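(* Let $d\geq 2$ and let $\Omega_1,\Omega_2\subset\mathbb{R}^d$ be bounded, connected open sets with Lipschitz boundary. Let $U:C(\overline{\Omega}_1)\to C(\overline{\Omega}_2)$ be a bounded linear operator satisfying the assumptions (a) $f\cdot g=0$ implies $(Uf)\cdot(Ug)=0$ for all $f,g\in C(\overline{\Omega}_1)$; and (b) $U(C_c^\infty(\Omega_1))\subset D(\Delta^\beta_{\Omega_2})$ for some $\beta\in C(\partial\Omega_2)$, and $U(\Delta f)=\Delta(Uf)$ for all $f\in C_c^\infty(\Omega_1)$; and (c) if $\omega\subset\Omega_2$ is open and $(Uf)|_\omega=0$ for all $f\in C_c^\infty(\Omega_1)$, then $\omega=\emptyset$. Suppose in addition that $\Omega_1$ is of class $C^1$. Then there exist an isometry $\tau:\mathbb{R}^d\to\mathbb{R}^d$ with $\tau(\Omega_2)=\Omega_1$ and a constant $c\in\mathbb{C}\setminus\{0\}$ such that $$Uf=c\,f\circ\tau\qquad\text{for all } f\in C(\overline\Omega_1).$$ In particular, $\Omega_1$ and $\Omega_2$ are congruent.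
   Context: Functions are complex-valued (the Robin coefficient $\beta$ is real-valued); $\Omega_1,\Omega_2$ are non-empty. An open set has Lipschitz boundary (is of class $C^1$) if its boundary is locally the graph of a Lipschitz ($C^1$) function with the set lying locally on one side of the graph. $C(\overline\Omega)$ carries the supremum norm. For a bounded open set $\Omega\subset\mathbb{R}^d$ with Lipschitz boundary let $\sigma$ be surface measure on $\partial\Omega$. For $u\in H^1(\Omega)$ with distributional Laplacian $\Delta u\in L^2(\Omega)$, the distributional outer normal derivative $\frac{\partial u}{\partial\nu}$ is the unique $h\in L^2(\partial\Omega)$, if it exists, with $\int_\Omega(\nabla u\cdot\overline{\nabla v}+\Delta u\,\overline v)\,dx=\int_{\partial\Omega}h\overline v\,d\sigma$ for all $v\in H^1(\Omega)$. For $\beta\in C(\partial\Omega)$ the Robin Laplacian on $C(\overline\Omega)$ is given by $D(\Delta^\beta_\Omega)=\{u\in H^1(\Omega)\cap C(\overline\Omega):\Delta u\in C(\overline\Omega),\ \frac{\partial u}{\partial\nu}\text{ exists in }L^2(\partial\Omega)\text{ and equals }-\beta u\}$, $\Delta^\beta_\Omega u=\Delta u$; $\beta\equiv0$ gives the Neumann Laplacian. Congruent means one set is the image of the other under an isometry of $\mathbb{R}^d$. *)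

theory Defs
  imports "HOL-Analysis.Analysis"
begin

definition partial_deriv ::
    "'a::euclidean_space \<Rightarrow> ('a \<Rightarrow> 'b::real_normed_vector) \<Rightarrow> 'a \<Rightarrow> 'b"
  where "partial_deriv i f x = frechet_derivative f (at x) i"

fun Ck :: "nat \<Rightarrow> ('a::euclidean_space \<Rightarrow> 'b::real_normed_vector) \<Rightarrow> bool"
  where
    "Ck 0 f \<longleftrightarrow> continuous_on UNIV f"
  | "Ck (Suc k) f \<longleftrightarrow>
       (\<forall>x. f differentiable (at x)) \<and> (\<forall>i\<in>Basis. Ck k (partial_deriv i f))"

definition test_functions :: "'a::euclidean_space set \<Rightarrow> ('a \<Rightarrow> complex) set"
  where "test_functions \<Omega> =
    {f. (\<forall>k. Ck k f) \<and> compact (closure {x. f x \<noteq> 0}) \<and> closure {x. f x \<noteq> 0} \<subseteq> \<Omega>}"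

definition laplacian :: "('a::euclidean_space \<Rightarrow> complex) \<Rightarrow> 'a \<Rightarrow> complex"
  where "laplacian f x = (\<Sum>i\<in>Basis. partial_deriv i (partial_deriv i f) x)"

text \<open>
  For a unit vector \<open>e\<close>, the graph of a function \<open>\<phi>\<close> over the hyperplane orthogonal to \<open>e\<close>
  is the set of all \<open>x\<close> with \<open>x \<bullet> e = \<phi> (x - (x \<bullet> e) *\<^sub>R e)\<close>. Only the values of \<open>\<phi>\<close> on
  that hyperplane matter; \<open>\<phi>\<close> is given on the whole space for convenience (a function on the
  hyperplane extends, with the same regularity, by composing with the orthogonal projection).
  The set lies on the side \<open>x \<bullet> e > \<phi> (\<dots>)\<close>; the other side is covered by passing to \<open>- e\<close>.
\<close>

definition boundary_locally_graph ::
    "(('a::euclidean_space \<Rightarrow> real) \<Rightarrow> bool) \<Rightarrow> 'a set \<Rightarrow> bool"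
  where "boundary_locally_graph R \<Omega> \<longleftrightarrow>
    (\<forall>z\<in>frontier \<Omega>. \<exists>e V \<phi>. norm e = 1 \<and> open V \<and> z \<in> V \<and> R \<phi> \<and>
       (\<forall>x\<in>V. (x \<in> frontier \<Omega> \<longleftrightarrow> x \<bullet> e = \<phi> (x - (x \<bullet> e) *\<^sub>R e)) \<and>
               (x \<in> \<Omega> \<longleftrightarrow> x \<bullet> e > \<phi> (x - (x \<bullet> e) *\<^sub>R e))))"

definition lipschitz_boundary :: "'a::euclidean_space set \<Rightarrow> bool"
  where "lipschitz_boundary = boundary_locally_graph (\<lambda>\<phi>. \<exists>L. L-lipschitz_on UNIV \<phi>)"

definition C1_boundary :: "'a::euclidean_space set \<Rightarrow> bool"
  where "C1_boundary = boundary_locally_graph (Ck 1)"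

text \<open>
  Surface measure is the (\<open>d\<close>-1)-dimensional Hausdorff measure, normalised so that it agrees
  with Lebesgue measure on hyperplanes. Empty sets in a cover cost nothing also when \<open>k = 0\<close>
  (where \<open>0 ^ 0 = 1\<close>), and boundedness is required because \<open>diameter\<close> is meaningful only
  for bounded sets.
\<close>

definition hausdorff_premeasure :: "nat \<Rightarrow> real \<Rightarrow> 'a::euclidean_space set \<Rightarrow> ennreal"
  where "hausdorff_premeasure k \<delta> A =
    (INF C \<in> {C :: nat \<Rightarrow> 'a set. A \<subseteq> (\<Union>n. C n) \<and> (\<forall>n. bounded (C n) \<and> diameter (C n) \<le> \<delta>)}.
       \<Sum>n. if C n = {} then 0
           else ennreal (unit_ball_vol (real k) * (diameter (C n) / 2) ^ k))"

definition hausdorff_outer_measure :: "nat \<Rightarrow> 'a::euclidean_space set \<Rightarrow> ennreal"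
  where "hausdorff_outer_measure k A = (SUP \<delta>\<in>{0<..}. hausdorff_premeasure k \<delta> A)"

text \<open>
  The outer measure is a metric outer measure, hence countably additive on the Borel sets, so
  \<open>measure_of\<close> does not fall back to its default value here.
\<close>

definition hausdorff_measure :: "nat \<Rightarrow> 'a::euclidean_space measure"
  where "hausdorff_measure k = measure_of UNIV (sets borel) (hausdorff_outer_measure k)"

definition surface_measure :: "'a::euclidean_space set \<Rightarrow> 'a measure"
  where "surface_measure \<Omega> = restrict_space (hausdorff_measure (DIM('a) - 1)) (frontier \<Omega>)"

text \<open>
  Elements of \<open>L\<^sup>2\<close> and \<open>H\<^sup>1\<close> are represented by functions; all notions below depend only on
  almost-everywhere classes (on \<open>\<Omega>\<close> with respect to Lebesgue measure, on the boundary with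
  respect to surface measure).
\<close>

definition L2 :: "'a measure \<Rightarrow> ('a \<Rightarrow> complex) set"
  where "L2 M = {f \<in> borel_measurable M. integrable M (\<lambda>x. (cmod (f x))\<^sup>2)}"

definition L2_tendsto :: "'a measure \<Rightarrow> (nat \<Rightarrow> 'a \<Rightarrow> complex) \<Rightarrow> ('a \<Rightarrow> complex) \<Rightarrow> bool"
  where "L2_tendsto M F f \<longleftrightarrow> (\<forall>n. F n \<in> L2 M) \<and> f \<in> L2 M \<and>
    (\<lambda>n. integral\<^sup>L M (\<lambda>x. (cmod (F n x - f x))\<^sup>2)) \<longlonglongrightarrow> 0"

text \<open>
  \<open>H1_gradient \<Omega> u G\<close>: the function \<open>u\<close> belongs to \<open>H\<^sup>1(\<Omega>)\<close> and \<open>G i\<close> is its weak partial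
  derivative in direction \<open>i\<close>, for every standard basis vector \<open>i\<close>.
\<close>

definition H1_gradient ::
    "'a::euclidean_space set \<Rightarrow> ('a \<Rightarrow> complex) \<Rightarrow> ('a \<Rightarrow> 'a \<Rightarrow> complex) \<Rightarrow> bool"
  where "H1_gradient \<Omega> u G \<longleftrightarrow> u \<in> L2 (lebesgue_on \<Omega>) \<and>
    (\<forall>i\<in>Basis. G i \<in> L2 (lebesgue_on \<Omega>) \<and>
       (\<forall>\<phi>\<in>test_functions \<Omega>.
          (LINT x|lebesgue_on \<Omega>. u x * partial_deriv i \<phi> x) =
          - (LINT x|lebesgue_on \<Omega>. G i x * \<phi> x)))"

definition H1 :: "'a::euclidean_space set \<Rightarrow> ('a \<Rightarrow> complex) set"
  where "H1 \<Omega> = {u. \<exists>G. H1_gradient \<Omega> u G}"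

definition H1_tendsto ::
    "'a::euclidean_space set \<Rightarrow> (nat \<Rightarrow> 'a \<Rightarrow> complex) \<Rightarrow> ('a \<Rightarrow> complex) \<Rightarrow> bool"
  where "H1_tendsto \<Omega> V v \<longleftrightarrow> L2_tendsto (lebesgue_on \<Omega>) V v \<and>
    (\<exists>GV G. (\<forall>n. H1_gradient \<Omega> (V n) (GV n)) \<and> H1_gradient \<Omega> v G \<and>
       (\<forall>i\<in>Basis. L2_tendsto (lebesgue_on \<Omega>) (\<lambda>n. GV n i) (G i)))"

definition distributional_laplacian ::
    "'a::euclidean_space set \<Rightarrow> ('a \<Rightarrow> complex) \<Rightarrow> ('a \<Rightarrow> complex) \<Rightarrow> bool"
  where "distributional_laplacian \<Omega> u w \<longleftrightarrow>
    u \<in> L2 (lebesgue_on \<Omega>) \<and> w \<in> L2 (lebesgue_on \<Omega>) \<and>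
    (\<forall>\<phi>\<in>test_functions \<Omega>.
       (LINT x|lebesgue_on \<Omega>. u x * laplacian \<phi> x) = (LINT x|lebesgue_on \<Omega>. w x * \<phi> x))"

text \<open>
  The trace operator from \<open>H\<^sup>1(\<Omega>)\<close> to \<open>L\<^sup>2(\<partial>\<Omega>)\<close> is the continuous extension of the restriction
  \<open>v \<mapsto> v|\<partial>\<Omega>\<close> of functions \<open>v \<in> H\<^sup>1(\<Omega>) \<inter> C(closure \<Omega>)\<close>; it is given here by its graph.
\<close>

definition has_trace ::
    "'a::euclidean_space set \<Rightarrow> ('a \<Rightarrow> complex) \<Rightarrow> ('a \<Rightarrow> complex) \<Rightarrow> bool"
  where "has_trace \<Omega> v t \<longleftrightarrow>
    (\<exists>V. (\<forall>n. V n \<in> H1 \<Omega> \<and> continuous_on (closure \<Omega>) (V n)) \<and>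
         H1_tendsto \<Omega> V v \<and> L2_tendsto (surface_measure \<Omega>) V t)"

text \<open>
  \<open>t\<close> is the trace of \<open>v\<close>, written \<open>v\<close> in the usual notation of the boundary integral; \<open>Gu\<close>,
  \<open>Gv\<close> are the gradients of \<open>u\<close>, \<open>v\<close> and \<open>w\<close> is the Laplacian of \<open>u\<close>.
\<close>

definition has_normal_derivative ::
    "'a::euclidean_space set \<Rightarrow> ('a \<Rightarrow> complex) \<Rightarrow> ('a \<Rightarrow> complex) \<Rightarrow> bool"
  where "has_normal_derivative \<Omega> u h \<longleftrightarrow> h \<in> L2 (surface_measure \<Omega>) \<and>
    (\<exists>Gu w. H1_gradient \<Omega> u Gu \<and> distributional_laplacian \<Omega> u w \<and>
       (\<forall>v Gv t. H1_gradient \<Omega> v Gv \<and> has_trace \<Omega> v t \<longrightarrow>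
          (LINT x|lebesgue_on \<Omega>. (\<Sum>i\<in>Basis. Gu i x * cnj (Gv i x)) + w x * cnj (v x)) =
          (LINT x|surface_measure \<Omega>. h x * cnj (t x))))"

text \<open>
  Elements of \<open>C(K)\<close> are represented by total functions that are continuous on \<open>K\<close> and are
  identified when they agree on \<open>K\<close>.
\<close>

definition C :: "'a::topological_space set \<Rightarrow> ('a \<Rightarrow> complex) set"
  where "C K = {f. continuous_on K f}"

definition sup_norm :: "'a set \<Rightarrow> ('a \<Rightarrow> complex) \<Rightarrow> real"
  where "sup_norm K f = (SUP x\<in>K. cmod (f x))"

text \<open>
  Linearity and boundedness together imply that \<open>U f\<close> on \<open>L\<close> depends only on \<open>f\<close> on \<open>K\<close>.
\<close>

definition bounded_linear_C ::
    "'a::topological_space set \<Rightarrow> 'b::topological_space set \<Rightarrow>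
     (('a \<Rightarrow> complex) \<Rightarrow> ('b \<Rightarrow> complex)) \<Rightarrow> bool"
  where "bounded_linear_C K L U \<longleftrightarrow>
    (\<forall>f\<in>C K. U f \<in> C L) \<and>
    (\<forall>f\<in>C K. \<forall>g\<in>C K. \<forall>x\<in>L. U (\<lambda>y. f y + g y) x = U f x + U g x) \<and>
    (\<forall>a. \<forall>f\<in>C K. \<forall>x\<in>L. U (\<lambda>y. a * f y) x = a * U f x) \<and>
    (\<exists>B. \<forall>f\<in>C K. sup_norm L (U f) \<le> B * sup_norm K f)"

definition robin_domain ::
    "'a::euclidean_space set \<Rightarrow> ('a \<Rightarrow> real) \<Rightarrow> ('a \<Rightarrow> complex) set"
  where "robin_domain \<Omega> \<beta> =
    {u \<in> H1 \<Omega> \<inter> C (closure \<Omega>).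
       (\<exists>w \<in> C (closure \<Omega>). distributional_laplacian \<Omega> u w) \<and>
       has_normal_derivative \<Omega> u (\<lambda>x. - complex_of_real (\<beta> x) * u x)}"

definition is_isometry :: "('a::metric_space \<Rightarrow> 'a) \<Rightarrow> bool"
  where "is_isometry \<tau> \<longleftrightarrow> (\<forall>x y. dist (\<tau> x) (\<tau> y) = dist x y)"

definition congruent_sets :: "'a::metric_space set \<Rightarrow> 'a set \<Rightarrow> bool"
  where "congruent_sets A B \<longleftrightarrow> (\<exists>\<tau>. is_isometry \<tau> \<and> \<tau> ` A = B)"

end

theory Submission
  imports Defs
begin

text \<open>
  Preserving disjointness, \<open>U\<close> is a weighted composition \<open>U f = h * (f \<circ> \<tau>)\<close>, and by (c) the set \<open>Y\<close> of the points of
  \<open>\<Omega>\<^sub>2\<close> with \<open>h y \<noteq> 0\<close> and \<open>\<tau> y \<in> \<Omega>\<^sub>1\<close> is dense in \<open>\<Omega>\<^sub>2\<close>. Applying the intertwining relation to the functions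
  \<open>\<bar>\<xi> - a\<bar> ^ (2 * k)\<close> and taking radial means shows that \<open>\<tau>\<close> is a local isometry and \<open>h\<close> is locally constant on \<open>Y\<close>.
  On a component \<open>E\<close> of \<open>Y\<close> the map \<open>\<tau>\<close> is therefore a global isometry \<open>T\<close>. By the Robin condition a boundary point of
  \<open>\<Omega>\<^sub>2\<close> in the closure of \<open>E\<close> cannot be sent into \<open>\<Omega>\<^sub>1\<close>, hence \<open>E = T -` \<Omega>\<^sub>1\<close>. So \<open>\<Omega>\<^sub>2\<close> is filled by
  finitely many copies of \<open>\<Omega>\<^sub>1\<close>; two adjacent ones would share a compact flat piece of boundary with no relative boundary,
  which the regularity of \<open>\<Omega>\<^sub>1\<close> excludes.
\<close>

subsection \<open>Smooth functions\<close>

text \<open>The obstacle throughout is that \<open>h\<close> and \<open>\<tau>\<close> are merely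
  continuous, so no chain rule is available: the intertwining relation is exploited only in weak
  form, tested with radial kernels. Powers of squared distances suit this because their Laplacians
  are again such powers; this makes all moments of the distances computable, and large exponents
  detect the largest distance. Two examples show what the remaining steps must exclude. If
  \<open>\<Omega>\<^sub>2\<close> is a proper open subset of \<open>\<Omega>\<^sub>1\<close> and
  \<open>U\<close> is restriction, then (a), (c) and the intertwining relation hold; only the Robin
  condition rules this out, which is why contact of the boundary of \<open>\<Omega>\<^sub>2\<close>
  with the interior of \<open>\<Omega>\<^sub>1\<close> has to be studied. Folding a rectangle with
  sides 2 and 1 onto the unit square gives an operator \<open>f \<mapsto> f \<circ> \<tau>\<close>
  with all of (a), (b), (c) although the domains are not congruent; so several copies do occur for
  Lipschitz domains, and the \<open>C^1\<close> hypothesis must enter through the way two copies can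
  share boundary.\<close>

lemma partial_deriv_eqI: "(f has_derivative D) (at x) \<Longrightarrow> partial_deriv i f x = D i"
  unfolding partial_deriv_def using frechet_derivative_at by metis

lemma partial_deriv_cong_open:
  assumes "open S" "x \<in> S" "\<And>y. y \<in> S \<Longrightarrow> f y = g y"
  shows "partial_deriv i f x = partial_deriv i g x"
proof -
  have "(f has_derivative D) (at x) \<longleftrightarrow> (g has_derivative D) (at x)" for D
    using assms by (metis has_derivative_transform_within_open)
  then show ?thesis unfolding partial_deriv_def frechet_derivative_def by simp
qed

lemma laplacian_cong_open:
  assumes "open S" "x \<in> S" "\<And>y. y \<in> S \<Longrightarrow> f y = g y"
  shows "laplacian f x = laplacian g x"
  unfolding laplacian_def
  by (intro sum.cong refl partial_deriv_cong_open[OF assms(1,2)] partial_deriv_cong_open[OF assms(1)] assms)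

lemma Ck_continuous: "Ck k f \<Longrightarrow> continuous_on UNIV f"
  by (cases k) (auto intro!: continuous_at_imp_continuous_on differentiable_imp_continuous_within)

text \<open>\<open>Ck\<close> recurses through \<open>frechet_derivative\<close>; naming the
  derivative \<open>D\<close> explicitly lets the closure properties below run by induction on the
  order with the usual rules of differentiation.\<close>

lemma Ck_SucI:
  assumes "\<And>x. (f has_derivative D x) (at x)" "\<And>i. i \<in> Basis \<Longrightarrow> Ck k (\<lambda>x. D x i)"
  shows "Ck (Suc k) f"
proof -
  have "partial_deriv i f = (\<lambda>x. D x i)" for i
    using partial_deriv_eqI[OF assms(1)] by auto
  then show ?thesis using assms by (auto simp: differentiable_def)
qed

lemma Ck_SucD:
  assumes "Ck (Suc k) f"
  shows "(f has_derivative frechet_derivative f (at x)) (at x)"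
    and "i \<in> Basis \<Longrightarrow> Ck k (\<lambda>x. frechet_derivative f (at x) i)"
  using assms by (auto simp: frechet_derivative_works[symmetric] partial_deriv_def[abs_def])

lemma Ck_lower: "Ck (Suc k) f \<Longrightarrow> Ck k f"
proof (induction k arbitrary: f)
  case 0
  then show ?case using Ck_continuous by (metis Ck.simps(1))
next
  case (Suc k)
  then show ?case by (subst Ck.simps) (metis Ck.simps(2))
qed

lemma Ck_const: "Ck k (\<lambda>_. c)"
proof (induction k arbitrary: c)
  case (Suc k)
  show ?case by (rule Ck_SucI[OF has_derivative_const]) (rule Suc)
qed auto

lemma Ck_linear: "bounded_linear T \<Longrightarrow> Ck k T"
proof (cases k)
  case (Suc n)
  assume "bounded_linear T"
  then show ?thesis unfolding Suc
    by (intro Ck_SucI[OF bounded_linear_imp_has_derivative] Ck_const)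
qed (auto intro: linear_continuous_on)

lemma Ck_add: "Ck k f \<Longrightarrow> Ck k g \<Longrightarrow> Ck k (\<lambda>x. f x + g x)"
proof (induction k arbitrary: f g)
  case (Suc k)
  show ?case
    by (rule Ck_SucI[OF has_derivative_add[OF Ck_SucD(1)[OF Suc.prems(1)] Ck_SucD(1)[OF Suc.prems(2)]]])
      (intro Suc.IH Ck_SucD(2) Suc.prems)
qed (auto intro: continuous_intros)

text \<open>The product rule leaves one factor undifferentiated in each term, so the induction also
  needs each factor at the lower order. One bilinear statement covers scalar multiples, products and
  inner products.\<close>

lemma Ck_prod:
  assumes bb: "bounded_bilinear m"
  shows "Ck k f \<Longrightarrow> Ck k g \<Longrightarrow> Ck k (\<lambda>x. m (f x) (g x))"
proof (induction k arbitrary: f g)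
  case (Suc k)
  show ?case
    by (rule Ck_SucI[OF bounded_bilinear.FDERIV[OF bb Ck_SucD(1)[OF Suc.prems(1)] Ck_SucD(1)[OF Suc.prems(2)]]])
      (intro Ck_add Suc.IH Ck_SucD(2) Suc.prems Ck_lower[OF Suc.prems(1)] Ck_lower[OF Suc.prems(2)]; assumption)
qed (auto intro: bounded_bilinear.continuous_on[OF bb])

lemmas Ck_scaleR = Ck_prod[OF bounded_bilinear_scaleR]
lemmas Ck_mult = Ck_prod[OF bounded_bilinear_mult]
lemmas Ck_inner = Ck_prod[OF bounded_bilinear_inner]

lemma Ck_bounded_linear_comp:
  assumes "bounded_linear T" shows "Ck k f \<Longrightarrow> Ck k (\<lambda>x. T (f x))"
proof (induction k arbitrary: f)
  case (Suc k)
  show ?case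
    by (rule Ck_SucI[OF bounded_linear.has_derivative[OF assms Ck_SucD(1)[OF Suc.prems]]])
      (intro Suc.IH Ck_SucD(2) Suc.prems)
qed (auto intro: bounded_linear.continuous_on[OF assms])

lemma Ck_compose_real:
  fixes f :: "real \<Rightarrow> 'b::real_normed_vector" and q :: "'a::euclidean_space \<Rightarrow> real"
  shows "Ck k f \<Longrightarrow> Ck k q \<Longrightarrow> Ck k (\<lambda>x. f (q x))"
proof (induction k arbitrary: f)
  case 0
  then show ?case by (auto intro: continuous_on_compose2[of UNIV])
next
  case (Suc k)
  let ?D = "\<lambda>x. frechet_derivative q (at x)"
  have D: "((\<lambda>x. f (q x)) has_derivative (\<lambda>v. frechet_derivative f (at (q x)) (?D x v))) (at x)" for x
    using has_derivative_compose[OF Ck_SucD(1)[OF Suc.prems(2)] Ck_SucD(1)[OF Suc.prems(1)]] .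
  \<comment> \<open>A linear map on the reals is multiplication by its value at \<open>1\<close>;
    this separates the two factors of the chain rule so that \<open>Ck_scaleR\<close>
    applies.\<close>
  have eq: "frechet_derivative f (at (q x)) (?D x v) = ?D x v *\<^sub>R frechet_derivative f (at (q x)) 1" for x v
    using linear_cmul[OF has_derivative_linear[OF Ck_SucD(1)[OF Suc.prems(1), of "q x"]], of "?D x v" 1] by simp
  show ?case
    by (rule Ck_SucI[OF D], unfold eq)
      (intro Ck_scaleR Ck_SucD(2) Suc.prems Suc.IH[OF Ck_SucD(2)[OF Suc.prems(1)]] Ck_lower[OF Suc.prems(2)]; simp)
qed

lemma Ck_realI:
  fixes g :: "real \<Rightarrow> real"
  assumes "\<And>x. (g has_real_derivative g' x) (at x)" "Ck k g'"
  shows "Ck (Suc k) g"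
  using assms(2)
  by (intro Ck_SucI[OF assms(1)[unfolded has_field_derivative_def]]) simp

definition smooth :: "('a::euclidean_space \<Rightarrow> 'b::real_normed_vector) \<Rightarrow> bool"
  where "smooth f \<longleftrightarrow> (\<forall>k. Ck k f)"

lemma smooth_partial: "smooth f \<Longrightarrow> i \<in> Basis \<Longrightarrow> smooth (partial_deriv i f)"
  unfolding smooth_def using Ck.simps(2) by blast

lemma smooth_has_derivative: "smooth f \<Longrightarrow> (f has_derivative frechet_derivative f (at x)) (at x)"
  unfolding smooth_def using Ck_SucD(1) by blast

lemma smooth_continuous_on: "smooth f \<Longrightarrow> continuous_on S f"
  unfolding smooth_def by (meson Ck_continuous continuous_on_subset subset_UNIV)

lemma smooth_measurable: "smooth (f :: 'a::euclidean_space \<Rightarrow> 'b::euclidean_space) \<Longrightarrow> f \<in> borel_measurable borel"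
  by (simp add: borel_measurable_continuous_onI smooth_continuous_on)

lemma smooth_const: "smooth (\<lambda>_. c)"
  and smooth_add: "smooth f \<Longrightarrow> smooth g \<Longrightarrow> smooth (\<lambda>x. f x + g x)"
  by (simp_all add: smooth_def Ck_const Ck_add)

lemma smooth_mult:
  "smooth f \<Longrightarrow> smooth g \<Longrightarrow> smooth (\<lambda>x. f x * g x :: 'b::real_normed_algebra)"
  by (simp add: smooth_def Ck_mult)

lemma smooth_inner: "smooth f \<Longrightarrow> smooth g \<Longrightarrow> smooth (\<lambda>x. f x \<bullet> g x)"
  by (simp add: smooth_def Ck_inner)

lemma smooth_linear: "bounded_linear T \<Longrightarrow> smooth T"
  by (simp add: smooth_def Ck_linear)

lemma smooth_bounded_linear_comp: "bounded_linear T \<Longrightarrow> smooth f \<Longrightarrow> smooth (\<lambda>x. T (f x))"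
  by (simp add: smooth_def Ck_bounded_linear_comp)

lemma smooth_compose_real:
  "smooth f \<Longrightarrow> smooth q \<Longrightarrow> smooth (\<lambda>x. (f :: real \<Rightarrow> _) (q x))"
  by (simp add: smooth_def Ck_compose_real)

lemma smooth_power: "smooth f \<Longrightarrow> smooth (\<lambda>x. f x ^ n :: 'b::real_normed_algebra_1)"
  by (induction n) (auto intro: smooth_mult smooth_const)

lemma smooth_sum: "(\<And>i. i \<in> I \<Longrightarrow> smooth (f i)) \<Longrightarrow> smooth (\<lambda>x. \<Sum>i\<in>I. f i x)"
  by (induction I rule: infinite_finite_induct) (auto intro: smooth_const smooth_add)

lemma smooth_diff_const: "smooth (\<lambda>x. x - c)"
  using smooth_add[OF smooth_linear[OF bounded_linear_ident] smooth_const[of "-c"]] by simp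

lemma smooth_norm_sq: "smooth (\<lambda>y. (norm (y - c))\<^sup>2 / r)"
proof -
  have "smooth (\<lambda>y. ((y - c) \<bullet> (y - c)) * (1 / r))"
    by (intro smooth_mult smooth_inner smooth_diff_const smooth_const)
  then show ?thesis by (simp add: power2_norm_eq_inner)
qed

lemma smooth_realI:
  fixes g :: "real \<Rightarrow> real"
  assumes "\<And>x. (g has_real_derivative g' x) (at x)" "smooth g'"
  shows "smooth g"
proof -
  have "Ck k g" for k
    using Ck_lower[OF Ck_realI[OF assms(1)]] assms(2) unfolding smooth_def by blast
  then show ?thesis by (simp add: smooth_def)
qed

lemma smooth_realE:
  fixes g :: "real \<Rightarrow> real"
  assumes "smooth g"
  obtains g' where "\<And>x. (g has_real_derivative g' x) (at x)" "smooth g'"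
proof
  have b: "(1::real) \<in> Basis" by simp
  show "smooth (partial_deriv 1 g)" using smooth_partial[OF assms b] .
  show "(g has_real_derivative partial_deriv 1 g x) (at x)" for x
  proof -
    have *: "(g has_derivative frechet_derivative g (at x)) (at x)" (is "(g has_derivative ?D) _")
      using smooth_has_derivative[OF assms] .
    have "?D h = partial_deriv 1 g x * h" for h
      using linear_cmul[OF has_derivative_linear[OF *], of h 1] by (simp add: partial_deriv_def mult.commute)
    then have "?D = (*) (partial_deriv 1 g x)" by auto
    then show ?thesis using * by (simp add: has_field_derivative_def)
  qed
qed

text \<open>The case \<open>n = 0\<close> is the classical function flat at the origin. The powers
  of \<open>t\<close> in the denominator are carried along because derivatives of members are linear
  combinations of members, which closes the induction on the order of smoothness.\<close>

definition flat_exp :: "nat \<Rightarrow> real \<Rightarrow> real"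
  where "flat_exp n t = (if t > 0 then exp (- (1 / t)) / t ^ n else 0)"

lemma flat_exp_tendsto_0: "(flat_exp n \<longlongrightarrow> 0) (at_right 0)"
proof -
  have "((\<lambda>x. x ^ n / exp x) \<longlongrightarrow> (0::real)) at_top" by (rule tendsto_power_div_exp_0)
  then have "((\<lambda>t. inverse t ^ n / exp (inverse t)) \<longlongrightarrow> (0::real)) (at_right 0)"
    by (rule filterlim_compose[OF _ filterlim_inverse_at_top_right])
  moreover have "\<forall>\<^sub>F t in at_right 0. inverse t ^ n / exp (inverse t) = flat_exp n t"
    by (auto simp: eventually_at_right_less flat_exp_def exp_minus field_simps
        intro!: eventually_at_rightI[of 0 1])
  ultimately show ?thesis by (rule Lim_transform_eventually)
qed

lemma flat_exp_deriv:
  "(flat_exp n has_real_derivative (flat_exp (n + 2) t - real n * flat_exp (n + 1) t)) (at t)"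
proof -
  consider "t > 0" | "t < 0" | "t = 0" by linarith
  then show ?thesis
  proof cases
    case 1
    have "((\<lambda>t. exp (- (1 / t)) / t ^ n) has_real_derivative
        (flat_exp (n + 2) t - real n * flat_exp (n + 1) t)) (at t)"
      using 1 apply (auto intro!: derivative_eq_intros simp: flat_exp_def field_simps power2_eq_square)
      by (cases n) (auto simp: field_simps power2_eq_square)
    then show ?thesis
      by (rule has_field_derivative_transform_within_open[where S="{0<..}"]) (use 1 in \<open>auto simp: flat_exp_def\<close>)
  next
    case 2
    have "((\<lambda>t. 0) has_real_derivative 0) (at t)" by simp
    then have "(flat_exp n has_real_derivative 0) (at t)"
      by (rule has_field_derivative_transform_within_open[where S="{..<0}"]) (use 2 in \<open>auto simp: flat_exp_def\<close>)
    then show ?thesis using 2 by (simp add: flat_exp_def)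
  next
    case 3
    \<comment> \<open>The left difference quotient vanishes and the right one is
      \<open>flat_exp (Suc n)\<close>, which tends to \<open>0\<close>.\<close>
    have "((\<lambda>h. (flat_exp n (0 + h) - flat_exp n 0) / h) \<longlongrightarrow> 0) (at 0)"
      unfolding filterlim_at_split
    proof
      show "((\<lambda>h. (flat_exp n (0 + h) - flat_exp n 0) / h) \<longlongrightarrow> 0) (at_left 0)"
        by (rule Lim_transform_eventually[OF tendsto_const])
          (auto intro!: eventually_at_leftI[of "-1" 0] simp: flat_exp_def)
      show "((\<lambda>h. (flat_exp n (0 + h) - flat_exp n 0) / h) \<longlongrightarrow> 0) (at_right 0)"
        by (rule Lim_transform_eventually[OF flat_exp_tendsto_0[of "Suc n"]])
          (auto intro!: eventually_at_rightI[of 0 1] simp: flat_exp_def)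
    qed
    then show ?thesis using 3 by (simp add: DERIV_def flat_exp_def)
  qed
qed

lemma smooth_flat_exp: "smooth (flat_exp n)"
proof -
  have "Ck k (flat_exp n)" for k
  proof (induction k arbitrary: n)
    case 0
    show ?case using DERIV_isCont[OF flat_exp_deriv] by (simp add: continuous_at_imp_continuous_on)
  next
    case (Suc k)
    have "Ck k (\<lambda>t. flat_exp (n + 2) t + (- real n) * flat_exp (n + 1) t)"
      by (intro Ck_add Ck_mult Ck_const Suc)
    then show ?case by (intro Ck_realI[OF flat_exp_deriv]) simp
  qed
  then show ?thesis by (simp add: smooth_def)
qed

lemma flat_exp_pos: "t > 0 \<Longrightarrow> flat_exp n t > 0" and flat_exp_zero: "t \<le> 0 \<Longrightarrow> flat_exp n t = 0"
  by (auto simp: flat_exp_def)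

lemma flat_exp_nonneg: "flat_exp n t \<ge> 0"
  by (auto simp: flat_exp_def)

subsection \<open>Radial profiles and mollifiers\<close>

text \<open>The argument \<open>s\<close> stands for a squared distance divided by a squared radius.
  Composed with a quadratic function, a profile gives a radial function that is smooth at its
  centre, and \<open>s = 1\<close> corresponds to the boundary of the ball.\<close>

definition radial_profile :: "(real \<Rightarrow> real) \<Rightarrow> bool"
  where "radial_profile g \<longleftrightarrow> smooth g \<and> (\<forall>s\<ge>1. g s = 0)"

lemma radial_profile_flat: "radial_profile (\<lambda>s. flat_exp 0 (1 - s))"
proof -
  have "smooth (\<lambda>s. 1 - s :: real)"
    using smooth_add[OF smooth_const[of 1] smooth_linear[OF bounded_linear_minus[OF bounded_linear_ident]]] by simp
  then show ?thesis
    unfolding radial_profile_def using smooth_compose_real[OF smooth_flat_exp] flat_exp_zero by auto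
qed

lemma radial_profile_mult_id: "radial_profile g \<Longrightarrow> radial_profile (\<lambda>s. s * g s)"
  by (simp add: radial_profile_def smooth_mult[OF smooth_linear[OF bounded_linear_ident]])

lemma radial_profile_bounded:
  fixes g :: "real \<Rightarrow> real"
  assumes "smooth g" "\<And>s. s \<ge> 1 \<Longrightarrow> g s = 0"
  shows "\<exists>B. \<forall>s\<ge>0. \<bar>g s\<bar> \<le> B"
proof -
  have "compact (g ` {0..1})"
    by (intro compact_continuous_image smooth_continuous_on assms) auto
  then obtain B where B: "\<And>x. x \<in> g ` {0..1} \<Longrightarrow> norm x \<le> B"
    using compact_imp_bounded bounded_iff by metis
  have "\<bar>g s\<bar> \<le> max B 0" if "s \<ge> 0" for s
    using B[of "g s"] assms(2)[of s] that by (cases "s \<le> 1") fastforce+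
  then show ?thesis by blast
qed

text \<open>\<open>G s\<close> is half the integral of \<open>g\<close> from \<open>s\<close> to
  \<open>1\<close>. The factor \<open>1 / 2\<close> cancels the \<open>2\<close> from
  differentiating the squared norm: the gradient of the radial function of \<open>G\<close> is minus
  that of \<open>g\<close> times \<open>(y - c) / r\<^sup>2\<close>.\<close>

lemma radial_profile_tail:
  assumes g: "radial_profile g"
  obtains G where "radial_profile G" "\<And>s. (G has_real_derivative - g s / 2) (at s)"
proof -
  have "isCont g x" for x
    using smooth_continuous_on[of g UNIV] g by (auto simp: radial_profile_def continuous_on_eq_continuous_at)
  then obtain H where "\<forall>x. (H has_vector_derivative g x) (at x)"
    using einterval_antiderivative[of "-\<infinity>" \<infinity> g] by auto
  then have H: "(H has_real_derivative g x) (at x)" for x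
    by (simp add: has_real_derivative_iff_has_vector_derivative)
  define G where "G s = (H 1 - H s) / 2" for s
  have D: "(G has_real_derivative - g s / 2) (at s)" for s
    unfolding G_def by (auto intro!: derivative_eq_intros H)
  have "smooth (\<lambda>s. (-1/2) * g s)"
    using g unfolding radial_profile_def by (intro smooth_mult smooth_const) auto
  then have "smooth G"
    by (intro smooth_realI[OF D]) simp
  moreover have "G s = 0" if "s \<ge> 1" for s
  proof -
    have "G s = G 1"
    proof (cases "s = 1")
      case False
      then obtain z where "1 < z" "G s - G 1 = (s - 1) * (- g z / 2)"
        using MVT2[of 1 s G "\<lambda>s. - g s / 2"] D \<open>s \<ge> 1\<close> by auto
      then show ?thesis using g by (simp add: radial_profile_def)
    qed auto
    then show ?thesis by (simp add: G_def)
  qed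
  ultimately show ?thesis using D by (intro that) (auto simp: radial_profile_def)
qed

section \<open>Differentiation under the integral sign\<close>

lemma has_vector_derivative_iff_quotient:
  "(f has_vector_derivative D) (at t) \<longleftrightarrow> ((\<lambda>s. (f s - f t) /\<^sub>R (s - t)) \<longlongrightarrow> D) (at t)"
proof -
  have eq: "norm (f s - f t - (s - t) *\<^sub>R D) / norm (s - t) = norm ((f s - f t) /\<^sub>R (s - t) - D)" if "s \<noteq> t" for s
  proof -
    have "f s - f t - (s - t) *\<^sub>R D = (s - t) *\<^sub>R ((f s - f t) /\<^sub>R (s - t) - D)"
      using that by (simp add: scaleR_diff_right)
    then show ?thesis using that by simp
  qed
  have "(f has_vector_derivative D) (at t) \<longleftrightarrow>
      ((\<lambda>s. norm (f s - f t - (s - t) *\<^sub>R D) / norm (s - t)) \<longlongrightarrow> 0) (at t)"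
    by (simp add: has_vector_derivative_def has_derivative_iff_norm bounded_linear_scaleR_left)
  also have "\<dots> \<longleftrightarrow> ((\<lambda>s. norm ((f s - f t) /\<^sub>R (s - t) - D)) \<longlongrightarrow> 0) (at t)"
    by (rule tendsto_cong) (use eq in \<open>auto simp: eventually_at intro!: exI[of _ 1]\<close>)
  finally show ?thesis
    by (simp add: tendsto_norm_zero_iff LIM_zero_iff)
qed

text \<open>Dominated convergence for the difference quotients along a sequence; the bound on
  \<open>F'\<close> passes to the quotients by the mean value inequality.\<close>

lemma deriv_under_integral:
  fixes F F' :: "real \<Rightarrow> 'b \<Rightarrow> complex"
  assumes t: "a < t" "t < b"
    and int: "\<And>s. a < s \<Longrightarrow> s < b \<Longrightarrow> integrable M (F s)"
    and der: "\<And>s x. a < s \<Longrightarrow> s < b \<Longrightarrow> ((\<lambda>s. F s x) has_vector_derivative F' s x) (at s)"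
    and bnd: "\<And>s x. a < s \<Longrightarrow> s < b \<Longrightarrow> norm (F' s x) \<le> B x" and B: "integrable M B"
    and meas: "F' t \<in> borel_measurable M"
  shows "((\<lambda>s. \<integral>x. F s x \<partial>M) has_vector_derivative (\<integral>x. F' t x \<partial>M)) (at t)"
  unfolding has_vector_derivative_iff_quotient tendsto_at_iff_sequentially
proof (intro allI impI)
  fix X :: "nat \<Rightarrow> real" assume X: "\<forall>i. X i \<in> UNIV - {t}" "X \<longlonglongrightarrow> t"
  have "\<forall>\<^sub>F i in sequentially. X i \<in> {a<..<b}"
    using topological_tendstoD[OF X(2), of "{a<..<b}"] t by simp
  then obtain N where N: "\<And>i. i \<ge> N \<Longrightarrow> X i \<in> {a<..<b}"
    by (auto simp: eventually_sequentially)
  \<comment> \<open>Dropping the first \<open>N\<close> terms puts every parameter into the interval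
    where the hypotheses hold.\<close>
  let ?q = "\<lambda>i x. (F (X (i + N)) x - F t x) /\<^sub>R (X (i + N) - t)"
  have "(\<lambda>i. \<integral>x. ?q i x \<partial>M) \<longlonglongrightarrow> (\<integral>x. F' t x \<partial>M)"
  proof (rule integral_dominated_convergence[OF meas _ B])
    show "?q i \<in> borel_measurable M" for i
      using borel_measurable_integrable[OF int[of "X (i + N)"]] borel_measurable_integrable[OF int[OF t]] N[of "i + N"]
      by auto
    show "AE x in M. (\<lambda>i. ?q i x) \<longlonglongrightarrow> F' t x"
    proof (intro always_eventually allI)
      fix x
      have "((\<lambda>s. (F s x - F t x) /\<^sub>R (s - t)) \<longlongrightarrow> F' t x) (at t)"
        using der[OF t] by (simp add: has_vector_derivative_iff_quotient)
      then have "(\<lambda>i. (F (X i) x - F t x) /\<^sub>R (X i - t)) \<longlonglongrightarrow> F' t x"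
        using X unfolding tendsto_at_iff_sequentially comp_def by blast
      then show "(\<lambda>i. ?q i x) \<longlonglongrightarrow> F' t x" by (rule LIMSEQ_ignore_initial_segment)
    qed
    show "AE x in M. norm (?q i x) \<le> B x" for i
    proof (intro always_eventually allI)
      fix x
      have "norm (F (X (i + N)) x - F t x) \<le> B x * norm (X (i + N) - t)"
      proof (rule differentiable_bound[of "{a<..<b}" "\<lambda>s. F s x" "\<lambda>s h. h *\<^sub>R F' s x"])
        show "((\<lambda>s. F s x) has_derivative (\<lambda>h. h *\<^sub>R F' s x)) (at s within {a<..<b})" if "s \<in> {a<..<b}" for s
          using der[of s x] that by (auto simp: has_vector_derivative_def intro: has_derivative_at_withinI)
        show "onorm (\<lambda>h. h *\<^sub>R F' s x) \<le> B x" if "s \<in> {a<..<b}" for s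
        proof (rule onorm_le)
          show "norm (h *\<^sub>R F' s x) \<le> B x * norm h" for h
            using mult_right_mono[OF bnd[of s x] norm_ge_zero[of h]] that by (simp add: mult.commute)
        qed
      qed (use N[of "i + N"] t in auto)
      moreover have "X (i + N) \<noteq> t" using X by auto
      ultimately show "norm (?q i x) \<le> B x" by (simp add: divide_simps)
    qed
  qed
  moreover have "(\<integral>x. ?q i x \<partial>M) = ((\<integral>x. F (X (i + N)) x \<partial>M) - (\<integral>x. F t x \<partial>M)) /\<^sub>R (X (i + N) - t)" for i
    using int[of "X (i + N)"] int[OF t] N[of "i + N"] by simp
  ultimately show "((\<lambda>s. ((\<integral>x. F s x \<partial>M) - (\<integral>x. F t x \<partial>M)) /\<^sub>R (s - t)) \<circ> X) \<longlonglongrightarrow> (\<integral>x. F' t x \<partial>M)"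
    by - (rule LIMSEQ_offset[where k=N], simp only: comp_def)
qed

lemma integrable_mult_bounded:
  fixes u v :: "'b \<Rightarrow> complex"
  assumes "integrable M u" "v \<in> borel_measurable M" "\<And>x. norm (v x) \<le> B"
  shows "integrable M (\<lambda>x. u x * v x)"
proof (rule Bochner_Integration.integrable_bound[of M "\<lambda>x. B * norm (u x)"])
  show "AE x in M. norm (u x * v x) \<le> norm (B * norm (u x))"
  proof (intro always_eventually allI)
    fix x
    have "norm (u x * v x) \<le> norm (u x) * B"
      using assms(3)[of x] by (simp add: norm_mult mult_left_mono)
    also have "\<dots> \<le> norm (B * norm (u x))" by (simp add: mult.commute)
    finally show "norm (u x * v x) \<le> norm (B * norm (u x))" .
  qed
qed (use assms in auto)

section \<open>Radial functions and their Laplacians\<close>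

definition radial :: "(real \<Rightarrow> real) \<Rightarrow> real \<Rightarrow> 'a::euclidean_space \<Rightarrow> 'a \<Rightarrow> complex"
  where "radial g r c y = complex_of_real (g ((norm (y - c))\<^sup>2 / r\<^sup>2))"

lemma smooth_radial: "smooth g \<Longrightarrow> smooth (radial g r c)"
  unfolding radial_def[abs_def]
  by (rule smooth_bounded_linear_comp[OF bounded_linear_of_real smooth_compose_real[of g, OF _ smooth_norm_sq]])

lemma radial_outside:
  assumes "\<forall>s\<ge>1. g s = 0" "0 < r" "dist c y \<ge> r" shows "radial g r c y = 0"
proof -
  have "r\<^sup>2 \<le> (norm (y - c))\<^sup>2" using assms by (auto simp: dist_norm norm_minus_commute intro: power_mono)
  then show ?thesis using assms by (simp add: radial_def)
qed

lemma smooth_test_functionI: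
  assumes "smooth f" "\<And>y. y \<notin> cball c r \<Longrightarrow> f y = 0" "cball c r \<subseteq> S"
  shows "f \<in> test_functions S"
proof -
  have "closure {x. f x \<noteq> 0} \<subseteq> cball c r"
    by (rule closure_minimal) (use assms(2) in blast, simp)
  moreover then have "compact (closure {x. f x \<noteq> 0})"
    by (metis bounded_cball bounded_subset closed_closure compact_eq_bounded_closed)
  ultimately show ?thesis
    using assms(1,3) unfolding test_functions_def smooth_def by auto
qed

lemma radial_test_function:
  assumes "radial_profile g" "0 < r" "cball c r \<subseteq> S"
  shows "radial g r c \<in> test_functions S"
  using assms radial_outside[of g r c] unfolding radial_profile_def
  by (intro smooth_test_functionI[OF smooth_radial, of g c r]) auto

lemma partial_deriv_radial:
  assumes "\<And>s. (g has_real_derivative g' s) (at s)"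
  shows "partial_deriv i (radial g r c) y = radial g' r c y * of_real (2 * ((y - c) \<bullet> i) / r\<^sup>2)"
proof -
  have q: "((\<lambda>y. (norm (y - c))\<^sup>2 / r\<^sup>2) has_derivative (\<lambda>v. 2 * ((y - c) \<bullet> v) / r\<^sup>2)) (at y)"
    unfolding power2_norm_eq_inner divide_inverse
    by (auto intro!: derivative_eq_intros simp: inner_commute algebra_simps)
  have "(radial g r c has_derivative (\<lambda>v. of_real (g' ((norm (y - c))\<^sup>2 / r\<^sup>2) * (2 * ((y - c) \<bullet> v) / r\<^sup>2)))) (at y)"
    unfolding radial_def[abs_def]
    by (intro has_derivative_of_real has_derivative_compose[OF q, of g "\<lambda>h. g' _ * h"] assms[unfolded has_field_derivative_def])
  from partial_deriv_eqI[OF this] show ?thesis by (simp add: radial_def)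
qed

text \<open>For \<open>s = |y - c|^2 / r^2\<close> the chain rule gives
  \<open>g'' |grad s|^2 + g' laplacian s\<close>, where \<open>|grad s|^2 = 4 s / r^2\<close> and
  \<open>laplacian s = 2 d / r^2\<close> in dimension \<open>d\<close>.\<close>

lemma laplacian_radial:
  fixes y :: "'a::euclidean_space"
  assumes g: "\<And>s. (g has_real_derivative g' s) (at s)" and g': "\<And>s. (g' has_real_derivative g'' s) (at s)"
    and r: "r \<noteq> 0"
  shows "laplacian (radial g r c) y =
    radial (\<lambda>s. 4 * s * g'' s + 2 * real DIM('a) * g' s) r c y / of_real (r\<^sup>2)"
proof -
  let ?s = "(norm (y - c))\<^sup>2 / r\<^sup>2"
  have q: "((\<lambda>y. (norm (y - c))\<^sup>2 / r\<^sup>2) has_derivative (\<lambda>v. 2 * ((y - c) \<bullet> v) / r\<^sup>2)) (at y)"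
    unfolding power2_norm_eq_inner divide_inverse
    by (auto intro!: derivative_eq_intros simp: inner_commute algebra_simps)
  have 2: "partial_deriv i (partial_deriv i (radial g r c)) y =
      of_real (g'' ?s * (4 * ((y - c) \<bullet> i)\<^sup>2 / (r\<^sup>2)\<^sup>2) + g' ?s * (2 / r\<^sup>2))" if "i \<in> Basis" for i
  proof -
    have eq: "partial_deriv i (radial g r c) =
        (\<lambda>y. of_real (g' ((norm (y - c))\<^sup>2 / r\<^sup>2) * (2 * ((y - c) \<bullet> i) / r\<^sup>2)))"
      using partial_deriv_radial[OF g, of i r c] by (auto simp: radial_def fun_eq_iff)
    have D: "((\<lambda>y. g' ((norm (y - c))\<^sup>2 / r\<^sup>2)) has_derivative (\<lambda>v. g'' ?s * (2 * ((y - c) \<bullet> v) / r\<^sup>2))) (at y)"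
      by (intro has_derivative_compose[OF q, of g' "\<lambda>h. g'' _ * h"] g'[unfolded has_field_derivative_def])
    have "((\<lambda>y. complex_of_real (g' ((norm (y - c))\<^sup>2 / r\<^sup>2) * (2 * ((y - c) \<bullet> i) / r\<^sup>2))) has_derivative
       (\<lambda>v. of_real (g' ?s * (2 * (v \<bullet> i) / r\<^sup>2) + g'' ?s * (2 * ((y - c) \<bullet> v) / r\<^sup>2) * (2 * ((y - c) \<bullet> i) / r\<^sup>2)))) (at y)"
      using r by (intro has_derivative_of_real has_derivative_mult D)
        (auto intro!: derivative_eq_intros simp: fun_eq_iff field_simps power2_eq_square)
    from partial_deriv_eqI[OF this, of i] have "partial_deriv i (partial_deriv i (radial g r c)) y =
       of_real (g' ?s * (2 * (i \<bullet> i) / r\<^sup>2) + g'' ?s * (2 * ((y - c) \<bullet> i) / r\<^sup>2) * (2 * ((y - c) \<bullet> i) / r\<^sup>2))"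
      unfolding eq .
    also have "g' ?s * (2 * (i \<bullet> i) / r\<^sup>2) + g'' ?s * (2 * ((y - c) \<bullet> i) / r\<^sup>2) * (2 * ((y - c) \<bullet> i) / r\<^sup>2) =
       g'' ?s * (4 * ((y - c) \<bullet> i)\<^sup>2 / (r\<^sup>2)\<^sup>2) + g' ?s * (2 / r\<^sup>2)"
      using that by (simp add: power2_eq_square)
    finally show ?thesis .
  qed
  have n: "(\<Sum>i\<in>Basis. ((y - c) \<bullet> i)\<^sup>2) = (norm (y - c))\<^sup>2"
    unfolding power2_norm_eq_inner by (simp add: euclidean_inner[of "y - c" "y - c"] power2_eq_square)
  have "laplacian (radial g r c) y =
      of_real (\<Sum>i\<in>Basis. g'' ?s * (4 * ((y - c) \<bullet> i)\<^sup>2 / (r\<^sup>2)\<^sup>2) + g' ?s * (2 / r\<^sup>2))"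
    unfolding laplacian_def using 2 by simp
  also have "(\<Sum>i\<in>Basis. g'' ?s * (4 * ((y - c) \<bullet> i)\<^sup>2 / (r\<^sup>2)\<^sup>2) + g' ?s * (2 / r\<^sup>2)) =
      4 / (r\<^sup>2)\<^sup>2 * g'' ?s * (\<Sum>i\<in>Basis. ((y - c) \<bullet> i)\<^sup>2) + real DIM('a) * (g' ?s * (2 / r\<^sup>2))"
    by (simp add: sum.distrib sum_distrib_left sum_distrib_right sum_divide_distrib mult_ac)
  also have "4 / (r\<^sup>2)\<^sup>2 * g'' ?s * (\<Sum>i\<in>Basis. ((y - c) \<bullet> i)\<^sup>2) + real DIM('a) * (g' ?s * (2 / r\<^sup>2)) =
      (4 * ?s * g'' ?s + 2 * real DIM('a) * g' ?s) / r\<^sup>2"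
    using r unfolding n by (simp add: field_simps power2_eq_square)
  finally show ?thesis
    unfolding radial_def[of "\<lambda>s. 4 * s * g'' s + 2 * real DIM('a) * g' s"] by simp
qed

text \<open>Only the scaling is normalised: it makes the mass independent of the radius, but the
  mass is not set to \<open>1\<close>, since a profile may be of any sign, or of zero mass, and
  several profiles have to be compared.\<close>

definition mollifier :: "(real \<Rightarrow> real) \<Rightarrow> real \<Rightarrow> 'a::euclidean_space \<Rightarrow> 'a \<Rightarrow> complex"
  where "mollifier g r c y = radial g r c y / of_real (r ^ DIM('a))"

lemma radial_cmult: "radial (\<lambda>s. a * g s) r c y = of_real a * radial g r c y"
  by (simp add: radial_def)

lemma radial_bounded:
  assumes "radial_profile g" shows "\<exists>B. \<forall>r c y. norm (radial g r c y) \<le> B"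
proof -
  obtain B where "\<And>s. s \<ge> 0 \<Longrightarrow> \<bar>g s\<bar> \<le> B"
    using radial_profile_bounded[of g] assms unfolding radial_profile_def by blast
  then show ?thesis unfolding radial_def by (intro exI[of _ B]) simp
qed

lemma radial_measurable: "smooth g \<Longrightarrow> radial g r c \<in> borel_measurable lebesgue"
  using smooth_measurable[OF smooth_radial, of g r c] by (auto intro: measurable_completion)

text \<open>
  The kernel \<open>\<rho>\<^sub>r y = g (\<bar>y - x\<bar>\<^sup>2 / r\<^sup>2) / r ^ DIM\<close> satisfies \<open>\<partial>\<rho>\<^sub>r / \<partial>r = r * laplacian \<rho>'\<^sub>r\<close>, where \<open>\<rho>'\<close> is formed with
  the tail \<open>G\<close> of \<open>g\<close>, so that \<open>G' = - g / 2\<close>.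
\<close>

lemma mean_value_deriv:
  fixes u w :: "'a::euclidean_space \<Rightarrow> complex"
  assumes u: "integrable lebesgue u" and w: "integrable lebesgue w"
    and weak: "(\<integral>y. u y * laplacian (radial G r x) y \<partial>lebesgue) = (\<integral>y. w y * radial G r x y \<partial>lebesgue)"
    and g: "radial_profile g" and G: "radial_profile G" and Gg: "\<And>s. (G has_real_derivative - g s / 2) (at s)"
    and r: "0 < r"
  shows "((\<lambda>r. \<integral>y. u y * mollifier g r x y \<partial>lebesgue) has_vector_derivative
    of_real r * (\<integral>y. w y * mollifier G r x y \<partial>lebesgue)) (at r)"
proof -
  let ?d = "DIM('a)"
  obtain g' where g': "\<And>s. (g has_real_derivative g' s) (at s)" and sg': "smooth g'"
    using g smooth_realE unfolding radial_profile_def by metis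
  have sg: "smooth g" using g by (simp add: radial_profile_def)
  \<comment> \<open>The profile of the radius derivative: differentiating
    \<open>g (n / r^2) / r ^ d\<close> in \<open>r\<close> gives \<open>k s / r ^ (d + 1)\<close>
    with \<open>s = n / r^2\<close>.\<close>
  define k where "k s = - (real ?d * g s + 2 * s * g' s)" for s
  have sk: "smooth k"
  proof -
    have "smooth (\<lambda>s. (- real ?d) * g s + (-2) * (s * g' s))"
      by (intro smooth_add smooth_mult smooth_const sg sg' smooth_linear bounded_linear_ident)
    then show ?thesis by (simp add: k_def[abs_def] algebra_simps)
  qed
  have k1: "k s = 0" if "s \<ge> 1" for s
  proof -
    have "k s = 0" if "s > 1" for s
    proof -
      have "((\<lambda>_. 0) has_real_derivative 0) (at s)" by simp
      then have "(g has_real_derivative 0) (at s)"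
        by (rule has_field_derivative_transform_within_open[where S="{1<..}"])
          (use that g in \<open>auto simp: radial_profile_def\<close>)
      then have "g' s = 0" using g' DERIV_unique by blast
      then show ?thesis using that g by (simp add: k_def radial_profile_def)
    qed
    \<comment> \<open>Vanishing of \<open>k\<close> beyond \<open>1\<close> carries over to
      \<open>1\<close> by continuity.\<close>
    moreover have "k 1 = 0"
    proof -
      have "(k \<longlongrightarrow> k 1) (at_right 1)"
        using smooth_continuous_on[OF sk, of UNIV]
        by (metis continuous_on_eq_continuous_at isCont_def UNIV_I open_UNIV filterlim_at_split)
      moreover have "(k \<longlongrightarrow> 0) (at_right 1)"
        by (rule Lim_transform_eventually[OF tendsto_const])
          (use \<open>\<And>s. s > 1 \<Longrightarrow> k s = 0\<close> in \<open>auto intro!: eventually_at_rightI[of 1 2]\<close>)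
      ultimately show ?thesis using tendsto_unique trivial_limit_at_right_real by blast
    qed
    ultimately show ?thesis using that by (cases "s = 1") auto
  qed
  have kp: "radial_profile k" using sk k1 by (simp add: radial_profile_def)
  let ?F' = "\<lambda>s y. u y * (radial k s x y / of_real (s ^ (?d + 1)))"
  obtain Bg where Bg: "\<And>r c y. norm (radial g r (c::'a) y) \<le> Bg" using radial_bounded[OF g] by blast
  obtain Bk where Bk: "\<And>r c y. norm (radial k r (c::'a) y) \<le> Bk" using radial_bounded[OF kp] by blast
  have Bk0: "Bk \<ge> 0" using Bk[of 0 0 0] norm_ge_zero order_trans by blast
  have "((\<lambda>r. \<integral>y. u y * mollifier g r x y \<partial>lebesgue) has_vector_derivative
     (\<integral>y. ?F' r y \<partial>lebesgue)) (at r)"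
  \<comment> \<open>The interval starting at \<open>r / 2\<close> stays away from radius
    \<open>0\<close>, which bounds the derivative of the kernel uniformly.\<close>
  proof (rule deriv_under_integral[where a="r/2" and b="r + 1" and B="\<lambda>y. norm (u y) * (Bk / (r/2) ^ (?d + 1))"])
    show "integrable lebesgue (\<lambda>y. u y * mollifier g s x y)" if "r / 2 < s" "s < r + 1" for s
      unfolding mollifier_def times_divide_eq_right
      by (intro integrable_divide_zero integrable_mult_bounded[OF u radial_measurable[OF sg] Bg])
    show "(\<lambda>y. ?F' r y) \<in> borel_measurable lebesgue"
      using borel_measurable_integrable[OF u] radial_measurable[OF sk] by measurable
    show "integrable lebesgue (\<lambda>y. norm (u y) * (Bk / (r / 2) ^ (?d + 1)))"
      using u by simp
    show "norm (?F' s y) \<le> norm (u y) * (Bk / (r / 2) ^ (?d + 1))" if "r / 2 < s" "s < r + 1" for s y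
    proof -
      have "norm (radial k s x y) / s ^ (?d + 1) \<le> Bk / (r / 2) ^ (?d + 1)"
        using that r Bk0 by (intro frac_le Bk power_mono) auto
      then have "norm (u y) * (norm (radial k s x y) / s ^ (?d + 1)) \<le> norm (u y) * (Bk / (r / 2) ^ (?d + 1))"
        by (intro mult_left_mono) auto
      moreover have "norm (?F' s y) = norm (u y) * (norm (radial k s x y) / s ^ (?d + 1))"
        using that r by (simp add: norm_mult norm_divide norm_power)
      ultimately show ?thesis by (simp only:)
    qed
    show "((\<lambda>s. u y * mollifier g s x y) has_vector_derivative ?F' s y) (at s)" if "r / 2 < s" "s < r + 1" for s y
    proof -
      let ?n = "(norm (y - x))\<^sup>2"
      have s: "s > 0" using that r by simp
      have "((\<lambda>s. g (?n / s\<^sup>2) / s ^ ?d) has_real_derivative k (?n / s\<^sup>2) / s ^ (?d + 1)) (at s)"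
      proof -
        have "((\<lambda>s. g (?n / s\<^sup>2)) has_real_derivative g' (?n / s\<^sup>2) * (- 2 * ?n / s ^ 3)) (at s)"
          by (rule DERIV_chain2[OF g'])
            (use s in \<open>auto intro!: derivative_eq_intros simp: field_simps power2_eq_square power3_eq_cube\<close>)
        then have "((\<lambda>s. g (?n / s\<^sup>2) / s ^ ?d) has_real_derivative
           (g' (?n / s\<^sup>2) * (- 2 * ?n / s ^ 3) * s ^ ?d - g (?n / s\<^sup>2) * (real ?d * s ^ (?d - 1))) / (s ^ ?d * s ^ ?d)) (at s)"
          by (rule DERIV_divide) (use s in \<open>auto intro!: derivative_eq_intros\<close>)
        moreover have "(g' (?n / s\<^sup>2) * (- 2 * ?n / s ^ 3) * s ^ ?d - g (?n / s\<^sup>2) * (real ?d * s ^ (?d - 1))) / (s ^ ?d * s ^ ?d)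
           = k (?n / s\<^sup>2) / s ^ (?d + 1)"
        proof -
          obtain n where "?d = Suc n" using DIM_positive[where 'a='a] by (metis gr0_implies_Suc)
          then show ?thesis using s by (simp add: k_def field_simps power2_eq_square power3_eq_cube)
        qed
        ultimately show ?thesis by simp
      qed
      then have "((\<lambda>s. complex_of_real (g (?n / s\<^sup>2) / s ^ ?d)) has_vector_derivative
          of_real (k (?n / s\<^sup>2) / s ^ (?d + 1))) (at s)"
        unfolding has_real_derivative_iff_has_vector_derivative
        by (rule bounded_linear.has_vector_derivative[OF bounded_linear_of_real])
      then show ?thesis
        unfolding mollifier_def radial_def
        by (intro bounded_linear.has_vector_derivative[OF bounded_linear_mult_right]) simp
    qed
  qed (use r in auto)
  moreover have "(\<integral>y. ?F' r y \<partial>lebesgue) = of_real r * (\<integral>y. w y * mollifier G r x y \<partial>lebesgue)"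
  proof -
    let ?\<psi> = "radial G r x"
    \<comment> \<open>Here \<open>G' = - g / 2\<close> and \<open>G'' = - g' / 2\<close>, so
      \<open>4 s G'' + 2 d G'\<close> is exactly \<open>k s\<close>.\<close>
    have "((\<lambda>s. - g s / 2) has_real_derivative - g' s / 2) (at s)" for s
      by (auto intro!: derivative_eq_intros g')
    from laplacian_radial[OF Gg this, of r x] r
    have l: "laplacian ?\<psi> y = radial k r x y / of_real (r\<^sup>2)" for y
      by (simp add: k_def[abs_def] algebra_simps)
    have "(\<integral>y. ?F' r y \<partial>lebesgue) = (\<integral>y. u y * laplacian ?\<psi> y * of_real (r\<^sup>2 / r ^ (?d + 1)) \<partial>lebesgue)"
      using r by (intro Bochner_Integration.integral_cong refl) (simp add: l)
    also have "\<dots> = (\<integral>y. w y * ?\<psi> y \<partial>lebesgue) * of_real (r\<^sup>2 / r ^ (?d + 1))"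
      using weak by simp
    also have "\<dots> = of_real r * (\<integral>y. w y * ?\<psi> y / of_real (r ^ ?d) \<partial>lebesgue)"
      using r by (simp add: power2_eq_square)
    finally show ?thesis by (simp add: mollifier_def)
  qed
  ultimately show ?thesis by simp
qed

subsection \<open>Integration by parts\<close>

lemma integral_lebesgue_translation:
  fixes f :: "'a::euclidean_space \<Rightarrow> complex"
  assumes "f \<in> borel_measurable borel"
  shows "(\<integral>x. f (c + x) \<partial>lebesgue) = (\<integral>x. f x \<partial>lebesgue)"
proof -
  have "(\<integral>x. f x \<partial>lborel) = (\<integral>x. f x \<partial>distr lborel borel ((+) c))" by (simp add: lborel_distr_plus)
  also have "\<dots> = (\<integral>x. f (c + x) \<partial>lborel)" using assms by (intro integral_distr) auto
  finally show ?thesis using assms by (simp add: integral_completion)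
qed

lemma integrable_lebesgue_bounded_support:
  fixes f :: "'a::euclidean_space \<Rightarrow> 'b::{second_countable_topology,banach}"
  assumes "f \<in> borel_measurable lebesgue" "\<And>x. norm (f x) \<le> B" "\<And>x. x \<notin> cball c R \<Longrightarrow> f x = 0"
  shows "integrable lebesgue f"
proof (rule integrableI_bounded_set[where A="cball c R" and B=B])
  show "emeasure lebesgue (cball c R) < \<infinity>"
    using emeasure_bounded_finite[of "cball c R"] by simp
qed (use assms in auto)

lemma integrable_indicator_cball:
  fixes c :: "'a::euclidean_space"
  shows "integrable lebesgue (\<lambda>y. indicator (cball c s) y * (b :: real))"
  using emeasure_bounded_finite[of "cball c s"] by (intro integrable_mult_left integrable_real_indicator) auto

lemma smooth_bounded:
  fixes f :: "'a::euclidean_space \<Rightarrow> complex"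
  assumes "smooth f" "\<And>x. x \<notin> cball c R \<Longrightarrow> f x = 0"
  shows "\<exists>B. \<forall>x. norm (f x) \<le> B"
proof -
  have "compact (f ` cball c R)"
    by (intro compact_continuous_image smooth_continuous_on assms) auto
  then obtain B where B: "\<And>x. x \<in> f ` cball c R \<Longrightarrow> norm x \<le> B"
    using compact_imp_bounded bounded_iff by metis
  have "norm (f x) \<le> max B 0" for x
    using B[of "f x"] assms(2)[of x] by (cases "x \<in> cball c R") fastforce+
  then show ?thesis by blast
qed

lemma smooth_measurable_lebesgue:
  fixes f :: "'a::euclidean_space \<Rightarrow> 'b::euclidean_space"
  shows "smooth f \<Longrightarrow> f \<in> borel_measurable lebesgue"
  using smooth_measurable[of f] by (auto intro: measurable_completion)

lemma smooth_integrable: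
  fixes f :: "'a::euclidean_space \<Rightarrow> complex"
  assumes "smooth f" "\<And>x. x \<notin> cball c R \<Longrightarrow> f x = 0"
  shows "integrable lebesgue f"
proof -
  obtain B where "\<And>x. norm (f x) \<le> B" using smooth_bounded[OF assms] by blast
  then show ?thesis
    by (rule integrable_lebesgue_bounded_support[OF smooth_measurable_lebesgue[OF assms(1)] _ assms(2)])
qed

lemma partial_deriv_const: "partial_deriv i (\<lambda>_. c) x = 0"
  using partial_deriv_eqI[OF has_derivative_const] .

lemma partial_deriv_outside:
  assumes "\<And>x. x \<notin> cball c R \<Longrightarrow> f x = 0" "x \<notin> cball c R"
  shows "partial_deriv i f x = 0"
  using partial_deriv_cong_open[of "- cball c R" x f "\<lambda>_. 0" i] assms by (auto simp: partial_deriv_const)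

text \<open>By translation invariance the integral of \<open>f (x + s *\<^sub>R i)\<close> is
  constant in \<open>s\<close>; its derivative at \<open>0\<close> is the integral in
  question.\<close>

lemma integral_partial_deriv_eq_0:
  fixes f :: "'a::euclidean_space \<Rightarrow> complex"
  assumes f: "smooth f" and R: "\<And>x. x \<notin> cball 0 R \<Longrightarrow> f x = 0" and i: "i \<in> Basis"
  shows "(\<integral>x. partial_deriv i f x \<partial>lebesgue) = 0"
proof -
  let ?p = "partial_deriv i f"
  have p: "smooth ?p" "\<And>x. x \<notin> cball 0 R \<Longrightarrow> ?p x = 0"
    using smooth_partial[OF f i] partial_deriv_outside[of 0 R f, OF R] by auto
  obtain B where B: "\<And>x. norm (?p x) \<le> B" using smooth_bounded[OF p] by blast
  \<comment> \<open>Shifts by less than \<open>1\<close> keep the support inside the ball of radius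
    \<open>R + 1\<close>, which carries the dominating function.\<close>
  have supp: "x + s *\<^sub>R i \<notin> cball 0 R" if "x \<notin> cball 0 (R + 1)" "-1 < s" "s < 1" for s x
  proof -
    have "norm x \<le> norm (x + s *\<^sub>R i) + norm (s *\<^sub>R i)"
      by (metis add_diff_cancel_right' norm_triangle_ineq4)
    then show ?thesis using that i by simp
  qed
  have sm: "smooth (\<lambda>x. g (x + s *\<^sub>R i))" if "smooth g" for g :: "'a \<Rightarrow> complex" and s
  proof -
    have "Ck k (\<lambda>x. g (x + v))" if "Ck k g" for k v and g :: "'a \<Rightarrow> complex" using that
    proof (induction k arbitrary: g)
      case 0
      then show ?case by (auto intro!: continuous_on_compose2[of UNIV g] continuous_intros)
    next
      case (Suc k)
      have "((\<lambda>x. g (x + v)) has_derivative frechet_derivative g (at (x + v))) (at x)" for x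
      proof -
        have "((\<lambda>x. x + v) has_derivative (\<lambda>h. h)) (at x)"
          by (auto intro!: derivative_eq_intros)
        from has_derivative_compose[OF this Ck_SucD(1)[OF Suc.prems]] show ?thesis by simp
      qed
      then show ?case by (rule Ck_SucI) (rule Suc.IH[OF Ck_SucD(2)[OF Suc.prems]])
    qed
    then show ?thesis using that unfolding smooth_def by blast
  qed
  have "((\<lambda>s. \<integral>x. f (x + s *\<^sub>R i) \<partial>lebesgue) has_vector_derivative (\<integral>x. ?p (x + 0 *\<^sub>R i) \<partial>lebesgue)) (at 0)"
  proof (rule deriv_under_integral[where a="-1" and b=1 and B="\<lambda>x. indicator (cball 0 (R + 1)) x * B"
        and F'="\<lambda>s x. ?p (x + s *\<^sub>R i)"])
    show "integrable lebesgue (\<lambda>x. f (x + s *\<^sub>R i))" if "-1 < s" "s < 1" for s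
      by (rule smooth_integrable[OF sm[OF f], of 0 "R + 1"]) (use supp that R in blast)
    show "((\<lambda>s. f (x + s *\<^sub>R i)) has_vector_derivative ?p (x + s *\<^sub>R i)) (at s)" for s x
    proof -
      have D: "(f has_derivative frechet_derivative f (at (x + s *\<^sub>R i))) (at (x + s *\<^sub>R i))" (is "(f has_derivative ?D) _")
        by (rule smooth_has_derivative[OF f])
      have "((\<lambda>s. x + s *\<^sub>R i) has_derivative (\<lambda>h. h *\<^sub>R i)) (at s)"
        by (auto intro!: derivative_eq_intros)
      from has_derivative_compose[OF this D]
      show ?thesis unfolding has_vector_derivative_def partial_deriv_def
        by (simp add: linear_cmul[OF has_derivative_linear[OF D]])
    qed
    show "norm (?p (x + s *\<^sub>R i)) \<le> indicator (cball 0 (R + 1)) x * B" if "-1 < s" "s < 1" for s x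
      using B[of "x + s *\<^sub>R i"] p(2)[OF supp[OF _ that]] by (cases "x \<in> cball 0 (R + 1)") auto
    show "integrable lebesgue (\<lambda>x. indicator (cball 0 (R + 1)) x * B :: real)"
      by (rule integrable_indicator_cball)
    show "(\<lambda>x. ?p (x + 0 *\<^sub>R i)) \<in> borel_measurable lebesgue"
      using smooth_measurable_lebesgue[OF p(1)] by simp
  qed auto
  moreover have "(\<lambda>s. \<integral>x. f (x + s *\<^sub>R i) \<partial>lebesgue) = (\<lambda>s. \<integral>x. f x \<partial>lebesgue)"
    using integral_lebesgue_translation[OF smooth_measurable[OF f]] by (subst add.commute) (rule ext)
  ultimately have "((\<lambda>s::real. \<integral>x. f x \<partial>lebesgue) has_vector_derivative (\<integral>x. ?p x \<partial>lebesgue)) (at 0)"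
    by simp
  then show ?thesis
    using vector_derivative_unique_at has_vector_derivative_const by blast
qed

lemma partial_deriv_mult:
  fixes f g :: "'a::euclidean_space \<Rightarrow> complex"
  assumes "smooth f" "smooth g"
  shows "partial_deriv i (\<lambda>x. f x * g x) x = f x * partial_deriv i g x + partial_deriv i f x * g x"
  using partial_deriv_eqI[OF has_derivative_mult[OF smooth_has_derivative[OF assms(1)] smooth_has_derivative[OF assms(2)]]]
  by (simp add: partial_deriv_def)

lemma smooth_laplacian: "smooth f \<Longrightarrow> smooth (laplacian f)"
  unfolding laplacian_def[abs_def] by (intro smooth_sum smooth_partial)

lemma laplacian_outside:
  assumes "\<And>x. x \<notin> cball c R \<Longrightarrow> f x = 0" "x \<notin> cball c R"
  shows "laplacian f x = 0"
  unfolding laplacian_def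
  by (intro sum.neutral ballI partial_deriv_outside[OF _ assms(2)] partial_deriv_outside[OF _ , of c R f] assms(1))

text \<open>The field \<open>f grad \<psi> - \<psi> grad f\<close> has the difference of the two
  integrands as its divergence, and its support is bounded by that of \<open>\<psi>\<close> alone;
  thus \<open>f\<close> may be a polynomial such as a power of a squared distance.\<close>

lemma green:
  fixes f \<psi> :: "'a::euclidean_space \<Rightarrow> complex"
  assumes f: "smooth f" and psi: "smooth \<psi>" and R: "\<And>x. x \<notin> cball 0 R \<Longrightarrow> \<psi> x = 0"
  shows "(\<integral>x. f x * laplacian \<psi> x \<partial>lebesgue) = (\<integral>x. laplacian f x * \<psi> x \<partial>lebesgue)"
proof -
  let ?p = "\<lambda>i f. partial_deriv i f"
  let ?v = "\<lambda>i x. f x * ?p i \<psi> x + (- 1) * (?p i f x * \<psi> x)"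
  have vs: "smooth (?v i)" if "i \<in> Basis" for i
    using that by (intro smooth_add smooth_mult smooth_const f psi smooth_partial)
  have v0: "?v i x = 0" if "x \<notin> cball 0 R" for i x
    using that R partial_deriv_outside[of 0 R \<psi>, OF R] by simp
  have pv: "?p i (?v i) x = f x * ?p i (?p i \<psi>) x - ?p i (?p i f) x * \<psi> x" if "i \<in> Basis" for i x
  proof -
    have "((\<lambda>x. f x * ?p i \<psi> x + (- 1) * (?p i f x * \<psi> x)) has_derivative
      (\<lambda>h. (f x * frechet_derivative (?p i \<psi>) (at x) h + frechet_derivative f (at x) h * ?p i \<psi> x) +
        (- 1) * (?p i f x * frechet_derivative \<psi> (at x) h + frechet_derivative (?p i f) (at x) h * \<psi> x))) (at x)"
      by (intro has_derivative_add has_derivative_mult_right has_derivative_mult smooth_has_derivative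
          f psi smooth_partial that)
    from partial_deriv_eqI[OF this, of i] show ?thesis
      by (simp only: partial_deriv_def[symmetric]) (simp add: algebra_simps)
  qed
  have int: "integrable lebesgue (\<lambda>x. f x * laplacian \<psi> x)" "integrable lebesgue (\<lambda>x. laplacian f x * \<psi> x)"
    by (rule smooth_integrable[where c=0 and R=R], intro smooth_mult smooth_laplacian f psi,
        use R laplacian_outside[of 0 R \<psi>, OF R] in auto)+
  have sum: "f x * laplacian \<psi> x - laplacian f x * \<psi> x = (\<Sum>i\<in>Basis. ?p i (?v i) x)" for x
  proof -
    have "(\<Sum>i\<in>Basis. ?p i (?v i) x) = (\<Sum>i\<in>Basis. f x * ?p i (?p i \<psi>) x - ?p i (?p i f) x * \<psi> x)"
      by (intro sum.cong refl pv)
    then show ?thesis by (simp only: laplacian_def sum_distrib_left sum_distrib_right sum_subtractf)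
  qed
  have "(\<integral>x. f x * laplacian \<psi> x - laplacian f x * \<psi> x \<partial>lebesgue) = (\<integral>x. (\<Sum>i\<in>Basis. ?p i (?v i) x) \<partial>lebesgue)"
    by (simp only: sum)
  also have "\<dots> = (\<Sum>i\<in>Basis. \<integral>x. ?p i (?v i) x \<partial>lebesgue)"
    by (intro Bochner_Integration.integral_sum smooth_integrable[where c=0 and R=R] smooth_partial vs
        partial_deriv_outside[of 0 R "?v _", OF v0]) auto
  also have "\<dots> = 0"
    using integral_partial_deriv_eq_0[OF vs v0] by simp
  finally show ?thesis using int by simp
qed

lemma test_functionE:
  assumes "\<psi> \<in> test_functions S"
  obtains R where "smooth \<psi>" "\<And>x. x \<notin> cball 0 R \<Longrightarrow> \<psi> x = 0"
    "\<And>x. x \<notin> S \<Longrightarrow> \<psi> x = 0" "\<And>x. x \<notin> S \<Longrightarrow> laplacian \<psi> x = 0" "\<And>x i. x \<notin> S \<Longrightarrow> partial_deriv i \<psi> x = 0"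
proof -
  let ?K = "closure {x. \<psi> x \<noteq> 0}"
  have K: "compact ?K" "?K \<subseteq> S" and s: "smooth \<psi>" using assms by (auto simp: test_functions_def smooth_def)
  obtain R where "\<And>x. x \<in> ?K \<Longrightarrow> norm x \<le> R"
    using compact_imp_bounded[OF K(1)] bounded_iff by metis
  then have R: "?K \<subseteq> cball 0 R" by auto
  have z: "\<psi> x = 0" if "x \<notin> ?K" for x using that closure_subset[of "{x. \<psi> x \<noteq> 0}"] by blast
  have o: "open (- ?K)" by (rule open_Compl[OF closed_closure])
  have p0: "partial_deriv i f x = 0" if "x \<notin> ?K" "\<And>x. x \<notin> ?K \<Longrightarrow> f x = 0" for f :: "_ \<Rightarrow> complex" and x i
  proof -
    have "partial_deriv i f x = partial_deriv i (\<lambda>_. 0) x"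
      by (rule partial_deriv_cong_open[OF o]) (use that in blast)+
    then show ?thesis by (simp only: partial_deriv_const)
  qed
  have l: "laplacian \<psi> x = 0" if "x \<notin> ?K" for x
    unfolding laplacian_def by (intro sum.neutral ballI p0[OF that] p0 z)
  have S: "x \<notin> ?K" if "x \<notin> S" for x using that K(2) by blast
  have C: "x \<notin> ?K" if "x \<notin> cball 0 R" for x using that R by blast
  show ?thesis
    by (rule that[OF s z[OF C] z[OF S] l[OF S] p0[OF S z]])
qed

text \<open>By \<open>mean_value_deriv\<close> the radius derivative of the mean is a mean of
  \<open>w\<close> against the tail of \<open>g\<close>, hence \<open>0\<close>. So the mean is
  constant in the radius, and it tends to \<open>0\<close> with the radius because \<open>u\<close>
  is continuous and vanishes at \<open>x\<close>. The hypothesis \<open>w0\<close> ranges over all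
  profiles because the tail replaces \<open>g\<close>.\<close>

lemma radial_mean_eq_0:
  fixes u w :: "'a::euclidean_space \<Rightarrow> complex"
  assumes u: "integrable lebesgue u" and w: "integrable lebesgue w"
    and weak: "\<And>\<psi>. \<psi> \<in> test_functions (ball x R) \<Longrightarrow>
      (\<integral>y. u y * laplacian \<psi> y \<partial>lebesgue) = (\<integral>y. w y * \<psi> y \<partial>lebesgue)"
    and cont: "isCont u x" "u x = 0"
    and w0: "\<And>G r. radial_profile G \<Longrightarrow> 0 < r \<Longrightarrow> r < R \<Longrightarrow> (\<integral>y. w y * mollifier G r x y \<partial>lebesgue) = 0"
    and g: "radial_profile g" and r: "0 < r" "r < R"
  shows "(\<integral>y. u y * mollifier g r x y \<partial>lebesgue) = 0"
proof -
  let ?I = "\<lambda>r. \<integral>y. u y * mollifier g r x y \<partial>lebesgue"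
  let ?d = "DIM('a)"
  obtain G where G: "radial_profile G" "\<And>s. (G has_real_derivative - g s / 2) (at s)"
    using radial_profile_tail[OF g] by blast
  have "\<exists>c. \<forall>s\<in>{0<..<R}. ?I s = c"
  proof (rule has_derivative_zero_constant)
    fix s assume s: "s \<in> {0<..<R}"
    then have "radial G s x \<in> test_functions (ball x R)"
      by (intro radial_test_function[OF G(1)]) auto
    from mean_value_deriv[OF u w weak[OF this] g G] have "(?I has_vector_derivative 0) (at s)"
      using w0[OF G(1), where r=s] s by simp
    then show "(?I has_derivative (\<lambda>h. 0)) (at s within {0<..<R})"
      by (auto simp: has_vector_derivative_def intro: has_derivative_at_withinI)
  qed auto
  then have const: "?I s = ?I r" if "0 < s" "s < R" for s using that r by force
  obtain B where B: "\<And>r c y. norm (radial g r (c::'a) y) \<le> B" using radial_bounded[OF g] by blast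
  have B0: "B \<ge> 0" using B[of 0 0 0] norm_ge_zero order_trans by blast
  have sg: "smooth g" using g by (simp add: radial_profile_def)
  \<comment> \<open>The factor \<open>1 / s ^ d\<close> of the kernel cancels against the volume of
    the ball, so the bound is uniform in the small radius \<open>s\<close>.\<close>
  have "norm (?I r) \<le> e * (B * unit_ball_vol ?d)" if e: "e > 0" for e
  proof -
    obtain d where d: "d > 0" "\<And>y. dist y x < d \<Longrightarrow> norm (u y) < e"
      using cont e unfolding continuous_at_eps_delta by (metis dist_norm diff_zero)
    define s where "s = min (d / 2) (R / 2)"
    have s: "0 < s" "s < d" "s < R" using d r by (auto simp: s_def min_def)
    have bound: "norm (u y * mollifier g s x y) \<le> indicator (cball x s) y * (e * (B / s ^ ?d))" for y
    proof (cases "y \<in> cball x s")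
      case True
      then have "norm (u y) \<le> e" using d(2)[of y] s by (auto simp: dist_commute)
      moreover have "norm (mollifier g s x y) \<le> B / s ^ ?d"
        using s B[of s x y] by (simp add: mollifier_def norm_divide norm_power divide_right_mono)
      ultimately have "norm (u y) * norm (mollifier g s x y) \<le> e * (B / s ^ ?d)"
        using e by (intro mult_mono) auto
      then show ?thesis using True by (simp add: norm_mult)
    next
      case False
      then show ?thesis using radial_outside[of g s x y] g s by (simp add: mollifier_def radial_profile_def)
    qed
    have "norm (?I s) \<le> (\<integral>y. indicator (cball x s) y * (e * (B / s ^ ?d)) \<partial>lebesgue)"
    proof (rule order_trans[OF integral_norm_bound integral_mono])
      show "integrable lebesgue (\<lambda>y. norm (u y * mollifier g s x y))"
        unfolding mollifier_def times_divide_eq_right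
        by (intro integrable_norm integrable_divide_zero integrable_mult_bounded[OF u radial_measurable[OF sg] B])
      show "integrable lebesgue (\<lambda>y. indicator (cball x s) y * (e * (B / s ^ ?d)))"
        by (rule integrable_indicator_cball)
    qed (use bound in auto)
    also have "\<dots> = measure lebesgue (cball x s) * (e * (B / s ^ ?d))"
      by simp
    also have "\<dots> = e * (B * unit_ball_vol ?d)"
      using s by (simp add: content_cball)
    finally show ?thesis using const s by simp
  qed
  then have *: "norm (?I r) \<le> e * (B * unit_ball_vol ?d)" if "e > 0" for e using that by blast
  have "norm (?I r) \<le> 0"
  proof (rule field_le_epsilon)
    fix e :: real assume e: "e > 0"
    have pos: "B * unit_ball_vol ?d + 1 > 0" using B0 by (simp add: add_nonneg_pos)
    have "norm (?I r) \<le> (e / (B * unit_ball_vol ?d + 1)) * (B * unit_ball_vol ?d)"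
      using e pos by (intro *) simp
    also have "\<dots> \<le> e" using e pos B0 by (simp add: field_simps)
    finally show "norm (?I r) \<le> 0 + e" by simp
  qed
  then show ?thesis by simp
qed

subsection \<open>Local rigidity of intertwining weighted compositions\<close>

text \<open>Extension by zero keeps every integral over the whole space, where translation
  invariance and the mean value formula are available.\<close>

definition restr :: "'a set \<Rightarrow> ('a \<Rightarrow> complex) \<Rightarrow> 'a \<Rightarrow> complex"
  where "restr A f y = (if y \<in> A then f y else 0)"

lemma restr_continuous_integrable:
  fixes f :: "'a::euclidean_space \<Rightarrow> complex"
  assumes "continuous_on (cball x R) f"
  shows "integrable lebesgue (restr (ball x R) f)"
proof -
  have "compact (f ` cball x R)" using assms by (intro compact_continuous_image) auto
  then obtain B where B: "\<And>y. y \<in> f ` cball x R \<Longrightarrow> norm y \<le> B"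
    using compact_imp_bounded bounded_iff by metis
  have "(\<lambda>y. indicator (ball x R) y *\<^sub>R f y) \<in> borel_measurable borel"
    by (intro borel_measurable_continuous_on_indicator continuous_on_subset[OF assms]) auto
  then have "restr (ball x R) f \<in> borel_measurable lebesgue"
    unfolding restr_def[abs_def] indicator_scaleR_eq_if by (auto intro: measurable_completion)
  then show ?thesis
  proof (rule integrable_lebesgue_bounded_support[where c=x and R=R and B="max B 0"])
    show "norm (restr (ball x R) f y) \<le> max B 0" for y
      using B[of "f y"] by (cases "y \<in> ball x R") (fastforce simp: restr_def)+
  qed (auto simp: restr_def)
qed

lemma integrable_restr_mult_smooth:
  fixes f :: "'a::euclidean_space \<Rightarrow> complex"
  assumes "continuous_on (cball x R) f" "smooth v" "\<And>y. y \<notin> cball c S \<Longrightarrow> v y = 0"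
  shows "integrable lebesgue (\<lambda>y. restr (ball x R) f y * v y)"
proof -
  obtain B where "\<And>y. norm (v y) \<le> B" using smooth_bounded[OF assms(2,3)] by blast
  then show ?thesis
    by (rule integrable_mult_bounded[OF restr_continuous_integrable[OF assms(1)] smooth_measurable_lebesgue[OF assms(2)]])
qed

text \<open>This is \<open>2 k (2 k - 2 + d)\<close>, the factor in the Laplacian of the
  \<open>2 k\<close>-th power of the distance in dimension \<open>d\<close>. It vanishes for
  \<open>k = 0\<close>, which makes the truncated \<open>k - 1\<close> harmless.\<close>

definition eigen_factor :: "'a::euclidean_space itself \<Rightarrow> nat \<Rightarrow> complex"
  where "eigen_factor _ k = of_real (real k * (4 * (real k - 1) + 2 * real DIM('a)))"

lemma smooth_real_power: "smooth (\<lambda>s::real. s ^ k)"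
  by (intro smooth_power smooth_linear bounded_linear_ident)

lemma laplacian_norm_power:
  fixes c :: "'a::euclidean_space"
  shows "laplacian (radial (\<lambda>s. s ^ k) 1 c) y = eigen_factor TYPE('a) k * radial (\<lambda>s. s ^ (k - 1)) 1 c y"
proof -
  have 1: "((\<lambda>s. s ^ k) has_real_derivative real k * s ^ (k - 1)) (at s)" for s
    by (auto intro!: derivative_eq_intros)
  have 2: "((\<lambda>s. real k * s ^ (k - 1)) has_real_derivative real k * (real (k - 1) * s ^ (k - 2))) (at s)" for s
    by (auto intro!: derivative_eq_intros simp: numeral_2_eq_2)
  have "4 * s * (real k * (real (k - 1) * s ^ (k - 2))) + 2 * real DIM('a) * (real k * s ^ (k - 1)) =
     (real k * (4 * (real k - 1) + 2 * real DIM('a))) * s ^ (k - 1)" for s :: real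
  proof (cases k)
    case (Suc n)
    then show ?thesis by (cases n) (auto simp: algebra_simps)
  qed auto
  then show ?thesis
    by (subst laplacian_radial[OF 1 2]) (simp_all add: radial_cmult eigen_factor_def)
qed

text \<open>Model case of the relation assumed in the locale below, with weight \<open>1\<close> and
  the identity in place of \<open>\<tau>\<close>; Green's formula applies because
  \<open>\<psi>\<close> vanishes outside the ball.\<close>

lemma weak_norm_power:
  fixes x c :: "'a::euclidean_space"
  assumes "\<psi> \<in> test_functions (ball x R)"
  shows "(\<integral>y. restr (ball x R) (radial (\<lambda>s. s ^ k) 1 c) y * laplacian \<psi> y \<partial>lebesgue) =
    eigen_factor TYPE('a) k * (\<integral>y. restr (ball x R) (radial (\<lambda>s. s ^ (k - 1)) 1 c) y * \<psi> y \<partial>lebesgue)"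
proof -
  obtain S where S: "smooth \<psi>" "\<And>x. x \<notin> cball 0 S \<Longrightarrow> \<psi> x = 0"
    "\<And>y. y \<notin> ball x R \<Longrightarrow> \<psi> y = 0" "\<And>y. y \<notin> ball x R \<Longrightarrow> laplacian \<psi> y = 0"
    using test_functionE[OF assms] by metis
  have "(\<integral>y. restr (ball x R) (radial (\<lambda>s. s ^ k) 1 c) y * laplacian \<psi> y \<partial>lebesgue)
     = (\<integral>y. radial (\<lambda>s. s ^ k) 1 c y * laplacian \<psi> y \<partial>lebesgue)"
    by (intro Bochner_Integration.integral_cong refl) (use S(4) in \<open>auto simp: restr_def\<close>)
  also have "\<dots> = (\<integral>y. laplacian (radial (\<lambda>s. s ^ k) 1 c) y * \<psi> y \<partial>lebesgue)"
    by (rule green[OF smooth_radial[OF smooth_real_power] S(1,2)])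
  also have "\<dots> = (\<integral>y. eigen_factor TYPE('a) k * (restr (ball x R) (radial (\<lambda>s. s ^ (k - 1)) 1 c) y * \<psi> y) \<partial>lebesgue)"
    by (intro Bochner_Integration.integral_cong refl)
      (use S(3) in \<open>auto simp: restr_def laplacian_norm_power mult.assoc\<close>)
  finally show ?thesis by simp
qed

lemma radial_norm_power: "radial (\<lambda>s. s ^ k) 1 c y = of_real ((dist y c)\<^sup>2 ^ k)"
  by (simp add: radial_def dist_norm)

lemma continuous_radial_norm_power: "continuous_on S (radial (\<lambda>s. s ^ k) 1 c)"
  by (intro smooth_continuous_on smooth_radial smooth_real_power)

lemma Re_times_of_real: "Re (z * complex_of_real a) = Re z * a"
  by simp

lemma isCont_gt_ball:
  fixes f :: "'a::metric_space \<Rightarrow> real"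
  assumes "isCont f z" "c < f z"
  obtains e where "e > 0" "\<And>y. y \<in> ball z e \<Longrightarrow> c < f y"
proof -
  have "\<forall>\<^sub>F y in nhds z. c < f y"
    using assms unfolding isCont_def tendsto_at_iff_tendsto_nhds by (rule order_tendstoD)
  then obtain e where "e > 0" "\<And>y. dist y z < e \<Longrightarrow> c < f y"
    unfolding eventually_nhds_metric by blast
  then show ?thesis by (intro that[of e]) (auto simp: dist_commute)
qed

lemma integral_ge_ball:
  fixes f :: "'a::euclidean_space \<Rightarrow> real"
  assumes "integrable lebesgue f" "\<And>y. f y \<ge> 0" "\<And>y. y \<in> ball z e \<Longrightarrow> f y \<ge> c"
  shows "c * measure lebesgue (ball z e) \<le> (\<integral>y. f y \<partial>lebesgue)"
proof -
  have "integrable lebesgue (\<lambda>y. indicator (ball z e) y * c)"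
    using emeasure_bounded_finite[of "ball z e"] by (intro integrable_mult_left integrable_real_indicator) auto
  then have "(\<integral>y. indicator (ball z e) y * c \<partial>lebesgue) \<le> (\<integral>y. f y \<partial>lebesgue)"
    by (rule integral_mono[OF _ assms(1)]) (use assms(2,3) in \<open>auto simp: indicator_def\<close>)
  then show ?thesis by (simp add: mult.commute)
qed

lemma measure_lebesgue_ball_pos: "e > 0 \<Longrightarrow> measure lebesgue (ball z e) > 0"
  by (simp add: content_ball_pos)

text \<open>Weak form of the intertwining relation for powers of the squared distance to
  \<open>a\<close>. All derivatives sit on the test function since \<open>h\<close> and
  \<open>\<tau>\<close> are only continuous. Centres are confined to the image of the ball because
  the powers will have to be cut off inside the first domain.\<close>

locale weak_intertwining =
  fixes x :: "'a::euclidean_space" and R :: real and h :: "'a \<Rightarrow> complex" and \<tau> :: "'a \<Rightarrow> 'a"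
  assumes R: "R > 0" and h: "continuous_on (cball x R) h" and \<tau>: "continuous_on (cball x R) \<tau>"
    and weak: "\<And>a k \<psi>. a \<in> \<tau> ` ball x R \<Longrightarrow> \<psi> \<in> test_functions (ball x R) \<Longrightarrow>
      (\<integral>y. restr (ball x R) (\<lambda>y. h y * of_real ((dist (\<tau> y) a)\<^sup>2 ^ k)) y * laplacian \<psi> y \<partial>lebesgue) =
      eigen_factor TYPE('a) k *
        (\<integral>y. restr (ball x R) (\<lambda>y. h y * of_real ((dist (\<tau> y) a)\<^sup>2 ^ (k - 1))) y * \<psi> y \<partial>lebesgue)"
begin

lemma continuous_power: "continuous_on (cball x R) (\<lambda>y. h y * of_real ((dist (\<tau> y) a)\<^sup>2 ^ k))"
  by (intro continuous_intros h \<tau>)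

lemma isCont_restr:
  assumes "continuous_on (cball x R) f" shows "isCont (restr (ball x R) f) x"
proof -
  have "isCont f x"
    using assms R by (metis ball_subset_cball centre_in_ball continuous_on_interior interior_cball)
  moreover have "\<forall>\<^sub>F y in nhds x. f y = restr (ball x R) f y"
    using R eventually_nhds_in_open[of "ball x R" x] by (auto simp: restr_def elim: eventually_mono)
  ultimately show ?thesis by (simp add: isCont_cong)
qed

text \<open>
  As the Laplacian of \<open>(dist y c)\<^sup>2 ^ k\<close> is \<open>eigen_factor k\<close> times its \<open>(k - 1)\<close>-st power, both terms
  obey the same recursion in \<open>k\<close>. Up to a factor, the derivative of the mean in \<open>r\<close> is the mean of the
  previous power, hence \<open>0\<close> by induction; as \<open>r\<close> tends to \<open>0\<close> the mean tends to a multiple of the value at \<open>x\<close>, also \<open>0\<close>.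
\<close>

lemma radial_mean_power:
  assumes "radial_profile g" "0 < r" "r < R"
  shows "(\<integral>y. restr (ball x R) (\<lambda>y. h y * of_real ((dist (\<tau> y) (\<tau> x))\<^sup>2 ^ k) - h x * of_real ((dist y x)\<^sup>2 ^ k)) y *
    mollifier g r x y \<partial>lebesgue) = 0"
  using assms
proof (induction k arbitrary: g r)
  let ?u = "\<lambda>k. restr (ball x R) (\<lambda>y. h y * of_real ((dist (\<tau> y) (\<tau> x))\<^sup>2 ^ k) - h x * of_real ((dist y x)\<^sup>2 ^ k))"
  have cont: "continuous_on (cball x R) (\<lambda>y. h y * of_real ((dist (\<tau> y) (\<tau> x))\<^sup>2 ^ k) - h x * of_real ((dist y x)\<^sup>2 ^ k))" for k
    by (intro continuous_intros h \<tau>)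
  have int: "integrable lebesgue (?u k)" for k by (rule restr_continuous_integrable[OF cont])
  have weak': "(\<integral>y. ?u k y * laplacian \<psi> y \<partial>lebesgue) = (\<integral>y. eigen_factor TYPE('a) k * ?u (k - 1) y * \<psi> y \<partial>lebesgue)"
    if psi: "\<psi> \<in> test_functions (ball x R)" for \<psi> k
  proof -
    obtain S where S: "smooth \<psi>" "\<And>x. x \<notin> cball 0 S \<Longrightarrow> \<psi> x = 0"
      using test_functionE[OF psi] by metis
    have L: "smooth (laplacian \<psi>)" "\<And>x. x \<notin> cball 0 S \<Longrightarrow> laplacian \<psi> x = 0"
      using smooth_laplacian[OF S(1)] laplacian_outside[of 0 S \<psi>, OF S(2)] by blast+
    have split: "(\<integral>y. ?u k y * v y \<partial>lebesgue) =
        (\<integral>y. restr (ball x R) (\<lambda>y. h y * of_real ((dist (\<tau> y) (\<tau> x))\<^sup>2 ^ k)) y * v y \<partial>lebesgue) -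
        h x * (\<integral>y. restr (ball x R) (radial (\<lambda>s. s ^ k) 1 x) y * v y \<partial>lebesgue)"
      if "v = \<psi> \<or> v = laplacian \<psi>" for v k
    proof -
      have that: "smooth v" "\<And>x. x \<notin> cball 0 S \<Longrightarrow> v x = 0" using L S that by blast+
      have "(\<integral>y. ?u k y * v y \<partial>lebesgue) = (\<integral>y. restr (ball x R) (\<lambda>y. h y * of_real ((dist (\<tau> y) (\<tau> x))\<^sup>2 ^ k)) y * v y
        - h x * (restr (ball x R) (radial (\<lambda>s. s ^ k) 1 x) y * v y) \<partial>lebesgue)"
        by (intro Bochner_Integration.integral_cong refl) (simp add: restr_def radial_norm_power algebra_simps)
      also have "\<dots> = (\<integral>y. restr (ball x R) (\<lambda>y. h y * of_real ((dist (\<tau> y) (\<tau> x))\<^sup>2 ^ k)) y * v y \<partial>lebesgue)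
        - (\<integral>y. h x * (restr (ball x R) (radial (\<lambda>s. s ^ k) 1 x) y * v y) \<partial>lebesgue)"
        by (intro Bochner_Integration.integral_diff integrable_mult_right
            integrable_restr_mult_smooth[OF continuous_power that]
            integrable_restr_mult_smooth[OF continuous_radial_norm_power that])
      finally show ?thesis by simp
    qed
    have "\<tau> x \<in> \<tau> ` ball x R" using R by simp
    then have "(\<integral>y. ?u k y * laplacian \<psi> y \<partial>lebesgue) =
        eigen_factor TYPE('a) k * (\<integral>y. restr (ball x R) (\<lambda>y. h y * of_real ((dist (\<tau> y) (\<tau> x))\<^sup>2 ^ (k - 1))) y * \<psi> y \<partial>lebesgue) -
        h x * (eigen_factor TYPE('a) k * (\<integral>y. restr (ball x R) (radial (\<lambda>s. s ^ (k - 1)) 1 x) y * \<psi> y \<partial>lebesgue))"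
      by (simp only: split[OF disjI2[OF refl]] weak[OF _ psi] weak_norm_power[OF psi])
    also have "\<dots> = eigen_factor TYPE('a) k * (\<integral>y. ?u (k - 1) y * \<psi> y \<partial>lebesgue)"
      unfolding split[OF disjI1[OF refl]] by (simp only: right_diff_distrib mult.left_commute)
    also have "\<dots> = (\<integral>y. eigen_factor TYPE('a) k * ?u (k - 1) y * \<psi> y \<partial>lebesgue)"
      by (simp only: integral_mult_right_zero mult.assoc)
    finally show ?thesis .
  qed
  {
    \<comment> \<open>For \<open>k = 0\<close> the factor vanishes: \<open>h - h x\<close> is weakly
      harmonic and vanishes at \<open>x\<close>.\<close>
    case 0
    show ?case
      by (rule radial_mean_eq_0[where w="\<lambda>_. 0" and R=R, OF int[of 0] _ _ isCont_restr[OF cont[of 0]]])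
        (use weak'[of _ 0] 0 in \<open>auto simp: eigen_factor_def restr_def\<close>)
  next
    case (Suc k)
    show ?case
    proof (rule radial_mean_eq_0[where w="\<lambda>y. eigen_factor TYPE('a) (Suc k) * ?u k y" and R=R, OF int[of "Suc k"] _ _ isCont_restr[OF cont[of "Suc k"]]])
      show "(\<integral>y. eigen_factor TYPE('a) (Suc k) * ?u k y * mollifier G r x y \<partial>lebesgue) = 0"
        if "radial_profile G" "0 < r" "r < R" for G r
        using Suc.IH[OF that] by (simp add: mult.assoc)
      show "integrable lebesgue (\<lambda>y. eigen_factor TYPE('a) (Suc k) * ?u k y)"
        by (intro integrable_mult_right int)
    qed (use weak'[of _ "Suc k"] Suc.prems in \<open>auto simp: restr_def\<close>)
  }
qed

text \<open>The integrated function vanishes at \<open>x\<close>, and its weak Laplacian is a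
  multiple of \<open>h - h x\<close>, whose radial means vanish by the case \<open>k = 0\<close>
  above. Centres other than \<open>\<tau> x\<close> are what polarisation will require.\<close>

lemma radial_mean_shifted:
  assumes g: "radial_profile g" and r: "0 < r" "r < R" and a: "a \<in> \<tau> ` ball x R"
  shows "(\<integral>y. restr (ball x R) (\<lambda>y. h y * of_real ((dist (\<tau> y) a)\<^sup>2) - h x * of_real ((dist (\<tau> x) a)\<^sup>2) -
      h x * of_real ((dist y x)\<^sup>2)) y * mollifier g r x y \<partial>lebesgue) = 0"
proof -
  let ?f = "\<lambda>y. h y * of_real ((dist (\<tau> y) a)\<^sup>2) - h x * of_real ((dist (\<tau> x) a)\<^sup>2) - h x * of_real ((dist y x)\<^sup>2)"
  let ?w = "restr (ball x R) (\<lambda>y. h y * of_real ((dist (\<tau> y) (\<tau> x))\<^sup>2 ^ 0) - h x * of_real ((dist y x)\<^sup>2 ^ 0))"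
  have cont: "continuous_on (cball x R) ?f" by (intro continuous_intros h \<tau>)
  have int: "integrable lebesgue (restr (ball x R) ?f)" by (rule restr_continuous_integrable[OF cont])
  have intw: "integrable lebesgue ?w" by (intro restr_continuous_integrable continuous_intros h \<tau>)
  have weak': "(\<integral>y. restr (ball x R) ?f y * laplacian \<psi> y \<partial>lebesgue) = (\<integral>y. eigen_factor TYPE('a) 1 * ?w y * \<psi> y \<partial>lebesgue)"
    if psi: "\<psi> \<in> test_functions (ball x R)" for \<psi>
  proof -
    obtain S where S: "smooth \<psi>" "\<And>x. x \<notin> cball 0 S \<Longrightarrow> \<psi> x = 0"
      using test_functionE[OF psi] by metis
    have L: "smooth (laplacian \<psi>)" "\<And>x. x \<notin> cball 0 S \<Longrightarrow> laplacian \<psi> x = 0"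
      using smooth_laplacian[OF S(1)] laplacian_outside[of 0 S \<psi>, OF S(2)] by blast+
    let ?q = "\<lambda>k. restr (ball x R) (\<lambda>y. h y * of_real ((dist (\<tau> y) a)\<^sup>2 ^ k))"
    let ?p = "\<lambda>k. restr (ball x R) (radial (\<lambda>s. s ^ k) 1 x)"
    have i: "integrable lebesgue (\<lambda>y. ?q k y * laplacian \<psi> y)" "integrable lebesgue (\<lambda>y. ?q k y * \<psi> y)"
      "integrable lebesgue (\<lambda>y. ?p k y * laplacian \<psi> y)" "integrable lebesgue (\<lambda>y. ?p k y * \<psi> y)" for k
      by (intro integrable_restr_mult_smooth[where c=0 and S=S] continuous_power continuous_radial_norm_power;
          use L S in blast)+
    have "(\<integral>y. restr (ball x R) ?f y * laplacian \<psi> y \<partial>lebesgue) =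
      (\<integral>y. ?q 1 y * laplacian \<psi> y - (h x * of_real ((dist (\<tau> x) a)\<^sup>2)) * (?p 0 y * laplacian \<psi> y) - h x * (?p 1 y * laplacian \<psi> y) \<partial>lebesgue)"
      by (intro Bochner_Integration.integral_cong refl) (simp add: restr_def radial_norm_power[of 0, simplified] radial_norm_power[of 1, simplified] algebra_simps)
    also have "\<dots> = (\<integral>y. ?q 1 y * laplacian \<psi> y \<partial>lebesgue) -
        (h x * of_real ((dist (\<tau> x) a)\<^sup>2)) * (\<integral>y. ?p 0 y * laplacian \<psi> y \<partial>lebesgue) - h x * (\<integral>y. ?p 1 y * laplacian \<psi> y \<partial>lebesgue)"
      by (simp only: Bochner_Integration.integral_diff Bochner_Integration.integrable_diff integrable_mult_right integral_mult_right_zero i)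
    also have "\<dots> = eigen_factor TYPE('a) 1 * (\<integral>y. ?q 0 y * \<psi> y \<partial>lebesgue) -
        h x * (eigen_factor TYPE('a) 1 * (\<integral>y. ?p 0 y * \<psi> y \<partial>lebesgue))"
      using weak[OF a psi, of 1] weak_norm_power[OF psi, of 1 x] weak_norm_power[OF psi, of 0 x]
      by (simp add: eigen_factor_def[of _ 0])
    also have "\<dots> = (\<integral>y. eigen_factor TYPE('a) 1 * (?q 0 y * \<psi> y) - h x * (eigen_factor TYPE('a) 1 * (?p 0 y * \<psi> y)) \<partial>lebesgue)"
      by (simp only: Bochner_Integration.integral_diff Bochner_Integration.integrable_diff integrable_mult_right integral_mult_right_zero i)
    also have "\<dots> = (\<integral>y. eigen_factor TYPE('a) 1 * ?w y * \<psi> y \<partial>lebesgue)"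
      by (intro Bochner_Integration.integral_cong refl) (simp add: restr_def radial_norm_power[of 0, simplified] radial_norm_power[of 1, simplified] algebra_simps)
    finally show ?thesis .
  qed
  show ?thesis
  proof (rule radial_mean_eq_0[where w="\<lambda>y. eigen_factor TYPE('a) 1 * ?w y" and R=R, OF int _ _ isCont_restr[OF cont] _ _ g r])
    show "(\<integral>y. eigen_factor TYPE('a) 1 * ?w y * mollifier G r x y \<partial>lebesgue) = 0"
      if "radial_profile G" "0 < r" "r < R" for G r
      using radial_mean_power[OF that, of 0] by (simp add: mult.assoc)
    show "integrable lebesgue (\<lambda>y. eigen_factor TYPE('a) 1 * ?w y)"
      by (intro integrable_mult_right intw)
  qed (use weak' in \<open>auto simp: restr_def\<close>)
qed

text \<open>
  All moments of \<open>(dist (\<tau> y) (\<tau> x))\<^sup>2\<close> with weight \<open>Re (h y / h x)\<close>, bounded below by \<open>1 / 2\<close>, equal those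
  of \<open>(dist y x)\<^sup>2\<close>, which is at most \<open>r\<^sup>2\<close> on the support of the mollifier: letting \<open>k\<close> grow shows that \<open>\<tau>\<close> does not
  increase distances from \<open>x\<close>. The moments for \<open>k = 0\<close> and \<open>k = 1\<close> then force equality.
\<close>

lemma local_isometry:
  assumes hx: "h x \<noteq> 0" and re: "\<And>y. y \<in> ball x R \<Longrightarrow> Re (h y / h x) \<ge> 1 / 2"
    and y: "y \<in> ball x R"
  shows "dist (\<tau> y) (\<tau> x) = dist y x"
proof -
  define g where "g s = flat_exp 0 (1 - s)" for s
  have g: "radial_profile g" unfolding g_def[abs_def] by (rule radial_profile_flat)
  have g0: "g s \<ge> 0" for s by (simp add: g_def flat_exp_nonneg)
  have gp: "g s > 0" if "s < 1" for s using that by (simp add: g_def flat_exp_pos)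
  let ?d = "DIM('a)"
  define \<rho> where "\<rho> r y = g ((norm (y - x))\<^sup>2 / r\<^sup>2) / r ^ ?d" for r y
  have rho: "mollifier g r x y = of_real (\<rho> r y)" for r y
    by (simp add: mollifier_def radial_def \<rho>_def)
  have rho0: "\<rho> r y \<ge> 0" if "r > 0" for r y using g0 that by (simp add: \<rho>_def)
  have rhop: "\<rho> r y > 0" if "r > 0" "dist x y < r" for r y
  proof -
    have "(norm (y - x))\<^sup>2 < r\<^sup>2"
      using that by (auto simp: dist_norm norm_minus_commute intro: power_strict_mono)
    then show ?thesis using gp that by (simp add: \<rho>_def)
  qed
  have rhoout: "\<rho> r y = 0" if "r > 0" "dist x y \<ge> r" for r y
    using radial_outside[of g r x y] that g by (simp add: \<rho>_def radial_def radial_profile_def)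
  have sm: "smooth (\<rho> r)" for r
  proof -
    have "smooth (\<lambda>y. g ((norm (y - x))\<^sup>2 / r\<^sup>2) * (1 / r ^ ?d))"
      using g by (intro smooth_mult smooth_const smooth_compose_real[OF _ smooth_norm_sq]) (simp add: radial_profile_def)
    then show ?thesis by (simp add: \<rho>_def[abs_def])
  qed
  let ?t = "\<lambda>y. (dist (\<tau> y) (\<tau> x))\<^sup>2" and ?q = "\<lambda>y. (dist y x)\<^sup>2"
  have cre: "continuous_on (cball x R) (\<lambda>y. Re (h y / h x))"
    using hx by (intro continuous_intros h) auto
  have real_mean: "integrable lebesgue (\<lambda>y. if y \<in> ball x R then Re (F y / h x) * \<rho> r y else 0) \<and>
      (\<integral>y. (if y \<in> ball x R then Re (F y / h x) * \<rho> r y else 0) \<partial>lebesgue) = 0"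
    if F: "continuous_on (cball x R) F" and r: "0 < r" "r < R"
      and 0: "(\<integral>y. restr (ball x R) F y * mollifier g r x y \<partial>lebesgue) = 0" for F r
  proof -
    have eq: "(if y \<in> ball x R then Re (F y / h x) * \<rho> r y else 0) = Re (restr (ball x R) F y * mollifier g r x y * (1 / h x))" for y
    proof -
      have "restr (ball x R) F y * mollifier g r x y * (1 / h x) =
          (if y \<in> ball x R then (F y / h x) * of_real (\<rho> r y) else 0)"
        by (simp add: restr_def rho)
      then show ?thesis by (simp only: if_distrib[of Re] Re_times_of_real) simp
    qed
    have int: "integrable lebesgue (\<lambda>y. restr (ball x R) F y * mollifier g r x y * (1 / h x))"
    proof (intro integrable_mult_left integrable_restr_mult_smooth[OF F, of _ x r])
      show "smooth (mollifier g r x)"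
        using smooth_bounded_linear_comp[OF bounded_linear_of_real sm] by (simp add: rho[abs_def])
    qed (use rhoout r in \<open>auto simp: rho\<close>)
    show ?thesis
      unfolding eq using int 0 by (simp add: integral_Re)
  qed
  have le: "dist (\<tau> y1) (\<tau> x) \<le> r" if y1: "dist x y1 < r" and r: "r < R" for y1 r
  proof (rule ccontr)
    assume "\<not> ?thesis"
    then have gt: "dist (\<tau> y1) (\<tau> x) > r" by simp
    have r0: "r > 0" using y1 zero_le_dist[of x y1] by linarith
    \<comment> \<open>On a small ball around \<open>y1\<close> the squared distance exceeds
      \<open>m\<close> and the kernel exceeds \<open>c\<close>, so the \<open>k\<close>-th moment is
      at least a constant times \<open>m ^ k\<close>; it is also at most
      \<open>(r\<^sup>2) ^ k\<close> times the mass of the kernel.\<close>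
    obtain m where m: "r\<^sup>2 < m" "m < ?t y1"
      using dense[OF power_strict_mono[OF gt, of 2]] r0 by auto
    define c where "c = \<rho> r y1 / 2"
    have c: "c > 0" "c < \<rho> r y1" using rhop[OF r0 y1] by (auto simp: c_def)
    have "isCont \<tau> y1"
      using y1 r by (intro continuous_on_interior[OF \<tau>]) (auto simp: interior_cball)
    then have ct: "isCont ?t y1" by (intro continuous_intros)
    obtain e1 where e1: "e1 > 0" "\<And>y. y \<in> ball y1 e1 \<Longrightarrow> m < ?t y"
      using isCont_gt_ball[OF ct m(2)] by metis
    have cr: "isCont (\<rho> r) y1"
      using smooth_continuous_on[OF sm, of UNIV] by (simp add: continuous_on_eq_continuous_at)
    obtain e2 where e2: "e2 > 0" "\<And>y. y \<in> ball y1 e2 \<Longrightarrow> c < \<rho> r y"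
      using isCont_gt_ball[OF cr c(2)] by metis
    define e where "e = min (min e1 e2) (r - dist x y1)"
    have e: "e > 0" using e1 e2 y1 by (simp add: e_def)
    have eb: "dist x y < r" if "y \<in> ball y1 e" for y
    proof -
      have "dist x y \<le> dist x y1 + dist y1 y" by (rule dist_triangle)
      then show ?thesis using that by (simp add: e_def)
    qed
    let ?V = "measure lebesgue (ball y1 e)" and ?P = "\<integral>y. \<rho> r y \<partial>lebesgue"
    have rint: "integrable lebesgue (\<rho> r)"
    proof -
      have "integrable lebesgue (\<lambda>y. complex_of_real (\<rho> r y))"
        by (rule smooth_integrable[OF smooth_bounded_linear_comp[OF bounded_linear_of_real sm], of x r])
          (use rhoout r0 in auto)
      then have "integrable lebesgue (\<lambda>y. Re (complex_of_real (\<rho> r y)))" by (rule integrable_Re)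
      then show ?thesis by simp
    qed
    have bound: "(1 / 2 * m ^ k * c) * ?V \<le> (r\<^sup>2) ^ k * ?P" for k
    proof -
      let ?F = "\<lambda>y. h y * of_real (?t y ^ k) - h x * of_real (?q y ^ k)"
      let ?f = "\<lambda>y. (if y \<in> ball x R then Re (?F y / h x) * \<rho> r y else 0)"
      have cF: "continuous_on (cball x R) ?F" by (intro continuous_intros h \<tau>)
      have F: "integrable lebesgue ?f" "(\<integral>y. ?f y \<partial>lebesgue) = 0"
        using real_mean[OF cF r0 r radial_mean_power[OF g r0 r, of k]] by blast+
      have ReF: "Re (?F y / h x) = Re (h y / h x) * ?t y ^ k - ?q y ^ k" for y
      proof -
        have "?F y / h x = (h y / h x) * of_real (?t y ^ k) - of_real (?q y ^ k)"
          using hx by (simp add: field_simps)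
        then show ?thesis by (simp only: Re_times_of_real minus_complex.sel Re_complex_of_real)
      qed
      have lower: "?f y + (r\<^sup>2) ^ k * \<rho> r y \<ge> 1 / 2 * ?t y ^ k * \<rho> r y" if "dist x y < r" for y
      proof -
        have y: "y \<in> ball x R" using that r by simp
        have "?q y ^ k \<le> (r\<^sup>2) ^ k"
          using that by (intro power_mono) (auto simp: dist_commute)
        moreover have "1 / 2 * ?t y ^ k \<le> Re (h y / h x) * ?t y ^ k"
          using re[OF y] by (intro mult_right_mono) auto
        ultimately have "1 / 2 * ?t y ^ k \<le> Re (?F y / h x) + (r\<^sup>2) ^ k"
          unfolding ReF by linarith
        then have "1 / 2 * ?t y ^ k * \<rho> r y \<le> (Re (?F y / h x) + (r\<^sup>2) ^ k) * \<rho> r y"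
          using rho0[OF r0] by (rule mult_right_mono)
        then show ?thesis using y by (simp add: distrib_right)
      qed
      have "(1 / 2 * m ^ k * c) * ?V \<le> (\<integral>y. ?f y + (r\<^sup>2) ^ k * \<rho> r y \<partial>lebesgue)"
      proof (rule integral_ge_ball)
        show "integrable lebesgue (\<lambda>y. ?f y + (r\<^sup>2) ^ k * \<rho> r y)"
          by (intro Bochner_Integration.integrable_add F integrable_mult_right rint)
        show "0 \<le> ?f y + (r\<^sup>2) ^ k * \<rho> r y" for y
        proof (cases "dist x y < r")
          case True
          then show ?thesis using rho0[OF r0] by (intro order_trans[OF _ lower]) auto
        next
          case False
          then show ?thesis using rhoout[OF r0, of y] by simp
        qed
        show "1 / 2 * m ^ k * c \<le> ?f y + (r\<^sup>2) ^ k * \<rho> r y" if y: "y \<in> ball y1 e" for y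
        proof (rule order_trans[OF _ lower[OF eb[OF y]]])
          have "m < ?t y" "c < \<rho> r y" using e1(2)[of y] e2(2)[of y] y by (auto simp: e_def)
          moreover have "m > 0" using m(1) r0 by (meson order_less_trans zero_less_power)
          ultimately show "1 / 2 * m ^ k * c \<le> 1 / 2 * ?t y ^ k * \<rho> r y"
            using c(1) by (intro mult_mono power_mono) auto
        qed
      qed
      also have "\<dots> = (r\<^sup>2) ^ k * ?P"
        using F rint by simp
      finally show ?thesis .
    qed
    have V: "?V > 0" using measure_lebesgue_ball_pos[OF e] .
    have m1: "m / r\<^sup>2 > 1" using m(1) r0 by simp
    obtain k where k: "2 * ?P / (c * ?V) < (m / r\<^sup>2) ^ k" using real_arch_pow[OF m1] by blast
    have "2 * ?P < (m / r\<^sup>2) ^ k * (c * ?V)" using k c(1) V by (simp add: divide_less_eq)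
    also have "\<dots> = m ^ k * c * ?V / (r\<^sup>2) ^ k" by (simp add: power_divide)
    also have "\<dots> \<le> 2 * ?P" using bound[of k] r0 by (simp add: divide_le_eq mult_ac)
    finally show False by simp
  qed
  \<comment> \<open>The bound holds for every radius \<open>w\<close> between
    \<open>dist y x\<close> and \<open>R\<close>; let \<open>w\<close> decrease.\<close>
  have le': "dist (\<tau> y) (\<tau> x) \<le> dist y x" if y: "y \<in> ball x R" for y
  proof (rule dense_ge_bounded[of _ R])
    show "dist y x < R" using y by (simp add: dist_commute)
    show "dist (\<tau> y) (\<tau> x) \<le> w" if "dist y x < w" "w < R" for w
      using le[of y w] that by (simp add: dist_commute)
  qed
  have tq: "?t y \<le> ?q y" if "y \<in> ball x R" for y using le'[OF that] by (simp add: power_mono)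
  show ?thesis
  proof (rule ccontr)
    assume "\<not> ?thesis"
    then have "dist (\<tau> y) (\<tau> x) < dist y x"
      using le'[OF y] by simp
    then have lt: "?t y < ?q y" by (intro power_strict_mono) auto
    obtain r where r: "dist x y < r" "r < R" using y dense by auto
    have r0: "r > 0" using r zero_le_dist[of x y] by linarith
    let ?f1 = "\<lambda>y. (if y \<in> ball x R then Re ((h y * of_real (?t y) - h x * of_real (?q y)) / h x) * \<rho> r y else 0)"
    let ?f2 = "\<lambda>y. (if y \<in> ball x R then Re ((h y - h x) * of_real (?q y) / h x) * \<rho> r y else 0)"
    have "continuous_on (cball x R) (\<lambda>y. h y * of_real (?t y ^ 1) - h x * of_real (?q y ^ 1))"
      by (intro continuous_intros h \<tau>)
    from real_mean[OF this r0 r(2) radial_mean_power[OF g r0 r(2), of 1]]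
    have f1: "integrable lebesgue ?f1" "(\<integral>y. ?f1 y \<partial>lebesgue) = 0"
      unfolding power_one_right by blast+
    \<comment> \<open>The factor \<open>(dist y x)\<^sup>2\<close> is absorbed into the profile
      \<open>s * g s\<close>, so this is a mean for \<open>k = 0\<close>.\<close>
    have "(\<integral>y. restr (ball x R) (\<lambda>y. (h y - h x) * of_real (?q y)) y * mollifier g r x y \<partial>lebesgue) =
       of_real (r\<^sup>2) * (\<integral>y. restr (ball x R) (\<lambda>y. h y * of_real (?t y ^ 0) - h x * of_real (?q y ^ 0)) y
         * mollifier (\<lambda>s. s * g s) r x y \<partial>lebesgue)"
      using r0 by (subst integral_mult_right_zero[symmetric], intro Bochner_Integration.integral_cong refl)
        (simp add: restr_def mollifier_def radial_def dist_norm)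
    then have "(\<integral>y. restr (ball x R) (\<lambda>y. (h y - h x) * of_real (?q y)) y * mollifier g r x y \<partial>lebesgue) = 0"
      by (simp only: radial_mean_power[OF radial_profile_mult_id[OF g] r0 r(2)] mult_zero_right)
    moreover have "continuous_on (cball x R) (\<lambda>y. (h y - h x) * of_real (?q y))"
      by (intro continuous_intros h \<tau>)
    ultimately have f2: "integrable lebesgue ?f2" "(\<integral>y. ?f2 y \<partial>lebesgue) = 0"
      using real_mean[OF _ r0 r(2)] by blast+
    \<comment> \<open>This difference is nonnegative with vanishing integral, yet it would be
      continuous and positive at \<open>y\<close>.\<close>
    have ff: "?f2 y - ?f1 y = (if y \<in> ball x R then Re (h y / h x) * (?q y - ?t y) * \<rho> r y else 0)" for y
    proof -
      have "(h y - h x) * of_real (?q y) / h x - (h y * of_real (?t y) - h x * of_real (?q y)) / h x =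
          (h y / h x) * of_real (?q y - ?t y)"
        using hx by (simp add: field_simps)
      from arg_cong[OF this, of Re]
      have "Re ((h y - h x) * of_real (?q y) / h x) - Re ((h y * of_real (?t y) - h x * of_real (?q y)) / h x) =
          Re (h y / h x) * (?q y - ?t y)"
        by (simp only: Re_times_of_real minus_complex.sel)
      from arg_cong[OF this, of "\<lambda>z. z * \<rho> r y"] show ?thesis by (simp only: left_diff_distrib) simp
    qed
    have cq: "isCont (\<lambda>y. ?q y - ?t y) y"
      using y by (intro continuous_intros continuous_on_interior[OF \<tau>]) (auto simp: interior_cball)
    have cr: "isCont (\<rho> r) y"
      using smooth_continuous_on[OF sm, of UNIV] by (simp add: continuous_on_eq_continuous_at)
    define f where "f y = Re (h y / h x) * (?q y - ?t y) * \<rho> r y" for y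
    let ?c = "1 / 2 * (?q y - ?t y) * \<rho> r y"
    have "isCont h y" using y by (intro continuous_on_interior[OF h]) (auto simp: interior_cball)
    then have cf: "isCont f y" unfolding f_def using hx by (intro continuous_intros cq cr) auto
    have cpos: "?c > 0" using lt rhop[OF r0 r(1)] by simp
    have "?c \<le> f y" unfolding f_def using re[OF y] lt le'[OF y] rho0[OF r0, of y] by (intro mult_right_mono) auto
    then have "?c / 2 < f y" using cpos by linarith
    then obtain e1 where e1: "e1 > 0" "\<And>z. z \<in> ball y e1 \<Longrightarrow> ?c / 2 < f z"
      using isCont_gt_ball[OF cf] by metis
    define e where "e = min e1 (R - dist x y)"
    have e: "e > 0" using e1 y by (simp add: e_def)
    have "?c / 2 * measure lebesgue (ball y e) \<le> (\<integral>y. ?f2 y - ?f1 y \<partial>lebesgue)"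
    proof (rule integral_ge_ball)
      show "integrable lebesgue (\<lambda>y. ?f2 y - ?f1 y)"
        by (intro Bochner_Integration.integrable_diff f1 f2)
      show "0 \<le> ?f2 y - ?f1 y" for y
      proof (cases "y \<in> ball x R")
        case True
        then have "0 \<le> Re (h y / h x)" using re[OF True] by linarith
        then show ?thesis unfolding ff using True tq[OF True] rho0[OF r0, of y] by simp
      next
        case False
        then show ?thesis unfolding ff by simp
      qed
      show "?c / 2 \<le> ?f2 z - ?f1 z" if z: "z \<in> ball y e" for z
      proof -
        have "dist x z \<le> dist x y + dist y z" by (rule dist_triangle)
        then have "z \<in> ball x R" using z by (simp add: e_def)
        then show ?thesis unfolding ff using e1(2)[of z] z by (simp add: f_def e_def)
      qed
    qed
    also have "\<dots> = 0" by (simp only: Bochner_Integration.integral_diff f1 f2 diff_self)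
    finally show False
      using mult_pos_pos[OF half_gt_zero[OF cpos] measure_lebesgue_ball_pos[OF e, of y]] by linarith
  qed
qed

end

text \<open>Together with \<open>flat_profile_deriv\<close> this exhibits the nonnegative profile
  \<open>flat_exp 0 (1 - s)\<close> as the tail of \<open>2 * flat_exp 2 (1 - s)\<close>: moving the
  centre of the kernel of the former produces the kernel of the latter times a linear
  function.\<close>

lemma radial_profile_flat_deriv: "radial_profile (\<lambda>s. 2 * flat_exp 2 (1 - s))"
proof -
  have "smooth (\<lambda>s. 1 - s :: real)"
    using smooth_add[OF smooth_const[of 1] smooth_linear[OF bounded_linear_minus[OF bounded_linear_ident]]] by simp
  then show ?thesis
    unfolding radial_profile_def
    by (intro conjI smooth_mult smooth_const smooth_compose_real[OF smooth_flat_exp]) (auto simp: flat_exp_zero)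
qed

lemma flat_profile_deriv: "((\<lambda>s. flat_exp 0 (1 - s)) has_real_derivative - (2 * flat_exp 2 (1 - s)) / 2) (at s)"
proof -
  have "((\<lambda>s. 1 - s) has_real_derivative - 1) (at s)" by (auto intro!: derivative_eq_intros)
  with flat_exp_deriv have "((\<lambda>s. flat_exp 0 (1 - s)) has_real_derivative
      (flat_exp (0 + 2) (1 - s) - real 0 * flat_exp (0 + 1) (1 - s)) * - 1) (at s)"
    by (rule DERIV_chain2)
  then show ?thesis by (simp add: numeral_2_eq_2)
qed

lemma smooth_mollifier: "radial_profile g \<Longrightarrow> smooth (mollifier g r c)"
  unfolding mollifier_def[abs_def] radial_profile_def divide_inverse
  by (intro smooth_mult smooth_const smooth_radial) simp

lemma mollifier_outside:
  "radial_profile g \<Longrightarrow> 0 < r \<Longrightarrow> y \<notin> cball x r \<Longrightarrow> mollifier g r x y = 0"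
  unfolding mollifier_def radial_profile_def using radial_outside[of g r x y] by simp

lemma mollifier_bounded:
  assumes "radial_profile g" shows "\<exists>B\<ge>0. \<forall>c y. norm (mollifier g r (c::'a::euclidean_space) y) \<le> B"
proof -
  obtain B where B: "\<And>r c y. norm (radial g r (c::'a) y) \<le> B" using radial_bounded[OF assms] by blast
  have "B \<ge> 0" using B[of 0 0 0] norm_ge_zero order_trans by blast
  then show ?thesis
    by (intro exI[of _ "B / \<bar>r\<bar> ^ DIM('a)"]) (simp add: mollifier_def norm_divide norm_power divide_right_mono B)
qed

context weak_intertwining
begin

text \<open>
  The linear function is the combination of \<open>(dist (\<tau> y) a)\<^sup>2\<close> and squared distances from \<open>x\<close> obtained by polarisation.
\<close>

lemma radial_mean_linear:
  assumes iso: "\<And>y y'. y \<in> ball x R \<Longrightarrow> y' \<in> ball x R \<Longrightarrow> dist (\<tau> y) (\<tau> y') = dist y y'"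
    and g: "radial_profile g" and r: "0 < r" "r < R" and v: "norm v < R"
  shows "(\<integral>y. restr (ball x R) (\<lambda>y. h y * of_real ((y - x) \<bullet> v)) y * mollifier g r x y \<partial>lebesgue) = 0"
proof -
  let ?I = "\<lambda>F. \<integral>y. restr (ball x R) F y * mollifier g r x y \<partial>lebesgue"
  let ?a = "\<tau> (x + v)"
  let ?F0 = "\<lambda>y. h y * of_real ((dist (\<tau> y) (\<tau> x))\<^sup>2 ^ 0) - h x * of_real ((dist y x)\<^sup>2 ^ 0)"
  let ?F1 = "\<lambda>y. h y * of_real ((dist (\<tau> y) (\<tau> x))\<^sup>2 ^ 1) - h x * of_real ((dist y x)\<^sup>2 ^ 1)"
  let ?F2 = "\<lambda>y. h y * of_real ((dist (\<tau> y) ?a)\<^sup>2) - h x * of_real ((dist (\<tau> x) ?a)\<^sup>2) - h x * of_real ((dist y x)\<^sup>2)"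
  have xv: "x + v \<in> ball x R" and xx: "x \<in> ball x R" using v R by (auto simp: dist_norm)
  have i: "integrable lebesgue (\<lambda>y. restr (ball x R) ?F0 y * mollifier g r x y)"
     "integrable lebesgue (\<lambda>y. restr (ball x R) ?F1 y * mollifier g r x y)"
     "integrable lebesgue (\<lambda>y. restr (ball x R) ?F2 y * mollifier g r x y)"
    by (rule integrable_restr_mult_smooth[OF _ smooth_mollifier[OF g] mollifier_outside[OF g r(1)]],
        intro continuous_intros h \<tau>, assumption)+
  have eq: "restr (ball x R) (\<lambda>y. h y * of_real ((y - x) \<bullet> v)) y * mollifier g r x y =
     (1 / 2) * (restr (ball x R) ?F1 y * mollifier g r x y) + of_real ((norm v)\<^sup>2 / 2) * (restr (ball x R) ?F0 y * mollifier g r x y)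
       - (1 / 2) * (restr (ball x R) ?F2 y * mollifier g r x y)" for y
  proof (cases "y \<in> ball x R")
    case True
    have "(dist y (x + v))\<^sup>2 = (dist y x)\<^sup>2 - 2 * ((y - x) \<bullet> v) + (norm v)\<^sup>2"
      unfolding dist_norm power2_norm_eq_inner by (simp add: algebra_simps inner_commute)
    then have e: "(y - x) \<bullet> v = ((dist y x)\<^sup>2 + (norm v)\<^sup>2 - (dist y (x + v))\<^sup>2) / 2" by simp
    have d: "dist x (x + v) = norm v" by (simp add: dist_norm)
    show ?thesis
      unfolding restr_def if_P[OF True] iso[OF True xv] iso[OF True xx] iso[OF xx xv] e d by (simp add: field_simps)
  qed (simp add: restr_def)
  show ?thesis
    unfolding eq
    by (simp only: Bochner_Integration.integral_diff Bochner_Integration.integral_add Bochner_Integration.integrable_diff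
        Bochner_Integration.integrable_add integrable_mult_right integral_mult_right_zero i
        radial_mean_power[OF g r] radial_mean_shifted[OF g r imageI[OF xv]]) simp
qed

end

lemma test_functions_mono: "S \<subseteq> T \<Longrightarrow> test_functions S \<subseteq> test_functions T"
  unfolding test_functions_def by blast

lemma integral_mollifier_translate:
  fixes x :: "'a::euclidean_space"
  assumes "radial_profile g"
  shows "(\<integral>y. mollifier g q x y \<partial>lebesgue) = (\<integral>y. mollifier g q (0::'a) y \<partial>lebesgue)"
proof -
  have "mollifier g q x y = mollifier g q 0 (- x + y)" for y by (simp add: mollifier_def radial_def)
  then show ?thesis
    using integral_lebesgue_translation[OF smooth_measurable[OF smooth_mollifier[OF assms]], of q 0 "- x"] by simp
qed

lemma integral_flat_mollifier_nonzero:
  assumes q: "q > 0"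
  shows "(\<integral>y. mollifier (\<lambda>s. flat_exp 0 (1 - s)) q (0::'a::euclidean_space) y \<partial>lebesgue) \<noteq> 0"
proof -
  define G where "G s = flat_exp 0 (1 - s)" for s
  have G: "radial_profile G" unfolding G_def[abs_def] by (rule radial_profile_flat)
  let ?\<rho> = "\<lambda>y::'a. G ((norm (y - 0))\<^sup>2 / q\<^sup>2) / q ^ DIM('a)"
  have m: "mollifier G q 0 = (\<lambda>y. complex_of_real (?\<rho> y))" by (auto simp: mollifier_def radial_def)
  have i: "integrable lebesgue (\<lambda>y. complex_of_real (?\<rho> y))"
    unfolding m[symmetric]
    by (rule smooth_integrable[where c=0 and R=q]) (use smooth_mollifier[OF G] mollifier_outside[OF G q] in blast)+
  \<comment> \<open>On the ball of half the radius the argument \<open>s\<close> is at most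
    \<open>1 / 4\<close>, so the profile is at least \<open>flat_exp 0 (3 / 4)\<close>.\<close>
  have c: "flat_exp 0 (3 / 4) / q ^ DIM('a) > 0" using q flat_exp_pos[of "3/4" 0] by simp
  have "flat_exp 0 (3 / 4) / q ^ DIM('a) * measure lebesgue (ball (0::'a) (q / 2)) \<le> (\<integral>y. ?\<rho> y \<partial>lebesgue)"
  proof (rule integral_ge_ball)
    show "integrable lebesgue ?\<rho>" using integrable_Re[OF i] by simp
    show "0 \<le> ?\<rho> y" for y using q by (simp add: G_def flat_exp_nonneg)
    show "flat_exp 0 (3 / 4) / q ^ DIM('a) \<le> ?\<rho> y" if "y \<in> ball 0 (q / 2)" for y
    proof -
      have "(norm y)\<^sup>2 \<le> (q / 2)\<^sup>2" using that by (intro power_mono) auto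
      then have "(norm y)\<^sup>2 / q\<^sup>2 \<le> 1 / 4" using q by (simp add: divide_le_eq power_divide)
      then have "flat_exp 0 (3 / 4) \<le> G ((norm y)\<^sup>2 / q\<^sup>2)" by (simp add: G_def flat_exp_def field_simps)
      then show ?thesis using q by (simp add: divide_right_mono)
    qed
  qed
  then have "(\<integral>y. ?\<rho> y \<partial>lebesgue) > 0"
    using mult_pos_pos[OF c measure_lebesgue_ball_pos[of "q / 2" "0::'a"]] q by simp
  then show ?thesis unfolding m G_def[abs_def, symmetric] using q by auto
qed

text \<open>Near \<open>y0\<close> all ratios of values of \<open>h\<close> have real part at least
  \<open>1 / 2\<close>, so \<open>local_isometry\<close> applies around every nearby point. As to
  the weight, the mean of \<open>h\<close> over a kernel centred at \<open>x\<close> is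
  \<open>h x\<close> times the mass \<open>P\<close>; its derivative in a direction \<open>v\<close>
  is a mean of \<open>h\<close> times a linear function, hence \<open>0\<close>.\<close>

lemma local_rigidity:
  fixes h :: "'a::euclidean_space \<Rightarrow> complex" and \<tau> :: "'a \<Rightarrow> 'a"
  assumes r: "r > 0" and h: "continuous_on (cball y0 r) h" and \<tau>: "continuous_on (cball y0 r) \<tau>" and h0: "h y0 \<noteq> 0"
    and weak: "\<And>a k \<psi>. a \<in> \<tau> ` ball y0 r \<Longrightarrow> \<psi> \<in> test_functions (ball y0 r) \<Longrightarrow>
      (\<integral>y. restr (ball y0 r) (\<lambda>y. h y * of_real ((dist (\<tau> y) a)\<^sup>2 ^ k)) y * laplacian \<psi> y \<partial>lebesgue) =
      eigen_factor TYPE('a) k *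
        (\<integral>y. restr (ball y0 r) (\<lambda>y. h y * of_real ((dist (\<tau> y) a)\<^sup>2 ^ (k - 1))) y * \<psi> y \<partial>lebesgue)"
  shows "\<exists>e>0. e \<le> r \<and> (\<forall>y\<in>ball y0 e. h y = h y0 \<and> (\<forall>y'\<in>ball y0 e. dist (\<tau> y) (\<tau> y') = dist y y'))"
proof -
  have "isCont h y0" using r by (intro continuous_on_interior[OF h]) (auto simp: interior_cball)
  \<comment> \<open>With \<open>1 / 6\<close> one gets \<open>|h y - h x| \<le> |h y0| / 3\<close>
    and \<open>|h x| \<ge> 5 / 6 |h y0|\<close>, so \<open>h y / h x\<close> differs from
    \<open>1\<close> by at most \<open>1 / 2\<close>.\<close>
  then obtain s where s: "s > 0" "\<And>y. dist y y0 < s \<Longrightarrow> dist (h y) (h y0) < norm (h y0) / 6"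
    using h0 unfolding continuous_at_eps_delta by (metis zero_less_divide_iff zero_less_norm_iff zero_less_numeral)
  define R where "R = min s r / 2"
  have RR: "R > 0" "2 * R \<le> s" "2 * R \<le> r" using s r by (auto simp: R_def)
  have wi: "weak_intertwining x Q h \<tau>" if x: "cball x Q \<subseteq> cball y0 r" "ball x Q \<subseteq> ball y0 r" and Q: "Q > 0" for x Q
  proof
    show "0 < Q" "continuous_on (cball x Q) h" "continuous_on (cball x Q) \<tau>"
      using Q x(1) h \<tau> continuous_on_subset by blast+
    fix a k \<psi> assume a: "a \<in> \<tau> ` ball x Q" and psi: "\<psi> \<in> test_functions (ball x Q)"
    have z: "\<psi> y = 0" "laplacian \<psi> y = 0" if "y \<notin> ball x Q" for y
      using test_functionE[OF psi] that by metis+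
    have e: "restr (ball x Q) f y * v y = restr (ball y0 r) f y * v y"
      if "v = \<psi> \<or> v = laplacian \<psi>" for f v y
      using z[of y] x(2) that by (auto simp: restr_def)
    show "(\<integral>y. restr (ball x Q) (\<lambda>y. h y * of_real ((dist (\<tau> y) a)\<^sup>2 ^ k)) y * laplacian \<psi> y \<partial>lebesgue) =
      eigen_factor TYPE('a) k *
        (\<integral>y. restr (ball x Q) (\<lambda>y. h y * of_real ((dist (\<tau> y) a)\<^sup>2 ^ (k - 1))) y * \<psi> y \<partial>lebesgue)"
      unfolding e[OF disjI1[OF refl]] e[OF disjI2[OF refl]]
      using a psi x(2) test_functions_mono[OF x(2)] by (intro weak) auto
  qed
  have hx: "norm (h x) \<ge> 5 / 6 * norm (h y0)" if "dist x y0 < s" for x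
    using s(2)[OF that] norm_triangle_ineq3[of "h x" "h y0"] by (simp add: dist_norm)
  have re: "Re (h y / h x) \<ge> 1 / 2" if "dist x y0 < s" "dist y y0 < s" for x y
  proof -
    have pos: "norm (h x) > 0" using order_less_le_trans[OF _ hx[OF that(1)], of 0] h0 by simp
    have "norm (h y - h x) \<le> norm (h y0) / 3"
      using s(2)[OF that(1)] s(2)[OF that(2)] norm_triangle_ineq4[of "h y - h y0" "h x - h y0"] by (simp add: dist_norm)
    also have "\<dots> \<le> 1 / 2 * norm (h x)" using hx[OF that(1)] norm_ge_zero[of "h y0"] by linarith
    finally have "norm ((h y - h x) / h x) \<le> 1 / 2" using pos by (simp add: norm_divide divide_le_eq)
    moreover have "(h y - h x) / h x = h y / h x - 1" using pos by (simp add: field_simps)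
    ultimately have "\<bar>Re (h y / h x - 1)\<bar> \<le> 1 / 2" using abs_Re_le_cmod order_trans by metis
    then have "\<bar>Re (h y / h x) - 1\<bar> \<le> 1 / 2" by simp
    then show ?thesis by linarith
  qed
  have tri: "dist y y0 \<le> dist x y0 + dist x y" for x y :: 'a using dist_triangle[of y y0 x] by (simp add: dist_commute)
  have tri': "dist y0 y \<le> dist x y0 + dist x y" for x y :: 'a using tri[of y x] by (simp add: dist_commute)
  have iso: "dist (\<tau> y) (\<tau> x) = dist y x" if x: "dist x y0 < R" and y: "dist x y < R" for x y
  proof -
    have sub: "cball x R \<subseteq> cball y0 r" "ball x R \<subseteq> ball y0 r"
      using x RR by (auto intro!: order_trans[OF tri'[of _ x]] order_le_less_trans[OF tri'[of _ x]])
    interpret weak_intertwining x R h \<tau> by (rule wi[OF sub RR(1)])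
    have xs: "dist x y0 < s" using x RR by simp
    show ?thesis
    proof (rule local_isometry)
      show "h x \<noteq> 0" using hx[OF xs] h0 by auto
      show "Re (h z / h x) \<ge> 1 / 2" if "z \<in> ball x R" for z
        using that x RR tri[of z x] by (intro re xs) auto
    qed (use y in auto)
  qed
  have iso2: "dist (\<tau> y) (\<tau> y') = dist y y'" if "dist y y0 < R / 2" "dist y' y0 < R / 2" for y y'
    using that RR iso[of y' y] dist_triangle2[of y' y y0] by simp
  \<comment> \<open>A domain of integration that does not move with the centre permits
    differentiation in the centre; kernels of radius \<open>q\<close> centred within
    \<open>R / 4\<close> of \<open>y0\<close> are supported in it.\<close>
  define D where "D = ball y0 (R / 2)"
  define q where "q = R / 8"
  have q: "q > 0" "q < R / 4" using RR by (auto simp: q_def)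
  define G where "G s = flat_exp 0 (1 - s)" for s
  define g where "g s = 2 * flat_exp 2 (1 - s)" for s
  have G: "radial_profile G" and g: "radial_profile g" and Gg: "\<And>s. (G has_real_derivative - g s / 2) (at s)"
    unfolding G_def[abs_def] g_def[abs_def]
    by (rule radial_profile_flat radial_profile_flat_deriv flat_profile_deriv)+
  define P where "P = (\<integral>y. mollifier G q (0::'a) y \<partial>lebesgue)"
  have Px: "(\<integral>y. mollifier G q x y \<partial>lebesgue) = P" for x :: 'a
    unfolding P_def by (rule integral_mollifier_translate[OF G])
  have sub: "cball x (R / 4) \<subseteq> cball y0 r" "ball x (R / 4) \<subseteq> ball y0 r" "ball x (R / 4) \<subseteq> D" if "dist x y0 < R / 4" for x
  proof -
    have *: "dist y0 y < R / 2 \<and> dist y0 y < r \<and> dist y0 y \<le> r" if "dist x y \<le> R / 4" for y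
      using tri'[of y x] that \<open>dist x y0 < R / 4\<close> RR by linarith
    show "cball x (R / 4) \<subseteq> cball y0 r" "ball x (R / 4) \<subseteq> ball y0 r" "ball x (R / 4) \<subseteq> D"
      unfolding subset_iff mem_ball mem_cball D_def using * *[OF less_imp_le] by blast+
  qed
  have restrD: "restr D f y * mollifier k q x y = restr (ball x (R / 4)) f y * mollifier k q x y"
    if "dist x y0 < R / 4" "radial_profile k" for x y f k
  proof (cases "y \<in> cball x q")
    case True
    then have "y \<in> ball x (R / 4)" using q(2) by simp
    then show ?thesis using sub(3)[OF that(1)] by (auto simp: restr_def)
  qed (use mollifier_outside[OF that(2) q(1)] in auto)
  have hP: "(\<integral>y. restr D h y * mollifier G q x y \<partial>lebesgue) = h x * P" if x: "dist x y0 < R / 4" for x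
  proof -
    interpret weak_intertwining x "R / 4" h \<tau> using sub[OF x] RR by (intro wi) auto
    have i: "integrable lebesgue (\<lambda>y. restr (ball x (R / 4)) h y * mollifier G q x y)"
      by (rule integrable_restr_mult_smooth[OF h smooth_mollifier[OF G] mollifier_outside[OF G q(1)]])
    have i2: "integrable lebesgue (mollifier G q x)"
      by (rule smooth_integrable[OF smooth_mollifier[OF G] mollifier_outside[OF G q(1)]])
    have "0 = (\<integral>y. restr (ball x (R / 4)) h y * mollifier G q x y - h x * mollifier G q x y \<partial>lebesgue)"
      by (subst radial_mean_power[OF G q, of 0, symmetric], intro Bochner_Integration.integral_cong refl)
        (use mollifier_outside[OF G q(1), of _ x] q(2) in \<open>auto simp: restr_def algebra_simps\<close>)
    also have "\<dots> = (\<integral>y. restr (ball x (R / 4)) h y * mollifier G q x y \<partial>lebesgue) - h x * P"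
      using i i2 Px by simp
    finally show ?thesis unfolding restrD[OF x G] by simp
  qed
  have lin: "(\<integral>y. restr D h y * (mollifier g q x y * of_real ((y - x) \<bullet> v / q\<^sup>2)) \<partial>lebesgue) = 0"
    if x: "dist x y0 < R / 4" and v: "norm v < R / 4" for x v
  proof -
    interpret weak_intertwining x "R / 4" h \<tau> using sub[OF x] RR by (intro wi) auto
    have "(\<integral>y. restr D h y * (mollifier g q x y * of_real ((y - x) \<bullet> v / q\<^sup>2)) \<partial>lebesgue) =
      (\<integral>y. (restr (ball x (R / 4)) (\<lambda>y. h y * of_real ((y - x) \<bullet> v)) y * mollifier g q x y) / of_real (q\<^sup>2) \<partial>lebesgue)"
      by (intro Bochner_Integration.integral_cong refl)
        (simp add: restrD[OF x g, symmetric], simp add: restr_def)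
    also have "\<dots> = 0"
      using radial_mean_linear[OF _ g q v] sub(3)[OF x] iso2 by (simp add: D_def dist_commute subset_iff)
    finally show ?thesis .
  qed
  have hD: "continuous_on (cball y0 (R / 2)) h"
    using RR by (intro continuous_on_subset[OF h]) auto
  have iD: "integrable lebesgue (restr D h)"
    unfolding D_def by (rule restr_continuous_integrable[OF hD])
  \<comment> \<open>The centre runs along \<open>y0 + t *\<^sub>R v\<close> with
    \<open>-1 < t < 1\<close>, so the comparison is made at the interior parameter
    \<open>t = 1 / 2\<close>; hence \<open>2 *\<^sub>R (y - y0)\<close> is inserted for
    \<open>v\<close> at the end.\<close>
  have const: "h (y0 + (1 / 2) *\<^sub>R v) * P = h y0 * P" if v: "norm v < R / 4" for v
  proof -
    let ?F = "\<lambda>t y. restr D h y * mollifier G q (y0 + t *\<^sub>R v) y"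
    let ?F' = "\<lambda>t y. restr D h y * (mollifier g q (y0 + t *\<^sub>R v) y * of_real ((y - (y0 + t *\<^sub>R v)) \<bullet> v / q\<^sup>2))"
    obtain Bg where Bg: "Bg \<ge> 0" "\<And>c y. norm (mollifier g q (c::'a) y) \<le> Bg" using mollifier_bounded[OF g] by blast
    obtain BG where BG: "\<And>c y. norm (mollifier G q (c::'a) y) \<le> BG" using mollifier_bounded[OF G] by blast
    have tv: "norm (t *\<^sub>R v) < R / 4" if "-1 < t" "t < 1" for t
    proof -
      have "\<bar>t\<bar> * norm v \<le> 1 * norm v" using that by (intro mult_right_mono) auto
      then show ?thesis using v by simp
    qed
    have "\<exists>c. \<forall>t\<in>{-1<..<1}. (\<integral>y. ?F t y \<partial>lebesgue) = c"
    proof (rule has_derivative_zero_constant)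
      fix t :: real assume t: "t \<in> {-1<..<1}"
      have "((\<lambda>t. \<integral>y. ?F t y \<partial>lebesgue) has_vector_derivative (\<integral>y. ?F' t y \<partial>lebesgue)) (at t)"
      proof (rule deriv_under_integral[where a="-1" and b=1 and B="\<lambda>y. norm (restr D h y) * (Bg * (R * R / q\<^sup>2))"])
        show "integrable lebesgue (?F s)" for s
          by (rule integrable_mult_bounded[OF iD smooth_measurable_lebesgue[OF smooth_mollifier[OF G]] BG])
        show "integrable lebesgue (\<lambda>y. norm (restr D h y) * (Bg * (R * R / q\<^sup>2)))"
          by (intro integrable_mult_left integrable_norm iD)
        show "?F' t \<in> borel_measurable lebesgue"
        proof (intro borel_measurable_times)
          show "restr D h \<in> borel_measurable lebesgue" using iD by auto
          show "mollifier g q (y0 + t *\<^sub>R v) \<in> borel_measurable lebesgue"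
            by (rule smooth_measurable_lebesgue[OF smooth_mollifier[OF g]])
          have "(\<lambda>y. complex_of_real ((y - (y0 + t *\<^sub>R v)) \<bullet> v / q\<^sup>2)) \<in> borel_measurable borel"
            by (intro borel_measurable_continuous_onI continuous_intros) (use q in auto)
          then show "(\<lambda>y. complex_of_real ((y - (y0 + t *\<^sub>R v)) \<bullet> v / q\<^sup>2)) \<in> borel_measurable lebesgue"
            by (auto intro: measurable_completion)
        qed
        show "norm (?F' s y) \<le> norm (restr D h y) * (Bg * (R * R / q\<^sup>2))" if s: "-1 < s" "s < 1" for s y
        proof (cases "y \<in> D")
          case True
          have "\<bar>(y - (y0 + s *\<^sub>R v)) \<bullet> v\<bar> \<le> norm (y - (y0 + s *\<^sub>R v)) * norm v" by (rule Cauchy_Schwarz_ineq2)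
          also have "\<dots> \<le> R * R"
          proof (rule mult_mono)
            have "norm (y - (y0 + s *\<^sub>R v)) \<le> norm (y - y0) + norm (s *\<^sub>R v)"
              using norm_triangle_ineq4[of "y - y0" "s *\<^sub>R v"] by (simp add: algebra_simps)
            then show "norm (y - (y0 + s *\<^sub>R v)) \<le> R"
              using tv[OF s] True RR by (simp add: D_def dist_norm norm_minus_commute)
          qed (use v RR in auto)
          finally have "norm (mollifier g q (y0 + s *\<^sub>R v) y) * \<bar>(y - (y0 + s *\<^sub>R v)) \<bullet> v / q\<^sup>2\<bar> \<le> Bg * (R * R / q\<^sup>2)"
            using Bg by (intro mult_mono) (auto simp: divide_right_mono)
          then show ?thesis
            unfolding norm_mult norm_of_real by (intro mult_left_mono) auto
        next
          case False
          then show ?thesis by (simp add: restr_def)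
        qed
        show "((\<lambda>s. ?F s y) has_vector_derivative ?F' s y) (at s)" for s y
        proof -
          let ?c = "\<lambda>s. y0 + s *\<^sub>R v"
          have n: "((\<lambda>s. (norm (y - ?c s))\<^sup>2 / q\<^sup>2) has_real_derivative - 2 * ((y - ?c s) \<bullet> v) / q\<^sup>2) (at s)"
            unfolding power2_norm_eq_inner
          proof (rule DERIV_cdivide)
            show "((\<lambda>s. (y - ?c s) \<bullet> (y - ?c s)) has_real_derivative - 2 * ((y - ?c s) \<bullet> v)) (at s)"
              unfolding has_field_derivative_def
              by (auto intro!: derivative_eq_intros simp: fun_eq_iff inner_commute algebra_simps)
          qed
          have "((\<lambda>s. G ((norm (y - ?c s))\<^sup>2 / q\<^sup>2) / q ^ DIM('a)) has_real_derivative
             (- g ((norm (y - ?c s))\<^sup>2 / q\<^sup>2) / 2 * (- 2 * ((y - ?c s) \<bullet> v) / q\<^sup>2)) / q ^ DIM('a)) (at s)"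
            by (intro DERIV_cdivide DERIV_chain2[OF Gg n])
          then have "((\<lambda>s. complex_of_real (G ((norm (y - ?c s))\<^sup>2 / q\<^sup>2) / q ^ DIM('a))) has_vector_derivative
             of_real ((- g ((norm (y - ?c s))\<^sup>2 / q\<^sup>2) / 2 * (- 2 * ((y - ?c s) \<bullet> v) / q\<^sup>2)) / q ^ DIM('a))) (at s)"
            unfolding has_real_derivative_iff_has_vector_derivative
            by (rule bounded_linear.has_vector_derivative[OF bounded_linear_of_real])
          then show ?thesis
            unfolding mollifier_def radial_def
            by (intro bounded_linear.has_vector_derivative[OF bounded_linear_mult_right]) (simp add: mult_ac)
        qed
      qed (use t in auto)
      moreover have "dist (y0 + t *\<^sub>R v) y0 < R / 4" using tv t by (simp add: dist_norm)
      ultimately show "((\<lambda>t. \<integral>y. ?F t y \<partial>lebesgue) has_derivative (\<lambda>h. 0)) (at t within {-1<..<1})"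
        using lin[OF _ v, of "y0 + t *\<^sub>R v"] by (auto simp: has_vector_derivative_def intro: has_derivative_at_withinI)
    qed auto
    then obtain c where c: "\<And>t. t \<in> {-1<..<1} \<Longrightarrow> (\<integral>y. ?F t y \<partial>lebesgue) = c" by blast
    have "(\<integral>y. ?F (1 / 2) y \<partial>lebesgue) = (\<integral>y. ?F 0 y \<partial>lebesgue)"
      using c[of "1 / 2"] c[of 0] by simp
    then show ?thesis
      using hP[of "y0 + (1 / 2) *\<^sub>R v"] hP[of y0] tv[of "1 / 2"] RR by (auto simp: dist_norm)
  qed
  have P0: "P \<noteq> 0"
    unfolding P_def G_def[abs_def] by (rule integral_flat_mollifier_nonzero[OF q(1)])
  have "h y = h y0" if "y \<in> ball y0 (R / 8)" for y
    using const[of "2 *\<^sub>R (y - y0)"] P0 that by (simp add: dist_norm norm_minus_commute)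
  moreover have "dist (\<tau> y) (\<tau> y') = dist y y'" if "y \<in> ball y0 (R / 8)" "y' \<in> ball y0 (R / 8)" for y y'
    using that RR by (intro iso2) (auto simp: dist_commute)
  moreover have "R / 8 > 0" "R / 8 \<le> r" using RR by auto
  ultimately show ?thesis by blast
qed

subsection \<open>Weighted composition operators\<close>

lemma sup_norm_le: "K \<noteq> {} \<Longrightarrow> (\<And>x. x \<in> K \<Longrightarrow> cmod (f x) \<le> b) \<Longrightarrow> sup_norm K f \<le> b"
  unfolding sup_norm_def by (rule cSUP_least)

lemma le_sup_norm:
  assumes "compact K" "f \<in> C K" "x \<in> K" shows "cmod (f x) \<le> sup_norm K f"
proof -
  have "compact ((\<lambda>x. cmod (f x)) ` K)"
    using assms by (intro compact_continuous_image continuous_on_norm) (auto simp: C_def)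
  then have "bdd_above ((\<lambda>x. cmod (f x)) ` K)" by (intro bounded_imp_bdd_above compact_imp_bounded)
  then show ?thesis unfolding sup_norm_def using assms(3) by (rule cSUP_upper[rotated])
qed

text \<open>The functional is carried by at most one point. If every point has a neighbourhood on
  which it vanishes, a partition of unity makes it \<open>0\<close>. Otherwise some \<open>p\<close>
  admits, in every neighbourhood, a function with nonzero value; disjointness then annihilates all
  functions vanishing near \<open>p\<close>, and boundedness all those vanishing at
  \<open>p\<close>.\<close>

lemma disjointness_preserving_functional:
  fixes K :: "'a::metric_space set"
  assumes K: "compact K" "K \<noteq> {}"
    and add: "\<And>f g. f \<in> C K \<Longrightarrow> g \<in> C K \<Longrightarrow> \<phi> (\<lambda>y. f y + g y) = \<phi> f + \<phi> g"
    and scale: "\<And>a f. f \<in> C K \<Longrightarrow> \<phi> (\<lambda>y. a * f y) = a * \<phi> f"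
    and bnd: "\<And>f. f \<in> C K \<Longrightarrow> cmod (\<phi> f) \<le> B * sup_norm K f"
    and disj: "\<And>f g. f \<in> C K \<Longrightarrow> g \<in> C K \<Longrightarrow> \<forall>x\<in>K. f x * g x = 0 \<Longrightarrow> \<phi> f * \<phi> g = 0"
  shows "\<exists>p\<in>K. \<forall>f\<in>C K. \<phi> f = \<phi> (\<lambda>_. 1) * f p"
proof -
  have bnd': "cmod (\<phi> f) \<le> \<bar>B\<bar> * b" if "f \<in> C K" "\<And>x. x \<in> K \<Longrightarrow> cmod (f x) \<le> b" for f b
  proof -
    have "sup_norm K f \<le> b" by (rule sup_norm_le[OF K(2) that(2)])
    moreover have "0 \<le> sup_norm K f"
      using K(2) le_sup_norm[OF K(1) that(1)] norm_ge_zero order_trans by blast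
    ultimately have "B * sup_norm K f \<le> \<bar>B\<bar> * b" by (intro mult_mono) auto
    then show ?thesis using bnd[OF that(1)] by linarith
  qed
  have zero: "\<phi> f = 0" if "f \<in> C K" "\<And>x. x \<in> K \<Longrightarrow> f x = 0" for f
    using bnd'[OF that(1), of 0] that(2) by simp
  have cong: "\<phi> f = \<phi> g" if "f \<in> C K" "g \<in> C K" "\<And>x. x \<in> K \<Longrightarrow> f x = g x" for f g
  proof -
    have c: "(\<lambda>y. f y - g y) \<in> C K" using that unfolding C_def by (auto intro: continuous_intros)
    have "\<phi> f = \<phi> (\<lambda>y. g y + (f y - g y))" by simp
    also have "\<dots> = \<phi> g" using add[OF that(2) c] zero[OF c] that(3) by simp
    finally show ?thesis .
  qed
  show ?thesis
  proof (cases "\<forall>p\<in>K. \<exists>e>0. \<forall>f\<in>C K. (\<forall>y\<in>K. dist p y \<ge> e \<longrightarrow> f y = 0) \<longrightarrow> \<phi> f = 0")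
    case True
    then obtain e where e: "\<And>p. p \<in> K \<Longrightarrow> e p > 0"
      "\<And>p f. p \<in> K \<Longrightarrow> f \<in> C K \<Longrightarrow> (\<And>y. y \<in> K \<Longrightarrow> dist p y \<ge> e p \<Longrightarrow> f y = 0) \<Longrightarrow> \<phi> f = 0"
      by metis
    obtain F where F: "F \<subseteq> K" "finite F" "K \<subseteq> (\<Union>p\<in>F. ball p (e p))"
      using compactE_image[OF K(1), of K "\<lambda>p. ball p (e p)"] e(1) by (metis (no_types, lifting) UN_I centre_in_ball open_ball subsetI)
    \<comment> \<open>Tent functions on the covering balls; dividing them by their sum gives the
      partition of unity.\<close>
    define d where "d p y = max 0 (e p - dist p y)" for p y
    define s where "s y = (\<Sum>p\<in>F. d p y)" for y
    have s: "s y > 0" if "y \<in> K" for y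
    proof -
      obtain p where p: "p \<in> F" "y \<in> ball p (e p)" using subsetD[OF F(3) \<open>y \<in> K\<close>] by blast
      then have "0 < d p y" by (simp add: d_def)
      also have "\<dots> \<le> s y" unfolding s_def by (rule member_le_sum[OF p(1) _ F(2)]) (simp add: d_def)
      finally show ?thesis .
    qed
    have all0: "\<phi> f = 0" if f: "f \<in> C K" for f
    proof -
      have cd: "continuous_on K (d p)" for p unfolding d_def[abs_def] by (intro continuous_intros)
      have cs: "continuous_on K s" unfolding s_def[abs_def] by (intro continuous_intros cd)
      have "continuous_on K (\<lambda>y. d p y / s y)" for p
        by (rule continuous_on_divide[OF cd cs]) (use s in force)
      then have c: "(\<lambda>y. f y * of_real (d p y / s y)) \<in> C K" for p
        using f unfolding C_def mem_Collect_eq by (intro continuous_on_mult continuous_on_of_real)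
      have "(\<lambda>y. \<Sum>p\<in>G. f y * of_real (d p y / s y)) \<in> C K \<and>
        \<phi> (\<lambda>y. \<Sum>p\<in>G. f y * of_real (d p y / s y)) = 0" if "G \<subseteq> F" "finite G" for G
        using that(2,1)
      proof (induction G rule: finite_induct)
        case empty
        then show ?case using zero[of "\<lambda>_. 0"] by (simp add: C_def)
      next
        case (insert p G)
        have "\<phi> (\<lambda>y. f y * of_real (d p y / s y)) = 0"
          using insert.prems F(1) by (intro e(2)[of p] c) (auto simp: d_def)
        then show ?case
          using insert add[OF c[of p], of "\<lambda>y. \<Sum>p\<in>G. f y * of_real (d p y / s y)"] c[of p]
          by (auto simp: C_def intro!: continuous_on_add)
      qed
      from this[OF order_refl F(2)]
      have 1: "(\<lambda>y. \<Sum>p\<in>F. f y * of_real (d p y / s y)) \<in> C K"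
        and 2: "\<phi> (\<lambda>y. \<Sum>p\<in>F. f y * of_real (d p y / s y)) = 0" by auto
      have "(\<Sum>p\<in>F. f y * of_real (d p y / s y)) = f y" if "y \<in> K" for y
      proof -
        have "(\<Sum>p\<in>F. f y * complex_of_real (d p y / s y)) = f y * of_real (s y / s y)"
          by (simp only: sum_distrib_left[symmetric] of_real_sum[symmetric] sum_divide_distrib[symmetric] s_def)
        then show ?thesis using s[OF that] by simp
      qed
      then show ?thesis using cong[OF f 1] 2 by simp
    qed
    obtain p where "p \<in> K" using K(2) by blast
    moreover have "(\<lambda>_. 1) \<in> C K" by (simp add: C_def)
    ultimately show ?thesis using all0 by auto
  next
    case False
    then obtain p where p: "p \<in> K"
      "\<And>e. e > 0 \<Longrightarrow> \<exists>f\<in>C K. (\<forall>y\<in>K. dist p y \<ge> e \<longrightarrow> f y = 0) \<and> \<phi> f \<noteq> 0" by blast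
    have van: "\<phi> g = 0" if g: "g \<in> C K" and gp: "g p = 0" for g
    proof -
      have le: "cmod (\<phi> g) \<le> \<bar>B\<bar> * (2 * e)" if e: "e > 0" for e
      proof -
        \<comment> \<open>\<open>ge\<close> vanishes where \<open>|g| \<le> e\<close> and equals
          \<open>g\<close> where \<open>|g| \<ge> 2 e\<close>: it is uniformly within
          \<open>2 e\<close> of \<open>g\<close>, yet disjoint from functions concentrated near
          \<open>p\<close>.\<close>
        define ge where "ge y = g y * of_real (min 1 (max 0 (cmod (g y) / e - 1)))" for y
        have ge: "ge \<in> C K" using g e unfolding C_def ge_def by (auto intro!: continuous_intros)
        obtain \<delta> where \<delta>: "\<delta> > 0" "\<And>y. y \<in> K \<Longrightarrow> dist y p < \<delta> \<Longrightarrow> cmod (g y) < e"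
        proof -
          have "\<exists>d>0. \<forall>y\<in>K. dist y p < d \<longrightarrow> dist (g y) (g p) < e"
            using g p(1) e unfolding C_def continuous_on_iff by blast
          then show ?thesis using that gp by auto
        qed
        obtain f where f: "f \<in> C K" "\<And>y. y \<in> K \<Longrightarrow> dist p y \<ge> \<delta> \<Longrightarrow> f y = 0" "\<phi> f \<noteq> 0"
          using p(2)[OF \<delta>(1)] by blast
        have "f y * ge y = 0" if "y \<in> K" for y
        proof (cases "dist p y \<ge> \<delta>")
          case False
          then have "cmod (g y) / e < 1" using \<delta>(2)[OF that] e by (simp add: dist_commute)
          then show ?thesis by (simp add: ge_def)
        qed (use f(2) that in auto)
        then have ge0: "\<phi> ge = 0" using disj[OF f(1) ge] f(3) by auto
        have c: "(\<lambda>y. g y - ge y) \<in> C K" using g ge unfolding C_def by (auto intro: continuous_intros)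
        have "\<phi> g = \<phi> (\<lambda>y. ge y + (g y - ge y))" by simp
        also have "\<dots> = \<phi> (\<lambda>y. g y - ge y)" unfolding add[OF ge c] ge0 by simp
        finally have eq: "\<phi> g = \<phi> (\<lambda>y. g y - ge y)" .
        show ?thesis unfolding eq
        proof (rule bnd'[OF c])
          fix y
          let ?m = "min 1 (max 0 (cmod (g y) / e - 1))"
          have "g y - ge y = g y * of_real (1 - ?m)" by (simp add: ge_def algebra_simps)
          then have eq: "cmod (g y - ge y) = cmod (g y) * (1 - ?m)" by (simp only: norm_mult norm_of_real)
          show "cmod (g y - ge y) \<le> 2 * e"
          proof (cases "cmod (g y) \<le> 2 * e")
            case True
            have "cmod (g y) * (1 - ?m) \<le> cmod (g y) * 1" by (intro mult_left_mono) auto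
            then show ?thesis unfolding eq using True by linarith
          next
            case False
            then have "cmod (g y) / e > 2" using e by (simp add: less_divide_eq)
            then have "?m = 1" by simp
            then show ?thesis unfolding eq using e by simp
          qed
        qed
      qed
      have "cmod (\<phi> g) \<le> 0"
      proof (rule field_le_epsilon)
        fix e :: real assume e: "e > 0"
        have "cmod (\<phi> g) \<le> \<bar>B\<bar> * (2 * (e / (2 * (\<bar>B\<bar> + 1))))" using e by (intro le) simp
        also have "\<dots> \<le> e" using e by (simp add: field_simps)
        finally show "cmod (\<phi> g) \<le> 0 + e" by simp
      qed
      then show ?thesis by simp
    qed
    have "\<phi> f = \<phi> (\<lambda>_. 1) * f p" if f: "f \<in> C K" for f
    proof -
      have one: "(\<lambda>_. 1) \<in> C K" and const: "(\<lambda>_. f p * 1) \<in> C K" by (auto simp: C_def)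
      have c: "(\<lambda>y. f y - f p) \<in> C K" using f unfolding C_def by (auto intro: continuous_intros)
      have "\<phi> f = \<phi> (\<lambda>y. f p * 1 + (f y - f p))" by simp
      also have "\<dots> = \<phi> (\<lambda>y. f p * 1) + \<phi> (\<lambda>y. f y - f p)" by (rule add[OF const c])
      also have "\<dots> = f p * \<phi> (\<lambda>_. 1)" using scale[OF one, of "f p"] van[OF c] by simp
      finally show ?thesis by simp
    qed
    then show ?thesis using p(1) by blast
  qed
qed

text \<open>Evaluation of \<open>U\<close> at a point is a functional of the preceding kind, with
  weight \<open>h = U 1\<close>. Where \<open>h\<close> vanishes the point \<open>\<tau> y\<close>
  is arbitrary, so continuity is claimed only off the zeros of \<open>h\<close>; there the
  coordinates of \<open>\<tau>\<close> are the images of the coordinate functions divided by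
  \<open>h\<close>.\<close>

lemma weighted_composition:
  fixes K :: "'a::euclidean_space set" and L :: "'b::metric_space set"
  assumes K: "compact K" "K \<noteq> {}" and L: "compact L" and U: "bounded_linear_C K L U"
    and disj: "\<forall>f\<in>C K. \<forall>g\<in>C K. (\<forall>x\<in>K. f x * g x = 0) \<longrightarrow> (\<forall>x\<in>L. U f x * U g x = 0)"
  obtains h \<tau> where "continuous_on L h" "\<And>y. y \<in> L \<Longrightarrow> \<tau> y \<in> K"
    "\<And>f y. f \<in> C K \<Longrightarrow> y \<in> L \<Longrightarrow> U f y = h y * f (\<tau> y)" "continuous_on {y\<in>L. h y \<noteq> 0} \<tau>"
proof -
  obtain B where B: "\<And>f. f \<in> C K \<Longrightarrow> sup_norm L (U f) \<le> B * sup_norm K f"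
    using U unfolding bounded_linear_C_def by blast
  have U': "U f \<in> C L" if "f \<in> C K" for f using U that unfolding bounded_linear_C_def by blast
  have one: "(\<lambda>_. 1) \<in> C K" by (simp add: C_def)
  define h where "h = U (\<lambda>_. 1)"
  have "\<exists>p\<in>K. \<forall>f\<in>C K. U f y = U (\<lambda>_. 1) y * f p" if y: "y \<in> L" for y
  proof (rule disjointness_preserving_functional[OF K, where \<phi>="\<lambda>f. U f y" and B=B])
    show "cmod (U f y) \<le> B * sup_norm K f" if "f \<in> C K" for f
      using le_sup_norm[OF L U'[OF that] y] B[OF that] by linarith
  qed (use U disj y in \<open>auto simp: bounded_linear_C_def\<close>)
  then obtain \<tau> where \<tau>: "\<And>y. y \<in> L \<Longrightarrow> \<tau> y \<in> K" "\<And>f y. f \<in> C K \<Longrightarrow> y \<in> L \<Longrightarrow> U f y = h y * f (\<tau> y)"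
    unfolding h_def by metis
  have h: "continuous_on L h" using U'[OF one] by (simp add: h_def C_def)
  have "continuous_on {y\<in>L. h y \<noteq> 0} (\<lambda>y. \<tau> y \<bullet> i)" for i
  proof -
    have c: "(\<lambda>x. complex_of_real (x \<bullet> i)) \<in> C K" by (auto simp: C_def intro!: continuous_intros)
    have "continuous_on L (U (\<lambda>x. complex_of_real (x \<bullet> i)))" using U'[OF c] by (simp add: C_def)
    then have "continuous_on {y\<in>L. h y \<noteq> 0} (\<lambda>y. Re (U (\<lambda>x. complex_of_real (x \<bullet> i)) y / h y))"
      using h by (auto intro!: continuous_intros intro: continuous_on_subset)
    then show ?thesis
      by (rule continuous_on_eq) (use \<tau>(2)[OF c] in auto)
  qed
  then have "continuous_on {y\<in>L. h y \<noteq> 0} \<tau>"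
    using continuous_on_componentwise by blast
  then show ?thesis using that h \<tau> by blast
qed

text \<open>Take the tail of a bump supported between \<open>1 / 2\<close> and \<open>1\<close>,
  normalised by its value at \<open>1 / 2\<close>.\<close>

lemma cutoff_profile:
  obtains \<eta> where "radial_profile \<eta>" "\<And>s. s \<le> 1 / 2 \<Longrightarrow> \<eta> s = 1" "\<And>s. 0 \<le> \<eta> s" "\<And>s. \<eta> s \<le> 1"
proof -
  define g where "g s = flat_exp 0 (s - 1 / 2) * flat_exp 0 (1 - s)" for s
  have sm: "smooth (\<lambda>s. s - 1 / 2 :: real)" "smooth (\<lambda>s. 1 - s :: real)"
    using smooth_diff_const[of "1 / 2 :: real"]
      smooth_add[OF smooth_const[of 1] smooth_linear[OF bounded_linear_minus[OF bounded_linear_ident]]] by simp_all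
  have g: "radial_profile g"
    unfolding radial_profile_def g_def[abs_def]
    by (intro conjI smooth_mult smooth_compose_real[OF smooth_flat_exp] sm) (auto simp: flat_exp_zero)
  obtain G where G: "radial_profile G" "\<And>s. (G has_real_derivative - g s / 2) (at s)"
    using radial_profile_tail[OF g] by blast
  have half: "G s = G (1 / 2)" if "s \<le> 1 / 2" for s
  proof (cases "s = 1 / 2")
    case False
    then obtain z where "z < 1 / 2" "G (1 / 2) - G s = (1 / 2 - s) * (- g z / 2)"
      using MVT2[of s "1 / 2" G "\<lambda>s. - g s / 2"] G(2) \<open>s \<le> 1 / 2\<close> by auto
    then show ?thesis by (simp add: g_def flat_exp_zero)
  qed (simp only:)
  obtain z where z: "1 / 2 < z" "z < (1::real)" "G 1 - G (1 / 2) = (1 - 1 / 2) * (- g z / 2)"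
    using MVT2[of "1 / 2" 1 G "\<lambda>s. - g s / 2"] G(2) by auto
  have "g z > 0" using z flat_exp_pos by (simp add: g_def)
  moreover have "G 1 = 0" using G(1) by (simp add: radial_profile_def)
  ultimately have pos: "G (1 / 2) > 0" using z(3) by simp
  show ?thesis
  proof
    show "radial_profile (\<lambda>s. (1 / G (1 / 2)) * G s)"
      unfolding radial_profile_def
      by (intro conjI smooth_mult smooth_const) (use G(1) in \<open>auto simp: radial_profile_def\<close>)
    show "(1 / G (1 / 2)) * G s = 1" if "s \<le> 1 / 2" for s using half[OF that] pos by simp
    have mono: "G t \<le> G s" if "s \<le> t" for s t
      by (rule DERIV_nonpos_imp_nonincreasing[OF that])
        (use G(2) flat_exp_nonneg in \<open>force simp: g_def\<close>)
    have "0 \<le> G s" for s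
      using mono[of s "max s 1"] G(1) by (simp add: radial_profile_def max_def)
    then show "0 \<le> (1 / G (1 / 2)) * G s" for s using pos by simp
    have "G s \<le> G (1 / 2)" for s
      using mono[of "1 / 2" s] half[of s] by (cases "s \<le> 1 / 2") auto
    then show "(1 / G (1 / 2)) * G s \<le> 1" for s using pos by simp
  qed
qed

lemma integral_lebesgue_on_eq:
  fixes F G :: "'a::euclidean_space \<Rightarrow> complex"
  assumes "S \<in> sets lebesgue" "\<And>y. G y = (if y \<in> S then F y else 0)"
  shows "(\<integral>y. F y \<partial>lebesgue_on S) = (\<integral>y. G y \<partial>lebesgue)"
  using Lebesgue_Measure.integral_restrict_UNIV[OF assms(1), of F] assms(2) by simp

text \<open>The powers are not test functions, so they are multiplied by a cut-off. This does no
  harm: \<open>U f\<close> and \<open>U (laplacian f)\<close> at \<open>y\<close> only see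
  \<open>f\<close> near \<open>\<tau> y\<close>, where the cut-off is \<open>1\<close> for all
  \<open>y\<close> close to \<open>y0\<close>.\<close>

lemma intertwining_local_rigidity:
  fixes \<Omega>\<^sub>1 \<Omega>\<^sub>2 :: "'a::euclidean_space set"
  assumes o1: "open \<Omega>\<^sub>1" and o2: "open \<Omega>\<^sub>2"
    and h: "continuous_on (closure \<Omega>\<^sub>2) h" and \<tau>: "continuous_on {y \<in> closure \<Omega>\<^sub>2. h y \<noteq> 0} \<tau>"
    and U: "\<And>f y. f \<in> C (closure \<Omega>\<^sub>1) \<Longrightarrow> y \<in> closure \<Omega>\<^sub>2 \<Longrightarrow> U f y = h y * f (\<tau> y)"
    and lap: "\<forall>f\<in>test_functions \<Omega>\<^sub>1. distributional_laplacian \<Omega>\<^sub>2 (U f) (U (laplacian f))"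
    and y0: "y0 \<in> \<Omega>\<^sub>2" "h y0 \<noteq> 0" "\<tau> y0 \<in> \<Omega>\<^sub>1"
  shows "\<exists>e>0. ball y0 e \<subseteq> \<Omega>\<^sub>2 \<and> (\<forall>y\<in>ball y0 e. h y = h y0 \<and> \<tau> y \<in> \<Omega>\<^sub>1 \<and>
    (\<forall>y'\<in>ball y0 e. dist (\<tau> y) (\<tau> y') = dist y y'))"
proof -
  define V where "V = {y \<in> closure \<Omega>\<^sub>2. h y \<noteq> 0}"
  have ch: "isCont h y0"
    using y0(1) o2 h by (metis closure_subset continuous_on_eq_continuous_at continuous_on_subset)
  obtain r1 where r1: "r1 > 0" "cball y0 r1 \<subseteq> \<Omega>\<^sub>2" using open_contains_cball o2 y0(1) by metis
  obtain r2 where r2: "r2 > 0" "\<And>y. dist y0 y < r2 \<Longrightarrow> h y \<noteq> 0"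
    using continuous_at_avoid[OF ch y0(2)] by blast
  define r3 where "r3 = min r1 (r2 / 2)"
  have r3: "r3 > 0" "cball y0 r3 \<subseteq> \<Omega>\<^sub>2" "cball y0 r3 \<subseteq> V"
    using r1 r2 closure_subset[of \<Omega>\<^sub>2] by (auto simp: r3_def V_def subset_iff)
  have t3: "continuous_on (cball y0 r3) \<tau>" using \<tau> r3(3) continuous_on_subset unfolding V_def by blast
  then have ct: "isCont \<tau> y0" using r3(1) by (intro continuous_on_interior) (auto simp: interior_cball)
  obtain \<rho>' where rr: "\<rho>' > 0" "cball (\<tau> y0) \<rho>' \<subseteq> \<Omega>\<^sub>1" using open_contains_cball o1 y0(3) by metis
  \<comment> \<open>Nested radii: centres \<open>a\<close> lie within \<open>\<rho>\<close> of
    \<open>\<tau> y0\<close>, the image of the small ball within \<open>2 * \<rho>\<close> of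
    \<open>a\<close>, the cut-off power is supported within \<open>3 * \<rho>\<close> of
    \<open>a\<close>, and all of it stays within \<open>4 * \<rho>\<close> of
    \<open>\<tau> y0\<close>.\<close>
  define \<rho> where "\<rho> = \<rho>' / 4"
  have rho: "\<rho> > 0" "cball (\<tau> y0) (4 * \<rho>) \<subseteq> \<Omega>\<^sub>1" using rr by (auto simp: \<rho>_def)
  obtain r4 where r4: "r4 > 0" "\<And>y. dist y y0 < r4 \<Longrightarrow> dist (\<tau> y) (\<tau> y0) < \<rho>"
    using ct rho(1) unfolding continuous_at_eps_delta by metis
  define r where "r = min r3 (r4 / 2)"
  have r: "r > 0" "cball y0 r \<subseteq> cball y0 r3" "r < r4" using r3 r4 by (auto simp: r_def)
  have t\<rho>: "dist (\<tau> y) (\<tau> y0) < \<rho>" if "y \<in> ball y0 r" for y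
    using r4(2)[of y] that r(3) by (simp add: dist_commute)
  have bO: "ball y0 r \<subseteq> \<Omega>\<^sub>2" using r(2) r3(2) ball_subset_cball by blast
  obtain \<eta> where \<eta>: "radial_profile \<eta>" "\<And>s. s \<le> 1 / 2 \<Longrightarrow> \<eta> s = 1" by (rule cutoff_profile) (rule that)
  have "\<exists>e>0. e \<le> r \<and> (\<forall>y\<in>ball y0 e. h y = h y0 \<and> (\<forall>y'\<in>ball y0 e. dist (\<tau> y) (\<tau> y') = dist y y'))"
  proof (rule local_rigidity[of r y0 h \<tau>, OF r(1) _ _ y0(2)])
    show "continuous_on (cball y0 r) h" "continuous_on (cball y0 r) \<tau>"
      using r(2) r3(2) closure_subset[of \<Omega>\<^sub>2] h t3 by (meson continuous_on_subset order_trans)+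
    fix a k \<psi> assume a: "a \<in> \<tau> ` ball y0 r" and psi: "\<psi> \<in> test_functions (ball y0 r)"
    define P where "P k = radial (\<lambda>s. s ^ k) 1 a" for k
    define f where "f z = P k z * radial \<eta> (3 * \<rho>) a z" for z
    have ad: "dist a (\<tau> y0) < \<rho>" using a t\<rho> by blast
    have sub: "cball a (3 * \<rho>) \<subseteq> \<Omega>\<^sub>1"
    proof
      fix z assume "z \<in> cball a (3 * \<rho>)"
      then have "dist (\<tau> y0) z \<le> 4 * \<rho>" using ad dist_triangle[of "\<tau> y0" z a] by (simp add: dist_commute)
      then show "z \<in> \<Omega>\<^sub>1" using rho(2) by auto
    qed
    have f: "f \<in> test_functions \<Omega>\<^sub>1"
    proof (rule smooth_test_functionI[OF _ _ sub])
      show "smooth f" unfolding f_def[abs_def] P_def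
        using \<eta>(1) by (intro smooth_mult smooth_radial smooth_real_power) (simp add: radial_profile_def)
      show "f z = 0" if "z \<notin> cball a (3 * \<rho>)" for z
        using radial_outside[of \<eta> "3 * \<rho>" a z] \<eta>(1) rho(1) that by (simp add: f_def radial_profile_def)
    qed
    then have sf: "smooth f" using test_functionE by metis
    have fP: "f z = P k z" if "z \<in> ball a (2 * \<rho>)" for z
    proof -
      \<comment> \<open>The squared ratio of the radii, \<open>4 / 9\<close>, lies below
        \<open>1 / 2\<close>, where the cut-off profile equals \<open>1\<close>.\<close>
      have "(norm (z - a))\<^sup>2 \<le> (2 * \<rho>)\<^sup>2" using that by (intro power_mono) (auto simp: dist_norm norm_minus_commute)
      then have "2 * (norm (z - a))\<^sup>2 \<le> 9 * \<rho>\<^sup>2"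
        using zero_le_power2[of \<rho>] unfolding power_mult_distrib by (simp only: power2_eq_square)
      then have "(norm (z - a))\<^sup>2 / (3 * \<rho>)\<^sup>2 \<le> 1 / 2"
        using rho(1) by (simp add: divide_le_eq power_mult_distrib)
      then show ?thesis by (simp add: f_def radial_def[of \<eta>] \<eta>(2))
    qed
    have lP: "laplacian f z = eigen_factor TYPE('a) k * P (k - 1) z" if "z \<in> ball a (2 * \<rho>)" for z
      using laplacian_cong_open[OF open_ball that, of f "P k", OF fP] unfolding P_def laplacian_norm_power .
    have tb: "\<tau> y \<in> ball a (2 * \<rho>)" if "y \<in> ball y0 r" for y
      using t\<rho>[OF that] ad dist_triangle[of a "\<tau> y" "\<tau> y0"] by (simp add: dist_commute)
    have C: "f \<in> C (closure \<Omega>\<^sub>1)" "laplacian f \<in> C (closure \<Omega>\<^sub>1)"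
      unfolding C_def using smooth_continuous_on[OF sf] smooth_continuous_on[OF smooth_laplacian[OF sf]] by auto
    have z: "\<psi> y = 0" "laplacian \<psi> y = 0" if "y \<notin> ball y0 r" for y
      using test_functionE[OF psi] that by metis+
    have yc: "y \<in> closure \<Omega>\<^sub>2" if "y \<in> ball y0 r" for y using that bO closure_subset by blast
    have P: "P j z = of_real ((dist z a)\<^sup>2 ^ j)" for j z unfolding P_def by (rule radial_norm_power)
    have psi2: "\<psi> \<in> test_functions \<Omega>\<^sub>2" using psi test_functions_mono[OF bO] by blast
    have m: "\<Omega>\<^sub>2 \<in> sets lebesgue" using o2 by simp
    have "(\<integral>y. U f y * laplacian \<psi> y \<partial>lebesgue_on \<Omega>\<^sub>2) = (\<integral>y. U (laplacian f) y * \<psi> y \<partial>lebesgue_on \<Omega>\<^sub>2)"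
      using lap f psi2 unfolding distributional_laplacian_def by blast
    moreover have "(\<integral>y. U f y * laplacian \<psi> y \<partial>lebesgue_on \<Omega>\<^sub>2) =
      (\<integral>y. restr (ball y0 r) (\<lambda>y. h y * of_real ((dist (\<tau> y) a)\<^sup>2 ^ k)) y * laplacian \<psi> y \<partial>lebesgue)"
    proof (rule integral_lebesgue_on_eq[OF m])
      fix y show "restr (ball y0 r) (\<lambda>y. h y * of_real ((dist (\<tau> y) a)\<^sup>2 ^ k)) y * laplacian \<psi> y =
        (if y \<in> \<Omega>\<^sub>2 then U f y * laplacian \<psi> y else 0)"
        using z(2)[of y] bO U[OF C(1) yc, of y] fP[OF tb, of y] P
        by (cases "y \<in> ball y0 r") (auto simp: restr_def)
    qed
    moreover have "(\<integral>y. U (laplacian f) y * \<psi> y \<partial>lebesgue_on \<Omega>\<^sub>2) =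
      (\<integral>y. eigen_factor TYPE('a) k * (restr (ball y0 r) (\<lambda>y. h y * of_real ((dist (\<tau> y) a)\<^sup>2 ^ (k - 1))) y * \<psi> y) \<partial>lebesgue)"
    proof (rule integral_lebesgue_on_eq[OF m])
      fix y show "eigen_factor TYPE('a) k * (restr (ball y0 r) (\<lambda>y. h y * of_real ((dist (\<tau> y) a)\<^sup>2 ^ (k - 1))) y * \<psi> y) =
        (if y \<in> \<Omega>\<^sub>2 then U (laplacian f) y * \<psi> y else 0)"
        using z(1)[of y] bO U[OF C(2) yc, of y] lP[OF tb, of y] P
        by (cases "y \<in> ball y0 r") (auto simp: restr_def)
    qed
    ultimately show "(\<integral>y. restr (ball y0 r) (\<lambda>y. h y * of_real ((dist (\<tau> y) a)\<^sup>2 ^ k)) y * laplacian \<psi> y \<partial>lebesgue) =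
      eigen_factor TYPE('a) k *
        (\<integral>y. restr (ball y0 r) (\<lambda>y. h y * of_real ((dist (\<tau> y) a)\<^sup>2 ^ (k - 1))) y * \<psi> y \<partial>lebesgue)"
      by simp
  qed
  then obtain e where e: "e > 0" "e \<le> r" "\<forall>y\<in>ball y0 e. h y = h y0 \<and> (\<forall>y'\<in>ball y0 e. dist (\<tau> y) (\<tau> y') = dist y y')"
    by blast
  have "ball y0 e \<subseteq> ball y0 r" using e(2) by (simp add: subset_ball)
  moreover have "\<tau> y \<in> \<Omega>\<^sub>1" if "y \<in> ball y0 r" for y
  proof -
    have "\<tau> y \<in> cball (\<tau> y0) (4 * \<rho>)" using t\<rho>[OF that] rho(1) by (simp add: dist_commute)
    then show ?thesis using rho(2) by blast
  qed
  ultimately have "\<And>y. y \<in> ball y0 e \<Longrightarrow> \<tau> y \<in> \<Omega>\<^sub>1" "ball y0 e \<subseteq> \<Omega>\<^sub>2" using bO by blast+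
  then show ?thesis using e(1,3) by blast
qed

subsection \<open>Isometries and inner normals\<close>

lemma isometry_affine:
  fixes T :: "'a::euclidean_space \<Rightarrow> 'a"
  assumes "is_isometry T"
  obtains A where "orthogonal_transformation A" "\<And>x. T x = T 0 + A x"
proof
  show "orthogonal_transformation (\<lambda>x. T x - T 0)"
    using assms by (simp add: orthogonal_transformation_isometry is_isometry_def dist_norm)
qed simp

lemma is_isometry_affineI:
  fixes A :: "'a::euclidean_space \<Rightarrow> 'a"
  assumes "orthogonal_transformation A" shows "is_isometry (\<lambda>x. b + A (x - c))"
proof -
  have "A (x - c) - A (y - c) = A (x - y)" for x y
    using linear_diff[OF orthogonal_transformation_linear[OF assms], of "x - c" "y - c"] by simp
  then show ?thesis
    using orthogonal_transformation_norm[OF assms] by (simp add: is_isometry_def dist_norm)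
qed

lemma isometry_continuous: "is_isometry T \<Longrightarrow> continuous_on S T"
  unfolding is_isometry_def continuous_on_iff by metis

lemma isometry_inverse:
  fixes T :: "'a::euclidean_space \<Rightarrow> 'a"
  assumes T: "is_isometry T"
  obtains S where "is_isometry S" "\<And>x. T (S x) = x" "\<And>x. S (T x) = x"
proof -
  obtain A where A: "orthogonal_transformation A" "\<And>x. T x = T 0 + A x" using isometry_affine[OF T] by blast
  have s: "T (inv A (x - T 0)) = x" for x
    using A(2)[of "inv A (x - T 0)"] surj_f_inv_f[OF orthogonal_transformation_surj[OF A(1)]] by simp
  have d: "dist (T x) (T y) = dist x y" for x y using T by (simp add: is_isometry_def)
  show ?thesis
  proof
    show "is_isometry (\<lambda>x. inv A (x - T 0))"
      unfolding is_isometry_def by (metis d s)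
    show "T (inv A (x - T 0)) = x" for x by (rule s)
    show "inv A (T x - T 0) = x" for x
      using d[of "inv A (T x - T 0)" x] s[of "T x"] by simp
  qed
qed

text \<open>Polarisation turns distances into inner products, so the rescaled images
  \<open>a i\<close> of basis displacements are orthonormal. The candidate sends the basis to them;
  its error \<open>w\<close> is orthogonal to every \<open>a i\<close>, hence
  \<open>0\<close>.\<close>

lemma isometry_extend_ball:
  fixes \<tau> :: "'a::euclidean_space \<Rightarrow> 'a"
  assumes e: "e > 0" and iso: "\<And>y y'. y \<in> ball y0 e \<Longrightarrow> y' \<in> ball y0 e \<Longrightarrow> dist (\<tau> y) (\<tau> y') = dist y y'"
  obtains T where "is_isometry T" "\<And>y. y \<in> ball y0 e \<Longrightarrow> \<tau> y = T y"
proof -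
  have y0: "y0 \<in> ball y0 e" using e by simp
  have pol: "(\<tau> y - \<tau> y0) \<bullet> (\<tau> y' - \<tau> y0) = (y - y0) \<bullet> (y' - y0)" if "y \<in> ball y0 e" "y' \<in> ball y0 e" for y y'
    using iso[OF that] iso[OF that(1) y0] iso[OF that(2) y0]
    unfolding dot_norm_neg[of "\<tau> y - \<tau> y0"] dot_norm_neg[of "y - y0"] by (simp add: dist_norm)
  define c where "c = e / 2"
  have c: "c > 0" "c < e" using e by (auto simp: c_def)
  have bi: "y0 + c *\<^sub>R i \<in> ball y0 e" if "i \<in> Basis" for i using that c by (simp add: dist_norm)
  define a where "a i = (1 / c) *\<^sub>R (\<tau> (y0 + c *\<^sub>R i) - \<tau> y0)" for i
  define A where "A v = (\<Sum>i\<in>Basis. (v \<bullet> i) *\<^sub>R a i)" for v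
  have aa: "a i \<bullet> a j = i \<bullet> j" if "i \<in> Basis" "j \<in> Basis" for i j
    using pol[OF bi[OF that(1)] bi[OF that(2)]] c unfolding a_def by simp
  have ya: "(\<tau> y - \<tau> y0) \<bullet> a j = (y - y0) \<bullet> j" if "j \<in> Basis" "y \<in> ball y0 e" for j y
    using pol[OF that(2) bi[OF that(1)]] c unfolding a_def by simp
  have Aa: "A v \<bullet> a j = v \<bullet> j" if "j \<in> Basis" for v j
  proof -
    have "A v \<bullet> a j = (\<Sum>i\<in>Basis. (v \<bullet> i) * (i \<bullet> j))"
      unfolding A_def inner_sum_left by (intro sum.cong refl) (simp add: aa that)
    then show ?thesis using that by (simp add: inner_Basis if_distrib cong: if_cong)
  qed
  have wA: "w \<bullet> A u = (\<Sum>i\<in>Basis. (u \<bullet> i) * (w \<bullet> a i))" for w u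
    unfolding A_def inner_sum_right by simp
  have lin: "linear A"
    unfolding A_def by (intro linearI) (auto simp: inner_left_distrib scaleR_left_distrib sum.distrib scaleR_sum_right)
  have nA: "norm (A v) = norm v" for v
  proof -
    have "A v \<bullet> A v = (\<Sum>i\<in>Basis. (v \<bullet> i) * (v \<bullet> i))"
      unfolding wA[of "A v"] by (intro sum.cong refl) (simp add: Aa)
    then show ?thesis unfolding norm_eq by (simp only: euclidean_inner[of v v])
  qed
  have A: "orthogonal_transformation A" using lin nA by (simp add: orthogonal_transformation)
  show ?thesis
  proof
    show "is_isometry (\<lambda>x. \<tau> y0 + A (x - y0))" by (rule is_isometry_affineI[OF A])
    fix y assume y: "y \<in> ball y0 e"
    define w where "w = \<tau> y - \<tau> y0 - A (y - y0)"
    have w: "w \<bullet> a j = 0" if "j \<in> Basis" for j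
      using ya[OF that y] Aa[OF that] by (simp add: w_def inner_diff_left)
    obtain u where "w = A u" using orthogonal_transformation_surj[OF A] by (metis surjD)
    then have "w \<bullet> w = 0" using wA[of w u] w by simp
    then have "w = 0" by simp
    then show "\<tau> y = \<tau> y0 + A (y - y0)" by (simp add: w_def algebra_simps)
  qed
qed

text \<open>Both maps are affine, and every direction can be scaled into the ball.\<close>

lemma isometry_eq_on_ball:
  fixes S T :: "'a::euclidean_space \<Rightarrow> 'a"
  assumes S: "is_isometry S" and T: "is_isometry T" and e: "e > 0" and eq: "\<And>y. y \<in> ball y0 e \<Longrightarrow> S y = T y"
  shows "S = T"
proof -
  obtain A where A: "orthogonal_transformation A" "\<And>x. S x = S 0 + A x" using isometry_affine[OF S] by blast
  obtain B where B: "orthogonal_transformation B" "\<And>x. T x = T 0 + B x" using isometry_affine[OF T] by blast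
  note lA = orthogonal_transformation_linear[OF A(1)] and lB = orthogonal_transformation_linear[OF B(1)]
  have AB: "A v = B v" for v
  proof -
    define t where "t = e / (2 * (norm v + 1))"
    have t: "t > 0" using e by (simp add: t_def add_nonneg_pos)
    have "t * norm v < e"
    proof -
      have "t * norm v \<le> t * (norm v + 1)" using t by (intro mult_left_mono) auto
      also have "\<dots> = e / 2"
        unfolding t_def using norm_ge_zero[of v] by (simp add: field_simps add_nonneg_eq_0_iff)
      also have "\<dots> < e" using e by simp
      finally show ?thesis .
    qed
    then have "y0 + t *\<^sub>R v \<in> ball y0 e" "y0 \<in> ball y0 e" using t e by (auto simp: dist_norm)
    from eq[OF this(1)] eq[OF this(2)]
    have "S 0 + A (y0 + t *\<^sub>R v) - (S 0 + A y0) = T 0 + B (y0 + t *\<^sub>R v) - (T 0 + B y0)"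
      by (simp only: A(2)[symmetric] B(2)[symmetric])
    then have "t *\<^sub>R A v = t *\<^sub>R B v"
      by (simp add: linear_add[OF lA] linear_add[OF lB] linear_cmul[OF lA] linear_cmul[OF lB])
    then show ?thesis using t by simp
  qed
  have "S y0 = T y0" using eq e by simp
  then have "S 0 = T 0" using A(2)[of y0] B(2)[of y0] AB by simp
  show ?thesis
  proof
    fix x show "S x = T x" using A(2)[of x] B(2)[of x] AB[of x] \<open>S 0 = T 0\<close> by simp
  qed
qed

text \<open>The isometry agreeing with \<open>\<tau>\<close> near a point is unique, so the pair of
  this isometry and the value of \<open>h\<close> is a locally constant function on a connected
  set.\<close>

lemma isometry_global_of_local:
  fixes \<tau> :: "'a::euclidean_space \<Rightarrow> 'a"
  assumes conn: "connected Y" and ne: "Y \<noteq> {}"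
    and loc: "\<And>y0. y0 \<in> Y \<Longrightarrow> \<exists>e>0. \<forall>y\<in>ball y0 e. h y = h y0 \<and> (\<forall>y'\<in>ball y0 e. dist (\<tau> y) (\<tau> y') = dist y y')"
  obtains T c where "is_isometry T" "\<And>y. y \<in> Y \<Longrightarrow> \<tau> y = T y" "\<And>y. y \<in> Y \<Longrightarrow> h y = c"
proof -
  define P where "P y0 T \<longleftrightarrow> is_isometry T \<and> (\<exists>e>0. \<forall>y\<in>ball y0 e. \<tau> y = T y)" for y0 T
  have ex: "\<exists>T. P y0 T" if y0: "y0 \<in> Y" for y0
  proof -
    obtain e where e: "e > 0" "\<And>y y'. y \<in> ball y0 e \<Longrightarrow> y' \<in> ball y0 e \<Longrightarrow> dist (\<tau> y) (\<tau> y') = dist y y'"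
      using loc[OF y0] by blast
    show ?thesis using isometry_extend_ball[OF e] e(1) unfolding P_def by metis
  qed
  have uniq: "S = T" if ST: "P y0 S" "P y0 T" for y0 S T
  proof -
    obtain e1 e2 where e: "e1 > 0" "\<forall>y\<in>ball y0 e1. \<tau> y = S y" "e2 > 0" "\<forall>y\<in>ball y0 e2. \<tau> y = T y"
      using ST unfolding P_def by blast
    show ?thesis
    proof (rule isometry_eq_on_ball[of S T "min e1 e2" y0])
      show "S y = T y" if "y \<in> ball y0 (min e1 e2)" for y
      proof -
        have "y \<in> ball y0 e1" "y \<in> ball y0 e2" using that by auto
        then show ?thesis using e(2,4) by metis
      qed
    qed (use e(1,3) ST in \<open>auto simp: P_def\<close>)
  qed
  define F where "F y0 = (SOME T. P y0 T)" for y0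
  have F: "P y0 (F y0)" if "y0 \<in> Y" for y0 unfolding F_def using ex[OF that] by (rule someI_ex)
  have P_open: "\<exists>e>0. \<forall>y\<in>ball y0 e. P y T" if PT: "P y0 T" for y0 T
  proof -
    obtain e where e: "e > 0" "\<forall>y\<in>ball y0 e. \<tau> y = T y" using PT unfolding P_def by blast
    have "P y T" if y: "y \<in> ball y0 e" for y
    proof -
      obtain d where "d > 0" "ball y d \<subseteq> ball y0 e" using y open_ball open_contains_ball by metis
      then show ?thesis using e(2) \<open>P y0 T\<close> unfolding P_def by blast
    qed
    then show ?thesis using e(1) by blast
  qed
  have const: "(F y, h y) = (F y', h y')" if "y \<in> Y" "y' \<in> Y" for y y'
  proof (rule connected_local_const[OF conn that, where f="\<lambda>y. (F y, h y)"], intro ballI)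
    fix y0 assume y0: "y0 \<in> Y"
    obtain e where e: "e > 0" "\<forall>y\<in>ball y0 e. P y (F y0)" using P_open[OF F[OF y0]] by blast
    obtain d where d: "d > 0" "\<forall>y\<in>ball y0 d. h y = h y0" using loc[OF y0] by blast
    have "(F y0, h y0) = (F y, h y)" if "y \<in> Y" "dist y y0 < min e d" for y
    proof -
      have "y \<in> ball y0 e" "y \<in> ball y0 d" using that by (auto simp: dist_commute)
      then show ?thesis using uniq[OF F[OF that(1)], of "F y0"] e(2) d(2) by auto
    qed
    then show "\<forall>\<^sub>F y in at y0 within Y. (F y0, h y0) = (F y, h y)"
      unfolding eventually_at using e(1) d(1) by (intro exI[of _ "min e d"]) auto
  qed
  obtain y0 where y0: "y0 \<in> Y" using ne by blast
  show ?thesis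
  proof
    show "is_isometry (F y0)" using F[OF y0] by (simp add: P_def)
    fix y assume y: "y \<in> Y"
    have "\<tau> y = F y y" using F[OF y] unfolding P_def by (metis centre_in_ball)
    then show "\<tau> y = F y0 y" "h y = h y0" using const[OF y y0] by auto
  qed
qed

lemma isometry_closure_vimage:
  fixes T :: "'a::euclidean_space \<Rightarrow> 'a"
  assumes T: "is_isometry T" shows "closure (T -` A) = T -` closure A"
proof -
  obtain S where S: "\<And>x. T (S x) = x" using isometry_inverse[OF T] by metis
  have d: "dist (T x) (T y) = dist x y" for x y using T by (simp add: is_isometry_def)
  show ?thesis
    unfolding closure_approachable set_eq_iff vimage_eq by (metis S d vimageI vimage_eq)
qed

lemma isometry_frontier_vimage:
  fixes T :: "'a::euclidean_space \<Rightarrow> 'a"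
  assumes T: "is_isometry T" and A: "open A" shows "frontier (T -` A) = T -` frontier A"
proof -
  have "open (T -` A)" using A isometry_continuous[OF T] by (simp add: open_vimage)
  then show ?thesis
    using A by (simp add: frontier_def isometry_closure_vimage[OF T] interior_open vimage_Diff)
qed

section \<open>Inner normals, exterior cones and flat boundary pieces\<close>

lemma boundary_locally_graphE:
  assumes "boundary_locally_graph R \<Omega>" "z \<in> frontier \<Omega>"
  obtains e V \<phi> where "norm e = 1" "open V" "z \<in> V" "R \<phi>"
    "\<And>x. x \<in> V \<Longrightarrow> x \<in> frontier \<Omega> \<longleftrightarrow> x \<bullet> e = \<phi> (x - (x \<bullet> e) *\<^sub>R e)"
    "\<And>x. x \<in> V \<Longrightarrow> x \<in> \<Omega> \<longleftrightarrow> x \<bullet> e > \<phi> (x - (x \<bullet> e) *\<^sub>R e)"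
proof -
  from bspec[OF assms(1)[unfolded boundary_locally_graph_def] assms(2)]
  show ?thesis
  proof (elim exE conjE)
    fix e V \<phi>
    assume "norm e = 1" "open V" "z \<in> V" "R \<phi>"
      "\<forall>x\<in>V. (x \<in> frontier \<Omega> \<longleftrightarrow> x \<bullet> e = \<phi> (x - (x \<bullet> e) *\<^sub>R e)) \<and>
        (x \<in> \<Omega> \<longleftrightarrow> x \<bullet> e > \<phi> (x - (x \<bullet> e) *\<^sub>R e))"
    then show ?thesis by (intro that[of e V \<phi>]) auto
  qed
qed

text \<open>Near \<open>z\<close> the set contains every open cone around \<open>n\<close> of
  half-angle below a right angle. This one-sided consequence of differentiability is preserved by
  isometries and can be compared between disjoint sets.\<close>

definition inner_normal :: "'a::euclidean_space set \<Rightarrow> 'a \<Rightarrow> 'a \<Rightarrow> bool"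
  where "inner_normal \<Omega> z n \<longleftrightarrow> norm n = 1 \<and>
    (\<forall>\<epsilon>>0. \<exists>r>0. \<forall>x. dist x z < r \<longrightarrow> (x - z) \<bullet> n > \<epsilon> * norm (x - z) \<longrightarrow> x \<in> \<Omega>)"

text \<open>The normal is the normalised gradient of the function \<open>\<psi>\<close>, height
  minus graph height, which is positive exactly on \<open>\<Omega>\<close> near \<open>z\<close>;
  the gradient is nonzero because the derivative in direction \<open>e\<close> is
  \<open>1\<close>.\<close>

lemma C1_boundary_inner_normal:
  assumes C1: "C1_boundary \<Omega>" and z: "z \<in> frontier \<Omega>"
  shows "\<exists>n. inner_normal \<Omega> z n"
proof -
  obtain e V \<phi> where e: "norm e = 1" and V: "open V" "z \<in> V" and \<phi>: "Ck 1 \<phi>"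
    and fr: "\<And>x. x \<in> V \<Longrightarrow> x \<in> frontier \<Omega> \<longleftrightarrow> x \<bullet> e = \<phi> (x - (x \<bullet> e) *\<^sub>R e)"
    and ins: "\<And>x. x \<in> V \<Longrightarrow> x \<in> \<Omega> \<longleftrightarrow> x \<bullet> e > \<phi> (x - (x \<bullet> e) *\<^sub>R e)"
    using boundary_locally_graphE[OF C1[unfolded C1_boundary_def] z] by metis
  let ?p = "\<lambda>x. x - (x \<bullet> e) *\<^sub>R e"
  obtain D where D: "(\<phi> has_derivative D) (at (?p z))"
    using \<phi> by (auto simp: differentiable_def)
  define \<psi> where "\<psi> x = x \<bullet> e - \<phi> (?p x)" for x
  define L where "L v = v \<bullet> e - D (?p v)" for v
  have p: "(?p has_derivative ?p) (at z)" by (auto intro!: derivative_eq_intros)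
  have "((\<lambda>x. \<phi> (?p x)) has_derivative (\<lambda>v. D (?p v))) (at z)"
    by (rule has_derivative_compose[OF p D])
  then have L: "(\<psi> has_derivative L) (at z)"
    unfolding \<psi>_def[abs_def] L_def[abs_def] by (auto intro!: derivative_eq_intros)
  then have linL: "linear L" by (rule has_derivative_linear)
  define m where "m = (\<Sum>i\<in>Basis. L i *\<^sub>R i)"
  have Lm: "L v = v \<bullet> m" for v
  proof -
    have "L v = L (\<Sum>i\<in>Basis. (v \<bullet> i) *\<^sub>R i)" by (simp add: euclidean_representation)
    then show ?thesis by (simp add: linear_sum[OF linL] linear_cmul[OF linL] m_def inner_sum_right mult.commute)
  qed
  have "D 0 = 0" using linear_0[OF has_derivative_linear[OF D]] .
  then have "L e = 1" using e by (simp add: L_def norm_eq_1)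
  then have m0: "norm m > 0" using Lm[of e] by auto
  have \<psi>z: "\<psi> z = 0" using fr[OF V(2)] z by (simp add: \<psi>_def)
  show ?thesis
  proof (intro exI[of _ "m /\<^sub>R norm m"], unfold inner_normal_def, intro conjI allI impI)
    show "norm (m /\<^sub>R norm m) = 1" using m0 by simp
    fix \<epsilon> :: real assume \<epsilon>: "\<epsilon> > 0"
    obtain d where d: "d > 0" "\<And>x. norm (x - z) < d \<Longrightarrow> norm (\<psi> x - \<psi> z - L (x - z)) \<le> (\<epsilon> * norm m) * norm (x - z)"
      using L \<epsilon> m0 unfolding has_derivative_at_alt by (metis mult_pos_pos)
    obtain d' where d': "d' > 0" "ball z d' \<subseteq> V" using V open_contains_ball by metis
    have "x \<in> \<Omega>" if x: "dist x z < min d d'" "(x - z) \<bullet> (m /\<^sub>R norm m) > \<epsilon> * norm (x - z)" for x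
    proof -
      have xV: "x \<in> V" using x(1) d'(2) by (auto simp: dist_commute)
      have "\<epsilon> * norm m * norm (x - z) < L (x - z)"
        using x(2) m0 by (simp add: Lm field_simps)
      moreover have "\<bar>\<psi> x - L (x - z)\<bar> \<le> \<epsilon> * norm m * norm (x - z)"
        using d(2)[of x] x(1) \<psi>z by (simp add: dist_norm)
      ultimately have "\<psi> x > 0" by linarith
      then show ?thesis using ins[OF xV] by (simp add: \<psi>_def)
    qed
    then show "\<exists>r>0. \<forall>x. dist x z < r \<longrightarrow> (x - z) \<bullet> (m /\<^sub>R norm m) > \<epsilon> * norm (x - z) \<longrightarrow> x \<in> \<Omega>"
      using d(1) d'(1) by (intro exI[of _ "min d d'"]) auto
  qed
qed

lemma inner_normal_vimage:
  fixes T :: "'a::euclidean_space \<Rightarrow> 'a"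
  assumes T: "is_isometry T" and n: "inner_normal \<Omega> (T z) n"
  shows "\<exists>n'. inner_normal (T -` \<Omega>) z n'"
proof -
  obtain A where A: "orthogonal_transformation A" "\<And>x. T x = T 0 + A x" using isometry_affine[OF T] by blast
  obtain m where m: "n = A m" using orthogonal_transformation_surj[OF A(1)] by (metis surjD)
  have Td: "T x - T z = A (x - z)" for x
    using A(2)[of x] A(2)[of z] by (simp add: linear_diff[OF orthogonal_transformation_linear[OF A(1)]])
  have d: "dist (T x) (T z) = dist x z" "norm (T x - T z) = norm (x - z)" for x
    using T by (auto simp: is_isometry_def dist_norm)
  have i: "(T x - T z) \<bullet> n = (x - z) \<bullet> m" for x
    using A(1) by (simp add: Td m orthogonal_transformation_def)
  have "inner_normal (T -` \<Omega>) z m"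
    unfolding inner_normal_def
  proof (intro conjI allI impI)
    show "norm m = 1" using n orthogonal_transformation_norm[OF A(1), of m] by (simp add: inner_normal_def m)
    fix \<epsilon> :: real assume "\<epsilon> > 0"
    then obtain r where "r > 0" "\<And>x. dist x (T z) < r \<Longrightarrow> (x - T z) \<bullet> n > \<epsilon> * norm (x - T z) \<Longrightarrow> x \<in> \<Omega>"
      using n unfolding inner_normal_def by blast
    then show "\<exists>r>0. \<forall>x. dist x z < r \<longrightarrow> \<epsilon> * norm (x - z) < (x - z) \<bullet> m \<longrightarrow> x \<in> T -` \<Omega>"
      using d i by (metis vimageI)
  qed
  then show ?thesis by blast
qed

lemma inner_normal_ray:
  assumes n: "inner_normal \<Omega> z n" and v: "v \<bullet> n > 0"
  obtains s where "s > 0" "\<And>t. 0 < t \<Longrightarrow> t < s \<Longrightarrow> z + t *\<^sub>R v \<in> \<Omega>"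
proof -
  have v0: "norm v > 0" using v by auto
  define \<epsilon> where "\<epsilon> = (v \<bullet> n) / (2 * norm v)"
  have "\<epsilon> > 0" using v v0 by (simp add: \<epsilon>_def)
  then obtain r where r: "r > 0" "\<And>x. dist x z < r \<Longrightarrow> (x - z) \<bullet> n > \<epsilon> * norm (x - z) \<Longrightarrow> x \<in> \<Omega>"
    using n unfolding inner_normal_def by blast
  show ?thesis
  proof
    show "r / norm v > 0" using r v0 by simp
    fix t assume t: "0 < t" "t < r / norm v"
    show "z + t *\<^sub>R v \<in> \<Omega>"
    proof (rule r(2))
      show "dist (z + t *\<^sub>R v) z < r" using t v0 by (simp add: dist_norm field_simps)
      have "\<epsilon> * norm (t *\<^sub>R v) = t * (v \<bullet> n) / 2" using v0 t by (simp add: \<epsilon>_def)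
      also have "\<dots> < t * (v \<bullet> n)" using t v by simp
      finally show "\<epsilon> * norm (z + t *\<^sub>R v - z) < (z + t *\<^sub>R v - z) \<bullet> n" by simp
    qed
  qed
qed

text \<open>Otherwise \<open>n + m\<close> forms acute angles with both normals, and a short segment
  from \<open>z\<close> in this direction lies in both sets.\<close>

lemma inner_normals_opposite:
  assumes n: "inner_normal A z n" and m: "inner_normal B z m" and disj: "A \<inter> B = {}"
  shows "m = - n"
proof (rule ccontr)
  assume ne: "m \<noteq> - n"
  have nm: "norm n = 1" "norm m = 1" using n m by (auto simp: inner_normal_def)
  have "(n + m) \<bullet> (n + m) > 0" using ne by (auto simp: inner_gt_zero_iff add_eq_0_iff)
  then have "n \<bullet> m > - 1" using nm by (simp add: norm_eq_1 inner_add_left inner_add_right inner_commute)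
  then have "(n + m) \<bullet> n > 0" "(n + m) \<bullet> m > 0" using nm by (auto simp: norm_eq_1 inner_add_left inner_commute[of m n])
  then obtain s t where s: "s > 0" "\<And>u. 0 < u \<Longrightarrow> u < s \<Longrightarrow> z + u *\<^sub>R (n + m) \<in> A"
    and t: "t > 0" "\<And>u. 0 < u \<Longrightarrow> u < t \<Longrightarrow> z + u *\<^sub>R (n + m) \<in> B"
    using inner_normal_ray[OF n] inner_normal_ray[OF m] by metis
  have "0 < min s t / 2" "min s t / 2 < s" "min s t / 2 < t" using s(1) t(1) by auto
  then show False using s(2) t(2) disj by blast
qed

text \<open>Moving from \<open>z\<close> along \<open>- e\<close> keeps the projection and passes
  below the graph. This is how slits are excluded: the set cannot lie on both sides of its
  boundary.\<close>

lemma graph_boundary_exterior: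
  assumes gr: "boundary_locally_graph R \<Omega>" and z: "z \<in> frontier \<Omega>" and N: "open N" "z \<in> N"
  shows "\<exists>x\<in>N. x \<notin> closure \<Omega>"
proof -
  obtain e V \<phi> where e: "norm e = 1" and V: "open V" "z \<in> V"
    and fr: "\<And>x. x \<in> V \<Longrightarrow> x \<in> frontier \<Omega> \<longleftrightarrow> x \<bullet> e = \<phi> (x - (x \<bullet> e) *\<^sub>R e)"
    and ins: "\<And>x. x \<in> V \<Longrightarrow> x \<in> \<Omega> \<longleftrightarrow> x \<bullet> e > \<phi> (x - (x \<bullet> e) *\<^sub>R e)"
    using boundary_locally_graphE[OF gr z] by metis
  obtain d where d: "d > 0" "ball z d \<subseteq> V \<inter> N" using V N open_contains_ball by (metis IntI open_Int)
  let ?x = "z - (d / 2) *\<^sub>R e"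
  have x: "?x \<in> V \<inter> N" using d e by (intro subsetD[OF d(2)]) (simp add: dist_norm)
  have ee: "e \<bullet> e = 1" using e by (simp add: norm_eq_1)
  have p: "?x - (?x \<bullet> e) *\<^sub>R e = z - (z \<bullet> e) *\<^sub>R e" using ee by (simp add: inner_diff_left algebra_simps)
  have "?x \<bullet> e < \<phi> (?x - (?x \<bullet> e) *\<^sub>R e)"
    unfolding p using fr[OF V(2)] z d(1) ee by (simp add: inner_diff_left)
  then have "?x \<notin> \<Omega> \<union> frontier \<Omega>" using fr[of ?x] ins[of ?x] x by auto
  then have "?x \<notin> closure \<Omega>" by (simp add: closure_Un_frontier)
  then show ?thesis using x by blast
qed

lemma lipschitz_boundary_exterior_cone:
  fixes \<Omega> :: "'a::euclidean_space set"
  assumes lip: "lipschitz_boundary \<Omega>" and z: "z \<in> frontier \<Omega>"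
  obtains e :: 'a and \<eta> r where "norm e = 1" "\<eta> > 0" "r > 0"
    "\<And>(w::'a) t. norm w < \<eta> \<Longrightarrow> 0 < t \<Longrightarrow> t < r \<Longrightarrow> z + t *\<^sub>R (w - e) \<notin> \<Omega>"
proof -
  obtain e V \<phi> L where e: "norm e = 1" and V: "open V" "z \<in> V" and L: "L-lipschitz_on UNIV \<phi>"
    and fr: "\<And>x. x \<in> V \<Longrightarrow> x \<in> frontier \<Omega> \<longleftrightarrow> x \<bullet> e = \<phi> (x - (x \<bullet> e) *\<^sub>R e)"
    and ins: "\<And>x. x \<in> V \<Longrightarrow> x \<in> \<Omega> \<longleftrightarrow> x \<bullet> e > \<phi> (x - (x \<bullet> e) *\<^sub>R e)"
    using boundary_locally_graphE[OF lip[unfolded lipschitz_boundary_def] z] by metis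
  obtain d where d: "d > 0" "ball z d \<subseteq> V" using V open_contains_ball by metis
  have L0: "L \<ge> 0" using L by (rule lipschitz_on_nonneg)
  have ee: "e \<bullet> e = 1" using e by (simp add: norm_eq_1)
  show ?thesis
  proof
    show "norm e = 1" by (rule e)
    \<comment> \<open>Along \<open>w - e\<close> the height falls by
      \<open>t * (1 - w \<bullet> e)\<close>, while \<open>\<phi>\<close> changes by at most
      \<open>L * (t * (2 * norm w))\<close>; the bound on \<open>norm w\<close> makes the fall at
      least as large as the change.\<close>
    show "1 / (2 + 2 * L) > 0" using L0 by simp
    show "d / 2 > 0" using d by simp
    fix w :: 'a and t assume w: "norm w < 1 / (2 + 2 * L)" and t: "0 < t" "t < d / 2"
    let ?x = "z + t *\<^sub>R (w - e)"
    have w1: "norm w < 1" using w L0 by (smt (verit) divide_le_eq_1)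
    have "norm (w - e) \<le> norm w + norm e" by (rule norm_triangle_ineq4)
    then have "norm (w - e) \<le> 2" using w1 e by simp
    then have "t * norm (w - e) \<le> t * 2" using t by (intro mult_left_mono) auto
    then have "t * norm (w - e) < d" using t by linarith
    then have xV: "?x \<in> V" using t(1) by (intro subsetD[OF d(2)]) (simp add: dist_norm)
    have we: "\<bar>w \<bullet> e\<bar> \<le> norm w" using Cauchy_Schwarz_ineq2[of w e] e by simp
    have "?x - (?x \<bullet> e) *\<^sub>R e - (z - (z \<bullet> e) *\<^sub>R e) = t *\<^sub>R (w - (w \<bullet> e) *\<^sub>R e)"
      using ee by (simp add: inner_add_left inner_diff_left algebra_simps)
    moreover have "norm (w - (w \<bullet> e) *\<^sub>R e) \<le> 2 * norm w"
      using norm_triangle_ineq4[of w "(w \<bullet> e) *\<^sub>R e"] we e by simp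
    ultimately have "dist (?x - (?x \<bullet> e) *\<^sub>R e) (z - (z \<bullet> e) *\<^sub>R e) \<le> t * (2 * norm w)"
      using t unfolding dist_norm by (simp add: mult_left_mono)
    then have "L * dist (?x - (?x \<bullet> e) *\<^sub>R e) (z - (z \<bullet> e) *\<^sub>R e) \<le> L * (t * (2 * norm w))"
      using L0 by (rule mult_left_mono)
    then have "\<bar>\<phi> (?x - (?x \<bullet> e) *\<^sub>R e) - \<phi> (z - (z \<bullet> e) *\<^sub>R e)\<bar> \<le> L * (t * (2 * norm w))"
      using lipschitz_onD[OF L, of "?x - (?x \<bullet> e) *\<^sub>R e" "z - (z \<bullet> e) *\<^sub>R e"] by (simp add: dist_real_def)
    moreover have "\<phi> (z - (z \<bullet> e) *\<^sub>R e) = z \<bullet> e" using fr[OF V(2)] z by simp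
    moreover have "?x \<bullet> e = z \<bullet> e - t * (1 - w \<bullet> e)"
      using ee by (simp add: inner_add_left inner_diff_left algebra_simps)
    moreover have "L * (t * (2 * norm w)) \<le> t * (1 - w \<bullet> e)"
    proof -
      have "norm w * (2 + 2 * L) < 1" using w L0 by (simp add: field_simps)
      then have "2 * L * norm w \<le> 1 - w \<bullet> e" using we norm_ge_zero[of w] by (simp add: algebra_simps)
      then have "t * (2 * L * norm w) \<le> t * (1 - w \<bullet> e)" using t by (intro mult_left_mono) auto
      then show ?thesis by (simp add: mult_ac)
    qed
    ultimately have "?x \<bullet> e \<le> \<phi> (?x - (?x \<bullet> e) *\<^sub>R e)" by linarith
    then show "?x \<notin> \<Omega>" using ins[OF xV] by linarith
  qed
qed

text \<open>
  Near a point of \<open>S\<close> extremal in a direction \<open>v\<close> of the hyperplane, the boundary graph would leave \<open>S\<close>.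
\<close>

lemma no_flat_compact_boundary_piece:
  fixes \<Omega> :: "'a::euclidean_space set"
  assumes dim: "DIM('a) \<ge> 2" and C1: "C1_boundary \<Omega>" and S: "compact S" "S \<noteq> {}" "S \<subseteq> frontier \<Omega>"
    and a: "a \<noteq> 0" "\<And>x. x \<in> S \<Longrightarrow> a \<bullet> x = b"
    and rel_open: "\<And>z. z \<in> S \<Longrightarrow> \<exists>N. open N \<and> z \<in> N \<and> frontier \<Omega> \<inter> N \<subseteq> S"
  shows False
proof -
  \<comment> \<open>A direction inside the hyperplane; it exists because the dimension is at least
    \<open>2\<close>.\<close>
  obtain v where v: "v \<noteq> 0" "a \<bullet> v = 0"
    using orthogonal_to_vector_exists[OF dim, of a] by (auto simp: orthogonal_def)
  obtain z where z: "z \<in> S" "\<And>x. x \<in> S \<Longrightarrow> v \<bullet> x \<le> v \<bullet> z"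
    using continuous_attains_sup[OF S(1,2), of "\<lambda>x. v \<bullet> x"] continuous_on_inner[OF continuous_on_const continuous_on_id] by blast
  obtain N where N: "open N" "z \<in> N" "frontier \<Omega> \<inter> N \<subseteq> S" using rel_open[OF z(1)] by blast
  obtain e V \<phi> where e: "norm e = 1" and V: "open V" "z \<in> V" and \<phi>: "Ck 1 \<phi>"
    and fr: "\<And>x. x \<in> V \<Longrightarrow> x \<in> frontier \<Omega> \<longleftrightarrow> x \<bullet> e = \<phi> (x - (x \<bullet> e) *\<^sub>R e)"
    using boundary_locally_graphE[OF C1[unfolded C1_boundary_def] subsetD[OF S(3) z(1)]] by metis
  have ee: "e \<bullet> e = 1" using e by (simp add: norm_eq_1)
  define z' where "z' = z - (z \<bullet> e) *\<^sub>R e"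
  have z'e: "z' \<bullet> e = 0" using ee by (simp add: z'_def inner_diff_left)
  have \<phi>z: "\<phi> z' = z \<bullet> e" using fr[OF V(2)] z(1) S(3) by (auto simp: z'_def)
  \<comment> \<open>\<open>q\<close> parametrises the boundary graph around \<open>z\<close> by
    small displacements \<open>u\<close> orthogonal to \<open>e\<close>.\<close>
  define q where "q u = z' + u + \<phi> (z' + u) *\<^sub>R e" for u
  have cq: "isCont q 0"
  proof -
    have "continuous_on UNIV \<phi>" using Ck_continuous[OF \<phi>] .
    then have "continuous_on UNIV (\<lambda>u. \<phi> (z' + u))"
      by (rule continuous_on_compose2) (auto intro: continuous_intros)
    then have "continuous_on UNIV q" unfolding q_def[abs_def]
      by (intro continuous_intros)
    then show ?thesis by (simp add: continuous_on_eq_continuous_at)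
  qed
  have q0: "q 0 = z" by (simp add: q_def \<phi>z) (simp add: z'_def)
  have "open (V \<inter> N)" "q 0 \<in> V \<inter> N" using V N q0 by auto
  then obtain d where d: "d > 0" "\<And>u. norm u < d \<Longrightarrow> q u \<in> V \<inter> N"
    using cq unfolding continuous_at_open eventually_nhds_metric
    by (metis (no_types, lifting) dist_0_norm dist_commute open_contains_ball mem_ball subsetD)
  have plane: "a \<bullet> (z' + u) + \<phi> (z' + u) * (a \<bullet> e) = b" and qS: "q u \<in> S" if u: "norm u < d" "u \<bullet> e = 0" for u
  proof -
    have "q u \<bullet> e = \<phi> (z' + u)" using z'e u(2) ee by (simp add: q_def inner_add_left)
    moreover then have "q u - (q u \<bullet> e) *\<^sub>R e = z' + u" by (simp add: q_def)
    ultimately have "q u \<in> frontier \<Omega>" using fr[of "q u"] d(2)[OF u(1)] by simp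
    then show "q u \<in> S" using N(3) d(2)[OF u(1)] by blast
    from a(2)[OF this] show "a \<bullet> (z' + u) + \<phi> (z' + u) * (a \<bullet> e) = b" by (simp add: q_def inner_add_right)
  qed
  have small: "\<exists>s>0. norm (s *\<^sub>R u) < d" for u :: 'a
  proof (intro exI conjI)
    show pos: "d / (2 * (norm u + 1)) > 0" using d by (simp add: add_nonneg_pos)
    have "norm ((d / (2 * (norm u + 1))) *\<^sub>R u) = d / (2 * (norm u + 1)) * norm u" using pos d(1) by simp
    also have "\<dots> \<le> d / (2 * (norm u + 1)) * (norm u + 1)" using pos by (intro mult_left_mono) auto
    also have "\<dots> = d / 2" using norm_ge_zero[of u] by (simp add: field_simps add_nonneg_eq_0_iff)
    also have "\<dots> < d" using d by simp
    finally show "norm ((d / (2 * (norm u + 1))) *\<^sub>R u) < d" .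
  qed
  show False
  proof (cases "a \<bullet> e = 0")
    case True
    \<comment> \<open>Here \<open>a\<close> itself is an admissible displacement, and moving along
      it leaves the hyperplane.\<close>
    obtain s where s: "s > 0" "norm (s *\<^sub>R a) < d" using small by blast
    have "a \<bullet> (s *\<^sub>R a) = 0"
      using plane[OF s(2)] plane[of 0] True d(1) by (simp add: inner_add_right)
    then show False using s(1) a(1) by simp
  next
    case False
    \<comment> \<open>Over the displacement \<open>s *\<^sub>R w\<close> the hyperplane equation
      forces the graph point \<open>z + s *\<^sub>R v\<close>, which exceeds the maximum attained at
      \<open>z\<close>.\<close>
    define w where "w = v - (v \<bullet> e) *\<^sub>R e"
    have we: "w \<bullet> e = 0" using ee by (simp add: w_def inner_diff_left)
    have aw: "a \<bullet> w = - (v \<bullet> e) * (a \<bullet> e)" using v(2) by (simp add: w_def inner_diff_right)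
    obtain s where s: "s > 0" "norm (s *\<^sub>R w) < d" using small by blast
    have su: "(s *\<^sub>R w) \<bullet> e = 0" using we by simp
    have "\<phi> (z' + s *\<^sub>R w) * (a \<bullet> e) = (\<phi> z' + s * (v \<bullet> e)) * (a \<bullet> e)"
      using plane[OF s(2) su] plane[of 0] d(1) by (simp add: inner_add_right aw algebra_simps)
    then have "\<phi> (z' + s *\<^sub>R w) = \<phi> z' + s * (v \<bullet> e)" using False by simp
    then have "q (s *\<^sub>R w) = z + s *\<^sub>R v"
      by (simp add: q_def \<phi>z w_def) (simp add: z'_def algebra_simps)
    then have "v \<bullet> (z + s *\<^sub>R v) \<le> v \<bullet> z" using z(2) qS[OF s(2) su] by simp
    then have "s * (v \<bullet> v) \<le> 0" by (simp add: inner_add_right)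
    moreover have "s * (v \<bullet> v) > 0" using s(1) v(1) by (intro mult_pos_pos) (simp_all add: inner_gt_zero_iff)
    ultimately show False by linarith
  qed
qed

subsection \<open>Dense unions of isometric copies\<close>

lemma closure_Union_finite: "finite F \<Longrightarrow> closure (\<Union>F) = (\<Union>E\<in>F. closure E)"
  by (induction F rule: finite_induct) auto

text \<open>Distinct components are disjoint, so the centres of their balls are at least
  \<open>\<rho>\<close> apart, and a bounded set holds only finitely many such points.\<close>

lemma components_finite_of_common_ball:
  fixes Y :: "'a::euclidean_space set"
  assumes Y: "open Y" "bounded Y" and \<rho>: "\<rho> > 0"
    and ball: "\<And>E. E \<in> components Y \<Longrightarrow> \<exists>x. ball x \<rho> \<subseteq> E"
  shows "finite (components Y)"
proof -
  obtain c where c: "\<And>E. E \<in> components Y \<Longrightarrow> ball (c E) \<rho> \<subseteq> E" using ball by metis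
  have sep: "E = E'" if "E \<in> components Y" "E' \<in> components Y" "dist (c E) (c E') < \<rho>" for E E'
  proof -
    have "c E' \<in> E" using c[OF that(1)] that(3) by auto
    moreover have "c E' \<in> E'" using c[OF that(2)] \<rho> by auto
    ultimately show ?thesis using components_eq[OF that(1,2)] by blast
  qed
  have "uniform_discrete (c ` components Y)"
    unfolding uniform_discrete_def
    using \<rho> sep by (intro exI[of _ \<rho>]) (metis (no_types, lifting) imageE)
  moreover have "c ` components Y \<subseteq> Y"
    using c \<rho> in_components_subset by (metis centre_in_ball image_subsetI subsetD)
  then have "bounded (c ` components Y)" using Y(2) bounded_subset by blast
  ultimately have "finite (c ` components Y)" using uniform_discrete_finite_iff by blast
  moreover have "inj_on c (components Y)" using sep \<rho> by (intro inj_onI) simp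
  ultimately show ?thesis by (rule finite_imageD)
qed

text \<open>
  If two copies \<open>E1\<close>, \<open>E2\<close> touch, their inner normals are opposite there, so no third copy touches and, by the
  exterior cone of \<open>\<Omega>\<^sub>2\<close>, the common boundary piece lies in \<open>\<Omega>\<^sub>2\<close>. This piece is then relatively open in the boundary of
  \<open>E1\<close>, while \<open>T E1\<close> and \<open>T E2\<close> agree on it, so that it is contained in a hyperplane.
\<close>

lemma dense_isometric_copies_single:
  fixes \<Omega>\<^sub>1 \<Omega>\<^sub>2 Y :: "'a::euclidean_space set"
  assumes dim: "DIM('a) \<ge> 2"
    and o1: "open \<Omega>\<^sub>1" "\<Omega>\<^sub>1 \<noteq> {}" and C1: "C1_boundary \<Omega>\<^sub>1"
    and o2: "open \<Omega>\<^sub>2" "bounded \<Omega>\<^sub>2" "connected \<Omega>\<^sub>2" and lip: "lipschitz_boundary \<Omega>\<^sub>2"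
    and Y: "open Y" "Y \<subseteq> \<Omega>\<^sub>2" "\<Omega>\<^sub>2 \<subseteq> closure Y"
    and T: "\<And>E. E \<in> components Y \<Longrightarrow> is_isometry (T E) \<and> E = T E -` \<Omega>\<^sub>1"
    and agree: "\<And>E E' z. E \<in> components Y \<Longrightarrow> E' \<in> components Y \<Longrightarrow> z \<in> closure E \<Longrightarrow> z \<in> closure E' \<Longrightarrow> T E z = T E' z"
    and E1: "E1 \<in> components Y"
  shows "E1 = \<Omega>\<^sub>2"
proof (rule ccontr)
  assume ne: "E1 \<noteq> \<Omega>\<^sub>2"
  have iso: "is_isometry (T E)" and Eq: "E = T E -` \<Omega>\<^sub>1" if "E \<in> components Y" for E using T[OF that] by auto
  have oE: "open E" if "E \<in> components Y" for E using open_components[OF Y(1) that] .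
  have sub: "E \<subseteq> \<Omega>\<^sub>2" if "E \<in> components Y" for E using in_components_subset[OF that] Y(2) by blast
  have dis: "E \<inter> E' = {}" if "E \<in> components Y" "E' \<in> components Y" "E \<noteq> E'" for E E'
    using components_nonoverlap[OF that(1,2)] that(3) by blast
  have frE: "T E z \<in> frontier \<Omega>\<^sub>1 \<longleftrightarrow> z \<in> frontier E" if "E \<in> components Y" for E z
    using isometry_frontier_vimage[OF iso[OF that] o1(1)] Eq[OF that] by (metis vimage_eq)
  have normal: "\<exists>n. inner_normal E z n" if E: "E \<in> components Y" and z: "z \<in> frontier E" for E z
    using C1_boundary_inner_normal[OF C1, of "T E z"] frE[OF E] z inner_normal_vimage[OF iso[OF E]] Eq[OF E] by metis
  have exterior: "\<exists>x\<in>N. x \<notin> closure E" if E: "E \<in> components Y" and z: "z \<in> frontier E" and N: "open N" "z \<in> N" for E z N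
  proof -
    obtain S where S: "is_isometry S" "\<And>x. T E (S x) = x" "\<And>x. S (T E x) = x" using isometry_inverse[OF iso[OF E]] by metis
    have "open (S -` N)" using N(1) isometry_continuous[OF S(1)] by (simp add: open_vimage)
    moreover have "T E z \<in> S -` N" using N(2) S(3) by simp
    ultimately obtain x where x: "S x \<in> N" "x \<notin> closure \<Omega>\<^sub>1"
      using graph_boundary_exterior[OF C1[unfolded C1_boundary_def], of "T E z"] frE[OF E] z by blast
    have "S x \<notin> closure E"
      using x(2) S(2) isometry_closure_vimage[OF iso[OF E], of \<Omega>\<^sub>1] Eq[OF E] by (metis vimage_eq)
    then show ?thesis using x(1) by blast
  qed
  obtain p \<rho> where p: "\<rho> > 0" "ball p \<rho> \<subseteq> \<Omega>\<^sub>1" using o1 open_contains_ball by (metis ex_in_conv)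
  have fin: "finite (components Y)"
  proof (rule components_finite_of_common_ball[OF Y(1) _ p(1)])
    show "bounded Y" using o2(2) Y(2) bounded_subset by blast
    fix E assume E: "E \<in> components Y"
    obtain S where S: "\<And>x. T E (S x) = x" using isometry_inverse[OF iso[OF E]] by metis
    have "ball (S p) \<rho> \<subseteq> T E -` ball p \<rho>"
      using iso[OF E] S by (auto simp: is_isometry_def) (metis S)
    then show "\<exists>x. ball x \<rho> \<subseteq> E" using p(2) Eq[OF E] by blast
  qed
  have clY: "closure Y = (\<Union>E\<in>components Y. closure E)"
    using closure_Union_finite[OF fin] Union_components[of Y] by simp
  \<comment> \<open>\<open>\<Omega>\<^sub>2\<close> is connected and meets both \<open>E1\<close>
    and its complement, so the boundary of \<open>E1\<close> enters
    \<open>\<Omega>\<^sub>2\<close>.\<close>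
  obtain z0 where z0: "z0 \<in> \<Omega>\<^sub>2" "z0 \<in> frontier E1"
    using connected_Int_frontier[OF o2(3), of E1] sub[OF E1] in_components_nonempty[OF E1] ne by blast
  \<comment> \<open>Arbitrarily near \<open>z0\<close> there are points outside the closure of
    \<open>E1\<close>, which other components approximate; by finiteness the closure of one of these
    contains \<open>z0\<close>.\<close>
  have "z0 \<in> (\<Union>E\<in>components Y - {E1}. closure E)"
  proof -
    have "z0 \<in> closure (\<Union>(components Y - {E1}))"
      unfolding closure_approachable
    proof (intro allI impI)
      fix e :: real assume e: "e > 0"
      obtain x where x: "x \<in> ball z0 e \<inter> \<Omega>\<^sub>2" "x \<notin> closure E1"
        using exterior[OF E1 z0(2) open_Int[OF open_ball o2(1)], of z0 e] e z0(1) by auto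
      have "x \<in> closure Y" using x(1) Y(3) by blast
      moreover have "open (ball z0 e \<inter> - closure E1)" by (intro open_Int) auto
      ultimately obtain y where y: "y \<in> Y" "y \<in> ball z0 e" "y \<notin> closure E1"
        using x open_Int_closure_eq_empty[of "ball z0 e \<inter> - closure E1" Y] by blast
      then obtain E where "E \<in> components Y" "y \<in> E" using Union_components[of Y] by blast
      moreover then have "E \<noteq> E1" using y(3) closure_subset by blast
      ultimately show "\<exists>y\<in>\<Union>(components Y - {E1}). dist y z0 < e"
        using y(2) by (auto simp: dist_commute)
    qed
    then show ?thesis using closure_Union_finite[of "components Y - {E1}"] fin by simp
  qed
  then obtain E2 where E2: "E2 \<in> components Y" "E2 \<noteq> E1" "z0 \<in> closure E2" by blast
  have frI: "z \<in> frontier E" if "E \<in> components Y" "E' \<in> components Y" "E \<noteq> E'" "z \<in> closure E" "z \<in> closure E'" for z E E'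
  proof -
    have "z \<notin> E" using dis[OF that(1-3)] oE[OF that(1)] that(5) open_Int_closure_eq_empty[of E E'] by blast
    then show ?thesis using that(4) oE[OF that(1)] by (simp add: frontier_def interior_open)
  qed
  define S where "S = closure E1 \<inter> closure E2"
  have z0S: "z0 \<in> S" using z0(2) E2(3) by (simp add: S_def frontier_def)
  have Sfr1: "z \<in> frontier E1" and Sfr2: "z \<in> frontier E2" if "z \<in> S" for z
    using that frI[OF E1 E2(1) E2(2)[symmetric]] frI[OF E2(1) E1 E2(2)] by (auto simp: S_def)
  have bE1: "bounded E1" using sub[OF E1] o2(2) bounded_subset by blast
  have cS: "compact S" unfolding S_def using bE1 by (intro compact_Int_closed) (auto simp: compact_closure)
  have only2: "E3 = E1 \<or> E3 = E2" if z: "z \<in> S" and E3: "E3 \<in> components Y" and z3: "z \<in> closure E3" for z E3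
  proof (rule ccontr)
    assume "\<not> ?thesis"
    then have n3: "E3 \<noteq> E1" "E3 \<noteq> E2" by auto
    obtain m1 m2 m3 where m: "inner_normal E1 z m1" "inner_normal E2 z m2" "inner_normal E3 z m3"
      using normal[OF E1 Sfr1[OF z]] normal[OF E2(1) Sfr2[OF z]]
        normal[OF E3 frI[OF E3 E1 n3(1) z3]] z by (auto simp: S_def)
    \<comment> \<open>Three unit vectors cannot be pairwise opposite.\<close>
    have "m2 = - m1" "m3 = - m1" "m3 = - m2"
      using inner_normals_opposite[OF m(1,2) dis[OF E1 E2(1) E2(2)[symmetric]]]
        inner_normals_opposite[OF m(1,3) dis[OF E1 E3 n3(1)[symmetric]]]
        inner_normals_opposite[OF m(2,3) dis[OF E2(1) E3 n3(2)[symmetric]]] by auto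
    then have "m1 = 0" by (metis add.inverse_inverse eq_neg_iff_add_eq_0 neg_equal_0_iff_equal real_vector_eq_affinity scaleR_half_double)
    then show False using m(1) by (simp add: inner_normal_def)
  qed
  have S_in: "z \<in> \<Omega>\<^sub>2" if z: "z \<in> S" for z
  proof (rule ccontr)
    assume "z \<notin> \<Omega>\<^sub>2"
    moreover have "z \<in> closure \<Omega>\<^sub>2" using z sub[OF E1] closure_mono unfolding S_def by blast
    ultimately have zf: "z \<in> frontier \<Omega>\<^sub>2" using o2(1) by (simp add: frontier_def interior_open)
    obtain e \<eta> r where cone: "norm e = 1" "\<eta> > 0" "r > 0"
      "\<And>w t. norm w < \<eta> \<Longrightarrow> 0 < t \<Longrightarrow> t < r \<Longrightarrow> z + t *\<^sub>R (w - e) \<notin> \<Omega>\<^sub>2"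
      using lipschitz_boundary_exterior_cone[OF lip zf] by metis
    obtain m1 m2 where m: "inner_normal E1 z m1" "inner_normal E2 z m2"
      using normal[OF E1 Sfr1[OF z]] normal[OF E2(1) Sfr2[OF z]] by blast
    have m21: "m2 = - m1" using inner_normals_opposite[OF m dis[OF E1 E2(1) E2(2)[symmetric]]] .
    have n1: "m1 \<bullet> m1 = 1" "norm m1 = 1" using m(1) by (auto simp: inner_normal_def norm_eq_1)
    \<comment> \<open>If the cone axis is tangent to the common boundary, it is tilted slightly
      towards \<open>E1\<close>. The direction \<open>w - e\<close> then points into
      \<open>E1\<close> or \<open>E2\<close>, both inside \<open>\<Omega>\<^sub>2\<close>, against
      the exterior cone.\<close>
    define w where "w = (if e \<bullet> m1 = 0 then (\<eta> / 2) *\<^sub>R m1 else 0)"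
    have w: "norm w < \<eta>" using cone(2) n1 by (simp add: w_def)
    have "(w - e) \<bullet> m1 \<noteq> 0" using cone(2) n1 by (simp add: w_def inner_diff_left)
    then have "(w - e) \<bullet> m1 > 0 \<or> (w - e) \<bullet> m2 > 0" by (auto simp: m21)
    then obtain E s where E: "E \<in> components Y" and s: "s > 0" "\<And>t. 0 < t \<Longrightarrow> t < s \<Longrightarrow> z + t *\<^sub>R (w - e) \<in> E"
      using inner_normal_ray[OF m(1), of "w - e"] inner_normal_ray[OF m(2), of "w - e"] E1 E2(1) by metis
    have t: "0 < min r s / 2" "min r s / 2 < r" "min r s / 2 < s" using cone(3) s(1) by auto
    show False using s(2)[OF t(1,3)] cone(4)[OF w t(1,2)] sub[OF E] by blast
  qed
  have S_open: "\<exists>N. open N \<and> z \<in> N \<and> frontier E1 \<inter> N \<subseteq> S" if z: "z \<in> S" for z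
  proof (intro exI conjI)
    \<comment> \<open>Away from the closures of the finitely many other copies, density leaves only
      points of the closures of \<open>E1\<close> and \<open>E2\<close>.\<close>
    let ?N = "\<Omega>\<^sub>2 - (\<Union>E\<in>components Y - {E1, E2}. closure E)"
    show oN: "open ?N" using o2(1) fin by (intro open_Diff closed_UN) auto
    show "z \<in> ?N" using S_in[OF z] only2[OF z] by blast
    have Ncl: "?N \<subseteq> closure E1 \<union> closure E2" using Y(3) clY by blast
    show "frontier E1 \<inter> ?N \<subseteq> S"
    proof
      fix p assume p: "p \<in> frontier E1 \<inter> ?N"
      have "p \<in> closure E2"
      proof (rule ccontr)
        assume "p \<notin> closure E2"
        then have "p \<in> ?N - closure E2" using p by blast
        then obtain x where "x \<in> ?N - closure E2" "x \<notin> closure E1"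
          using exterior[OF E1 IntD1[OF p] open_Diff[OF oN closed_closure]] by metis
        then show False using Ncl by blast
      qed
      then show "p \<in> S" using p by (simp add: S_def frontier_def)
    qed
  qed
  have T12: "T E1 z = T E2 z" if "z \<in> S" for z using agree[OF E1 E2(1)] that by (simp add: S_def)
  have "T E1 \<noteq> T E2" using Eq[OF E1] Eq[OF E2(1)] E2(2) by metis
  then obtain q where q: "T E1 q \<noteq> T E2 q" by blast
  \<comment> \<open>A point where the two isometries agree has equal distances to the two images of
    \<open>q\<close>; so the image of \<open>S\<close> lies in the perpendicular bisector of
    \<open>?p\<close> and \<open>?p'\<close>.\<close>
  let ?p = "T E1 q" and ?p' = "T E2 q"
  obtain R where R: "is_isometry R" "\<And>x. T E1 (R x) = x" "\<And>x. R (T E1 x) = x" using isometry_inverse[OF iso[OF E1]] by metis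
  show False
  proof (rule no_flat_compact_boundary_piece[OF dim C1, where S="T E1 ` S" and a="2 *\<^sub>R (?p' - ?p)" and b="?p' \<bullet> ?p' - ?p \<bullet> ?p"])
    show "compact (T E1 ` S)" by (intro compact_continuous_image isometry_continuous iso E1 cS)
    show "T E1 ` S \<noteq> {}" using z0S by blast
    show "T E1 ` S \<subseteq> frontier \<Omega>\<^sub>1" using frE[OF E1] Sfr1 by blast
    show "2 *\<^sub>R (?p' - ?p) \<noteq> 0" using q by simp
    show "2 *\<^sub>R (?p' - ?p) \<bullet> x = ?p' \<bullet> ?p' - ?p \<bullet> ?p" if x: "x \<in> T E1 ` S" for x
    proof -
      obtain z where z: "z \<in> S" "x = T E1 z" using x by blast
      have "dist x ?p = dist z q" using iso[OF E1] unfolding z(2) is_isometry_def by blast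
      moreover have "dist x ?p' = dist z q" using iso[OF E2(1)] unfolding z(2) T12[OF z(1)] is_isometry_def by blast
      ultimately have "dist x ?p = dist x ?p'" by simp
      then have "(x - ?p) \<bullet> (x - ?p) = (x - ?p') \<bullet> (x - ?p')" by (simp add: dist_norm norm_eq)
      then show ?thesis by (simp add: inner_diff_left inner_diff_right inner_commute)
    qed
    fix x assume "x \<in> T E1 ` S"
    then obtain z where z: "z \<in> S" "x = T E1 z" by blast
    obtain N where N: "open N" "z \<in> N" "frontier E1 \<inter> N \<subseteq> S" using S_open[OF z(1)] by blast
    have "open (R -` N)" using N(1) isometry_continuous[OF R(1)] by (simp add: open_vimage)
    moreover have "x \<in> R -` N" using N(2) z(2) R(3) by simp
    moreover have "frontier \<Omega>\<^sub>1 \<inter> R -` N \<subseteq> T E1 ` S"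
    proof
      fix y assume y: "y \<in> frontier \<Omega>\<^sub>1 \<inter> R -` N"
      then have "R y \<in> frontier E1 \<inter> N" using frE[OF E1, of "R y"] R(2) by simp
      then have "R y \<in> S" using N(3) by blast
      then show "y \<in> T E1 ` S" using R(2)[of y] by (metis imageI)
    qed
    ultimately show "\<exists>N. open N \<and> x \<in> N \<and> frontier \<Omega>\<^sub>1 \<inter> N \<subseteq> T E1 ` S" by blast
  qed
qed

subsection \<open>Cut-off functions and surface measure\<close>

lemma smooth_test_function_compactI:
  assumes "smooth f" "compact K" "K \<subseteq> S" "\<And>y. y \<notin> K \<Longrightarrow> f y = 0"
  shows "f \<in> test_functions S"
proof -
  have "closure {x. f x \<noteq> 0} \<subseteq> K"
    by (rule closure_minimal) (use assms(2,4) compact_imp_closed in blast)+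
  then have "compact (closure {x. f x \<noteq> 0})"
    using assms(2) by (metis closed_Int_compact closed_closure inf.absorb_iff1)
  then show ?thesis
    using \<open>closure {x. f x \<noteq> 0} \<subseteq> K\<close> assms(1,3) unfolding test_functions_def smooth_def by blast
qed

lemma smooth_prod:
  fixes f :: "'i \<Rightarrow> 'a::euclidean_space \<Rightarrow> complex"
  shows "(\<And>i. i \<in> I \<Longrightarrow> smooth (f i)) \<Longrightarrow> smooth (\<lambda>x. \<Prod>i\<in>I. f i x)"
  by (induction I rule: infinite_finite_induct) (auto intro: smooth_const smooth_mult)

text \<open>Countably many bumps \<open>b j\<close>, each equal to \<open>1\<close> on the ball of
  half its radius, such that these smaller balls cover the set. One minus the product of the
  \<open>1 - b j\<close> has compact support and becomes \<open>1\<close> at a point as soon as one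
  of the bumps involved is \<open>1\<close> there.\<close>

lemma exhausting_cutoffs:
  fixes O1 :: "'a::euclidean_space set"
  assumes O1: "open O1"
  obtains cut :: "nat \<Rightarrow> 'a \<Rightarrow> complex" where "\<And>n. smooth (cut n)"
    "\<And>n. \<exists>K. compact K \<and> K \<subseteq> O1 \<and> (\<forall>x. x \<notin> K \<longrightarrow> cut n x = 0)"
    "\<And>n x. cmod (cut n x) \<le> 1" "\<And>x. x \<in> O1 \<Longrightarrow> (\<lambda>n. cut n x) \<longlonglongrightarrow> 1"
proof (cases "O1 = {}")
  case True
  show ?thesis
    by (rule that[of "\<lambda>_ _. 0"]) (use True in \<open>auto intro: smooth_const\<close>)
next
  case False
  obtain \<eta> where \<eta>: "radial_profile \<eta>" "\<And>s. s \<le> 1 / 2 \<Longrightarrow> \<eta> s = 1" "\<And>s. 0 \<le> \<eta> s" "\<And>s. \<eta> s \<le> 1"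
    by (rule cutoff_profile) (rule that)
  define F where "F = {(x, r). r > 0 \<and> cball x r \<subseteq> O1}"
  have cover: "(\<Union>(x, r)\<in>F. ball x (r / 2)) = O1"
  proof (intro equalityI subsetI)
    fix y assume "y \<in> O1"
    then obtain r where "r > 0" "cball y r \<subseteq> O1" using O1 open_contains_cball by metis
    then have "(y, r) \<in> F" "y \<in> ball y (r / 2)" by (auto simp: F_def)
    then show "y \<in> (\<Union>(x, r)\<in>F. ball x (r / 2))" by blast
  next
    fix y assume "y \<in> (\<Union>(x, r)\<in>F. ball x (r / 2))"
    then show "y \<in> O1" by (force simp: F_def)
  qed
  obtain \<D> where \<D>: "\<D> \<subseteq> (\<lambda>(x, r). ball x (r / 2)) ` F" "countable \<D>" "\<Union>\<D> = \<Union>((\<lambda>(x, r). ball x (r / 2)) ` F)"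
  proof (rule Lindelof)
    show "open B" if "B \<in> (\<lambda>(x, r). ball x (r / 2)) ` F" for B using that by auto
  qed (rule that)
  obtain F' where F': "countable F'" "F' \<subseteq> F" "\<D> = (\<lambda>(x, r). ball x (r / 2)) ` F'"
    using countable_subset_image[of \<D> "\<lambda>(x, r). ball x (r / 2)" F] \<D>(1,2) by blast
  have cover': "(\<Union>p\<in>F'. ball (fst p) (snd p / 2)) = O1"
    using cover \<D>(3) F'(3) by (simp add: case_prod_unfold)
  then have ne: "F' \<noteq> {}" using False by auto
  define p where "p = from_nat_into F'"
  have pF: "p n \<in> F" for n using F'(2) from_nat_into[OF ne] by (auto simp: p_def)
  define b where "b n = radial \<eta> (snd (p n)) (fst (p n))" for n
  define cut where "cut n x = 1 - (\<Prod>j\<le>n. 1 - b j x)" for n x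
  have b01: "\<exists>t. b n x = complex_of_real t \<and> 0 \<le> t \<and> t \<le> 1" for n x
    using \<eta>(3,4) by (auto simp: b_def radial_def)
  have sb: "smooth (b n)" for n using \<eta>(1) unfolding b_def radial_profile_def by (intro smooth_radial) simp
  show ?thesis
  proof
    show "smooth (cut n)" for n
    proof -
      have "smooth (\<lambda>x. 1 + (- 1) * (\<Prod>j\<le>n. 1 + (- 1) * b j x))"
        by (intro smooth_add smooth_mult smooth_const smooth_prod sb)
      then show ?thesis by (simp add: cut_def[abs_def])
    qed
    show "\<exists>K. compact K \<and> K \<subseteq> O1 \<and> (\<forall>x. x \<notin> K \<longrightarrow> cut n x = 0)" for n
    proof (intro exI conjI allI impI)
      show "compact (\<Union>j\<le>n. cball (fst (p j)) (snd (p j)))" by (intro compact_UN) auto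
      show "(\<Union>j\<le>n. cball (fst (p j)) (snd (p j))) \<subseteq> O1" using pF by (force simp: F_def case_prod_unfold)
      fix x assume x: "x \<notin> (\<Union>j\<le>n. cball (fst (p j)) (snd (p j)))"
      have "b j x = 0" if "j \<le> n" for j
        using x that \<eta>(1) pF[of j] unfolding b_def
        by (intro radial_outside) (force simp: radial_profile_def F_def case_prod_unfold)+
      then show "cut n x = 0" by (simp add: cut_def)
    qed
    show "cmod (cut n x) \<le> 1" for n x
    proof -
      define t where "t j = Re (b j x)" for j
      have t: "b j x = complex_of_real (t j)" "0 \<le> t j" "t j \<le> 1" for j
        using b01[of j x] by (auto simp: t_def)
      have "cut n x = complex_of_real (1 - (\<Prod>j\<le>n. 1 - t j))" by (simp add: cut_def t(1))
      moreover have "0 \<le> (\<Prod>j\<le>n. 1 - t j)" "(\<Prod>j\<le>n. 1 - t j) \<le> 1"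
        using t(2,3) by (auto intro!: prod_nonneg prod_le_1)
      ultimately show ?thesis by (simp only: norm_of_real)
    qed
    fix x assume "x \<in> O1"
    then obtain q where q: "q \<in> F'" "x \<in> ball (fst q) (snd q / 2)" using cover' by blast
    then obtain m where m: "q = p m" using from_nat_into_surj[OF F'(1)] unfolding p_def by metis
    have "b m x = 1"
    proof -
      have s: "snd (p m) > 0" using pF[of m] by (auto simp: F_def)
      have "(norm (x - fst (p m)))\<^sup>2 \<le> (snd (p m) / 2)\<^sup>2"
        using q(2) by (intro power_mono) (auto simp: m dist_norm norm_minus_commute)
      then have "(norm (x - fst (p m)))\<^sup>2 / (snd (p m))\<^sup>2 \<le> 1 / 4"
        using s by (simp add: divide_le_eq power_divide)
      then have "(norm (x - fst (p m)))\<^sup>2 / (snd (p m))\<^sup>2 \<le> 1 / 2" by linarith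
      from \<eta>(2)[OF this] show ?thesis by (simp add: b_def radial_def)
    qed
    then have "cut n x = 1" if "n \<ge> m" for n
      using that by (simp add: cut_def) (metis atMost_iff diff_self finite_atMost prod_zero)
    then show "(\<lambda>n. cut n x) \<longlonglongrightarrow> 1"
      by (intro tendsto_eventually) (auto simp: eventually_sequentially)
  qed
qed

text \<open>Multiplying \<open>p\<close> by the cut-offs gives admissible test functions, and
  dominated convergence passes to the limit. A weak identity in the interior can thus be tested with
  functions that do not vanish near the boundary.\<close>

lemma weak_zero_extends:
  fixes k p :: "'a::euclidean_space \<Rightarrow> complex"
  assumes O1: "open O1" and k: "integrable lebesgue k"
    and weak: "\<And>\<psi>. \<psi> \<in> test_functions O1 \<Longrightarrow> (\<integral>y. k y * \<psi> y \<partial>lebesgue) = 0"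
    and p: "smooth p" "\<And>x. cmod (p x) \<le> B"
  shows "(\<integral>y. restr O1 k y * p y \<partial>lebesgue) = 0"
proof -
  obtain cut :: "nat \<Rightarrow> 'a \<Rightarrow> complex" where cut: "\<And>n. smooth (cut n)"
    "\<And>n. \<exists>K. compact K \<and> K \<subseteq> O1 \<and> (\<forall>x. x \<notin> K \<longrightarrow> cut n x = 0)"
    "\<And>n x. cmod (cut n x) \<le> 1" "\<And>x. x \<in> O1 \<Longrightarrow> (\<lambda>n. cut n x) \<longlonglongrightarrow> 1"
    by (rule exhausting_cutoffs[OF O1]) (rule that)
  have mk: "k \<in> borel_measurable lebesgue" using k by auto
  have mp: "p \<in> borel_measurable lebesgue" by (rule smooth_measurable_lebesgue[OF p(1)])
  have mc: "cut n \<in> borel_measurable lebesgue" for n by (rule smooth_measurable_lebesgue[OF cut(1)])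
  have out: "cut n y = 0" if "y \<notin> O1" for n y using cut(2)[of n] that by blast
  have "(\<lambda>n. \<integral>y. k y * (cut n y * p y) \<partial>lebesgue) \<longlonglongrightarrow> (\<integral>y. restr O1 k y * p y \<partial>lebesgue)"
  proof (rule integral_dominated_convergence[where w="\<lambda>y. norm (k y) * B"])
    have "(\<lambda>y. indicator O1 y *\<^sub>R k y) \<in> borel_measurable lebesgue"
      using mk O1 by (intro borel_measurable_scaleR borel_measurable_indicator) auto
    then have "restr O1 k \<in> borel_measurable lebesgue" by (simp add: restr_def[abs_def] indicator_scaleR_eq_if)
    then show "(\<lambda>y. restr O1 k y * p y) \<in> borel_measurable lebesgue" using mp by simp
    show "(\<lambda>y. k y * (cut n y * p y)) \<in> borel_measurable lebesgue" for n using mk mp mc by simp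
    show "integrable lebesgue (\<lambda>y. norm (k y) * B)" using k by simp
    show "AE y in lebesgue. (\<lambda>n. k y * (cut n y * p y)) \<longlonglongrightarrow> restr O1 k y * p y"
    proof (intro always_eventually allI)
      fix y
      show "(\<lambda>n. k y * (cut n y * p y)) \<longlonglongrightarrow> restr O1 k y * p y"
      proof (cases "y \<in> O1")
        case True
        have "(\<lambda>n. k y * (cut n y * p y)) \<longlonglongrightarrow> k y * (1 * p y)"
          by (intro tendsto_intros cut(4) True)
        then show ?thesis using True by (simp add: restr_def)
      qed (simp add: out restr_def)
    qed
    show "AE y in lebesgue. norm (k y * (cut n y * p y)) \<le> norm (k y) * B" for n
    proof (intro always_eventually allI)
      fix y
      have "norm (cut n y) * norm (p y) \<le> 1 * B" using cut(3) p(2) by (intro mult_mono) auto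
      then show "norm (k y * (cut n y * p y)) \<le> norm (k y) * B"
        unfolding norm_mult by (intro mult_left_mono) auto
    qed
  qed
  moreover have "(\<integral>y. k y * (cut n y * p y) \<partial>lebesgue) = 0" for n
  proof (rule weak)
    obtain K where K: "compact K" "K \<subseteq> O1" "\<And>x. x \<notin> K \<Longrightarrow> cut n x = 0" using cut(2) by blast
    show "(\<lambda>y. cut n y * p y) \<in> test_functions O1"
      by (rule smooth_test_function_compactI[OF smooth_mult[OF cut(1) p(1)] K(1,2)]) (simp add: K(3))
  qed
  ultimately show ?thesis using LIMSEQ_unique tendsto_const by (metis (no_types, lifting) ext)
qed

text \<open>Cutting the parameter cube into \<open>m ^ (d - 1)\<close> cells covers the graph by
  sets of diameter at most \<open>D / m\<close>, whose total cost is at most the constant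
  \<open>M\<close>, whatever \<open>m\<close> is.\<close>

lemma hausdorff_outer_measure_lipschitz_graph:
  fixes A :: "'a::euclidean_space set"
  assumes e: "norm e = 1" and L: "L-lipschitz_on UNIV \<phi>" and A: "A \<subseteq> ball z R"
    and gr: "\<And>x. x \<in> A \<Longrightarrow> x \<bullet> e = \<phi> (x - (x \<bullet> e) *\<^sub>R e)"
  shows "hausdorff_outer_measure (DIM('a) - 1) A < \<infinity>"
proof (cases "R > 0")
  case False
  then have "A = {}" using A by (auto simp: ball_empty)
  have "hausdorff_premeasure (DIM('a) - 1) \<delta> A \<le> 0" if "\<delta> > 0" for \<delta>
    unfolding hausdorff_premeasure_def
    by (rule INF_lower2[of "\<lambda>_. {}"]) (use that \<open>A = {}\<close> in \<open>auto simp: diameter_def\<close>)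
  then have "hausdorff_outer_measure (DIM('a) - 1) A \<le> 0"
    unfolding hausdorff_outer_measure_def by (intro SUP_least) auto
  then show ?thesis by (metis ennreal_zero_less_top infinity_ennreal_def le_zero_eq)
next
  case True
  let ?k = "DIM('a) - 1"
  obtain S where S: "e \<in> S" "pairwise orthogonal S" "\<And>x. x \<in> S \<Longrightarrow> norm x = 1"
    "independent S" "card S = DIM('a)" "span S = UNIV"
    using vector_in_orthonormal_basis[OF e] by metis
  have fS: "finite S" using S(4) independent_imp_finite by blast
  define B where "B = S - {e}"
  have B: "finite B" "card B = ?k" using fS S(1,5) by (auto simp: B_def)
  have expand: "x - (x \<bullet> e) *\<^sub>R e = (\<Sum>b\<in>B. (x \<bullet> b) *\<^sub>R b)" for x
  proof -
    have "x = (\<Sum>b\<in>S. (x \<bullet> b) *\<^sub>R b)"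
      by (rule orthonormal_basis_expand[symmetric]) (use S fS in auto)
    also have "\<dots> = (x \<bullet> e) *\<^sub>R e + (\<Sum>b\<in>B. (x \<bullet> b) *\<^sub>R b)"
      unfolding B_def by (rule sum.remove[OF fS S(1)])
    finally show ?thesis by (metis add_diff_cancel_left')
  qed
  have L0: "L \<ge> 0" using L by (rule lipschitz_on_nonneg)
  have dist_le: "dist x y \<le> (1 + L) * (\<Sum>b\<in>B. \<bar>(x - y) \<bullet> b\<bar>)" if x: "x \<in> A" and y: "y \<in> A" for x y
  proof -
    let ?x = "x - (x \<bullet> e) *\<^sub>R e" and ?y = "y - (y \<bullet> e) *\<^sub>R e"
    have "?x - ?y = (\<Sum>b\<in>B. ((x - y) \<bullet> b) *\<^sub>R b)"
      unfolding expand[symmetric] by (simp add: inner_diff_left algebra_simps)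
    also have "norm \<dots> \<le> (\<Sum>b\<in>B. \<bar>(x - y) \<bullet> b\<bar>)"
      by (rule order_trans[OF norm_sum]) (use S(3) in \<open>auto simp: B_def intro!: sum_mono\<close>)
    finally have h: "dist ?x ?y \<le> (\<Sum>b\<in>B. \<bar>(x - y) \<bullet> b\<bar>)" by (simp add: dist_norm)
    have "\<bar>x \<bullet> e - y \<bullet> e\<bar> \<le> L * dist ?x ?y"
      using lipschitz_onD[OF L, of ?x ?y] gr[OF x] gr[OF y] by (simp add: dist_real_def)
    moreover have "x - y = (?x - ?y) + (x \<bullet> e - y \<bullet> e) *\<^sub>R e" by (simp add: algebra_simps)
    then have "norm (x - y) \<le> norm (?x - ?y) + norm ((x \<bullet> e - y \<bullet> e) *\<^sub>R e)" by (metis norm_triangle_ineq)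
    ultimately have "dist x y \<le> dist ?x ?y + L * dist ?x ?y" using e by (simp add: dist_norm)
    also have "\<dots> = (1 + L) * dist ?x ?y" by (simp add: algebra_simps)
    also have "\<dots> \<le> (1 + L) * (\<Sum>b\<in>B. \<bar>(x - y) \<bullet> b\<bar>)" using h L0 by (intro mult_left_mono) auto
    finally show ?thesis .
  qed
  \<comment> \<open>A bound for the diameter of \<open>A\<close>: width \<open>2 * R\<close> in each
    of the \<open>?k\<close> parameter directions, stretched by the factor \<open>1 + L\<close> of
    the graph.\<close>
  define D where "D = (1 + L) * (real ?k * (2 * R))"
  have D0: "D \<ge> 0" using L0 True by (simp add: D_def)
  define M where "M = unit_ball_vol (real ?k) * (D / 2) ^ ?k"
  have pre: "hausdorff_premeasure ?k \<delta> A \<le> ennreal M" if \<delta>: "\<delta> > 0" for \<delta>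
  proof -
    obtain m :: nat where m: "D / \<delta> < real m" using reals_Archimedean2 by blast
    have m0: "m > 0" using m D0 \<delta> by (metis divide_nonneg_pos gr0I less_le_not_le of_nat_0)
    have Dm: "D / real m \<le> \<delta>" using m m0 \<delta> by (simp add: field_simps)
    \<comment> \<open>\<open>t x b\<close> rescales the coordinate to the range from
      \<open>0\<close> to \<open>m\<close>; its integer part selects the cell.\<close>
    define t where "t x b = (x \<bullet> b - z \<bullet> b + R) * real m / (2 * R)" for x b
    define cell where "cell \<kappa> = {x \<in> A. \<forall>b\<in>B. nat \<lfloor>t x b\<rfloor> = \<kappa> b}" for \<kappa>
    define I where "I = PiE B (\<lambda>_. {..<m})"
    have I: "finite I" "card I = m ^ ?k" using B by (auto simp: I_def finite_PiE card_PiE)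
    have t: "0 \<le> t x b" "t x b < real m" if "x \<in> A" "b \<in> B" for x b
    proof -
      have "\<bar>(x - z) \<bullet> b\<bar> \<le> norm (x - z) * norm b" by (rule Cauchy_Schwarz_ineq2)
      also have "\<dots> < R" using that A S(3) by (auto simp: B_def dist_norm norm_minus_commute)
      finally have "- R < x \<bullet> b - z \<bullet> b" "x \<bullet> b - z \<bullet> b < R" by (auto simp: inner_diff_left)
      then have N: "0 < x \<bullet> b - z \<bullet> b + R" "x \<bullet> b - z \<bullet> b + R < 2 * R" by auto
      show "0 \<le> t x b" using True N(1) by (simp add: t_def)
      have "(x \<bullet> b - z \<bullet> b + R) * real m < 2 * R * real m" using N(2) m0 by (intro mult_strict_right_mono) auto
      then show "t x b < real m" using True by (simp add: t_def divide_less_eq mult_ac)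
    qed
    have cover: "A \<subseteq> (\<Union>\<kappa>\<in>I. cell \<kappa>)"
    proof
      fix x assume x: "x \<in> A"
      let ?\<kappa> = "restrict (\<lambda>b. nat \<lfloor>t x b\<rfloor>) B"
      have "nat \<lfloor>t x b\<rfloor> < m" if "b \<in> B" for b using t[OF x that] by linarith
      then have "?\<kappa> \<in> I" by (auto simp: I_def)
      moreover have "x \<in> cell ?\<kappa>" using x by (simp add: cell_def)
      ultimately show "x \<in> (\<Union>\<kappa>\<in>I. cell \<kappa>)" by blast
    qed
    have dC: "dist x y \<le> D / real m" if "x \<in> cell \<kappa>" "y \<in> cell \<kappa>" for x y \<kappa>
    proof -
      have xy: "x \<in> A" "y \<in> A" using that by (auto simp: cell_def)
      have "\<bar>(x - y) \<bullet> b\<bar> \<le> 2 * R / real m" if b: "b \<in> B" for b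
      proof -
        have "nat \<lfloor>t x b\<rfloor> = nat \<lfloor>t y b\<rfloor>" using \<open>x \<in> cell \<kappa>\<close> \<open>y \<in> cell \<kappa>\<close> b by (simp add: cell_def)
        then have "\<bar>t x b - t y b\<bar> < 1" using t[OF xy(1) b] t[OF xy(2) b] by linarith
        moreover have "t x b - t y b = ((x - y) \<bullet> b) * (real m / (2 * R))"
          by (simp add: t_def inner_diff_left left_diff_distrib distrib_right diff_divide_distrib add_divide_distrib)
        ultimately have "\<bar>(x - y) \<bullet> b\<bar> * (real m / (2 * R)) < 1" using True by (simp add: abs_mult)
        then show ?thesis using True m0 by (simp add: field_simps)
      qed
      then have "(\<Sum>b\<in>B. \<bar>(x - y) \<bullet> b\<bar>) \<le> real ?k * (2 * R / real m)"
        using sum_bounded_above[of B "\<lambda>b. \<bar>(x - y) \<bullet> b\<bar>" "2 * R / real m"] B(2) by simp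
      then have "(1 + L) * (\<Sum>b\<in>B. \<bar>(x - y) \<bullet> b\<bar>) \<le> (1 + L) * (real ?k * (2 * R / real m))"
        using L0 by (intro mult_left_mono) auto
      then show ?thesis using dist_le[OF xy] by (simp add: D_def)
    qed
    obtain f where f: "bij_betw f {..<card I} I"
      using ex_bij_betw_nat_finite[OF I(1)] by (metis atLeast0LessThan)
    define Q where "Q n = (if n < card I then cell (f n) else {})" for n
    have diam: "diameter (Q n) \<le> D / real m" for n
      using dC D0 by (intro diameter_le) (auto simp: Q_def dist_norm split: if_splits)
    have Q: "Q \<in> {C. A \<subseteq> (\<Union>n. C n) \<and> (\<forall>n. bounded (C n) \<and> diameter (C n) \<le> \<delta>)}"
    proof (intro CollectI conjI allI)
      show "A \<subseteq> (\<Union>n. Q n)"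
      proof
        fix x assume "x \<in> A"
        then obtain \<kappa> where \<kappa>: "\<kappa> \<in> I" "x \<in> cell \<kappa>" using cover by blast
        then obtain n where "n < card I" "f n = \<kappa>" using f unfolding bij_betw_def by (metis imageE lessThan_iff)
        then show "x \<in> (\<Union>n. Q n)" using \<kappa>(2) by (auto simp: Q_def)
      qed
      show "bounded (Q n)" for n
        by (rule bounded_subset[OF bounded_ball[of z R]]) (use A in \<open>auto simp: Q_def cell_def\<close>)
      show "diameter (Q n) \<le> \<delta>" for n using diam[of n] Dm by linarith
    qed
    let ?s = "\<lambda>n. if Q n = {} then 0 else ennreal (unit_ball_vol (real ?k) * (diameter (Q n) / 2) ^ ?k)"
    have "hausdorff_premeasure ?k \<delta> A \<le> (\<Sum>n. ?s n)"
      unfolding hausdorff_premeasure_def by (rule INF_lower[OF Q])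
    also have "\<dots> = (\<Sum>n<card I. ?s n)"
      by (rule suminf_finite) (auto simp: Q_def)
    also have "\<dots> \<le> (\<Sum>n<card I. ennreal (unit_ball_vol (real ?k) * (D / real m / 2) ^ ?k))"
    proof (rule sum_mono)
      fix n
      have "0 \<le> diameter (Q n)"
        by (rule diameter_ge_0) (rule bounded_subset[OF bounded_ball[of z R]], use A in \<open>auto simp: Q_def cell_def\<close>)
      then have "(diameter (Q n) / 2) ^ ?k \<le> (D / real m / 2) ^ ?k" using diam[of n] by (intro power_mono) auto
      then show "?s n \<le> ennreal (unit_ball_vol (real ?k) * (D / real m / 2) ^ ?k)"
        by (auto intro!: ennreal_leI mult_left_mono)
    qed
    also have "\<dots> = ennreal (real (card I) * (unit_ball_vol (real ?k) * (D / real m / 2) ^ ?k))"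
      using D0 by (simp add: ennreal_mult' ennreal_of_nat_eq_real_of_nat)
    also have "real (card I) * (unit_ball_vol (real ?k) * (D / real m / 2) ^ ?k) = M"
      using m0 by (simp add: I(2) M_def power_divide)
    finally show ?thesis .
  qed
  have "hausdorff_outer_measure ?k A \<le> ennreal M"
    unfolding hausdorff_outer_measure_def by (intro SUP_least pre) auto
  then show ?thesis using ennreal_less_top infinity_ennreal_def le_less_trans by metis
qed

lemma sets_hausdorff_measure: "sets (hausdorff_measure k :: 'a::euclidean_space measure) = sets borel"
  and space_hausdorff_measure: "space (hausdorff_measure k :: 'a::euclidean_space measure) = UNIV"
  unfolding hausdorff_measure_def using sets.sigma_sets_eq[of borel] by (auto simp: space_measure_of_conv)

text \<open>\<open>measure_of\<close> yields either the given set function or zero, and the bound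
  holds in both cases.\<close>

lemma emeasure_hausdorff_measure_le:
  "emeasure (hausdorff_measure k) A \<le> hausdorff_outer_measure k (A :: 'a::euclidean_space set)"
  unfolding hausdorff_measure_def by (simp add: emeasure_measure_of_conv)

lemma surface_measure_finite:
  fixes z :: "'a::euclidean_space"
  assumes lip: "lipschitz_boundary \<Omega>" and z: "z \<in> frontier \<Omega>"
  obtains R where "R > 0" "emeasure (surface_measure \<Omega>) (frontier \<Omega> \<inter> ball z R) < \<infinity>"
proof -
  obtain e V \<phi> where e: "norm e = 1" and V: "open V" "z \<in> V" and "\<exists>L. L-lipschitz_on UNIV \<phi>"
    and fr: "\<And>x. x \<in> V \<Longrightarrow> x \<in> frontier \<Omega> \<longleftrightarrow> x \<bullet> e = \<phi> (x - (x \<bullet> e) *\<^sub>R e)"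
    using boundary_locally_graphE[OF lip[unfolded lipschitz_boundary_def] z] by metis
  then obtain L where L: "L-lipschitz_on UNIV \<phi>" by blast
  obtain R where R: "R > 0" "ball z R \<subseteq> V" using V open_contains_ball by metis
  have "emeasure (surface_measure \<Omega>) (frontier \<Omega> \<inter> ball z R) =
      emeasure (hausdorff_measure (DIM('a) - 1)) (frontier \<Omega> \<inter> ball z R)"
    unfolding surface_measure_def
    by (rule emeasure_restrict_space) (auto simp: sets_hausdorff_measure space_hausdorff_measure)
  also have "\<dots> \<le> hausdorff_outer_measure (DIM('a) - 1) (frontier \<Omega> \<inter> ball z R)"
    by (rule emeasure_hausdorff_measure_le)
  also have "\<dots> < \<infinity>"
    by (rule hausdorff_outer_measure_lipschitz_graph[OF e L]) (use R(2) fr in auto)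
  finally show ?thesis using that R(1) by blast
qed

text \<open>\<open>W\<close> is a cylinder around \<open>e\<close>. Every point above the graph is
  joined vertically to the level \<open>s\<close>, and within that level to a common point. The
  purpose is to show that a component of \<open>Y\<close> reaching a boundary point fills the domain
  near it.\<close>

lemma connected_near_boundary:
  fixes \<Omega> :: "'a::euclidean_space set"
  assumes lip: "lipschitz_boundary \<Omega>" and z: "z \<in> frontier \<Omega>" and N: "open N" "z \<in> N"
  obtains W where "open W" "z \<in> W" "W \<subseteq> N" "connected (W \<inter> \<Omega>)"
proof -
  obtain e V \<phi> where e: "norm e = 1" and V: "open V" "z \<in> V" and "\<exists>L. L-lipschitz_on UNIV \<phi>"
    and fr: "\<And>x. x \<in> V \<Longrightarrow> x \<in> frontier \<Omega> \<longleftrightarrow> x \<bullet> e = \<phi> (x - (x \<bullet> e) *\<^sub>R e)"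
    and ins: "\<And>x. x \<in> V \<Longrightarrow> x \<in> \<Omega> \<longleftrightarrow> x \<bullet> e > \<phi> (x - (x \<bullet> e) *\<^sub>R e)"
    using boundary_locally_graphE[OF lip[unfolded lipschitz_boundary_def] z] by metis
  then obtain L where L: "L-lipschitz_on UNIV \<phi>" by blast
  have L0: "L \<ge> 0" using L by (rule lipschitz_on_nonneg)
  have ee: "e \<bullet> e = 1" using e by (simp add: norm_eq_1)
  obtain d where d: "d > 0" "ball z d \<subseteq> V \<inter> N" using V N open_contains_ball by (metis IntI open_Int)
  define p where "p x = x - (x \<bullet> e) *\<^sub>R e" for x
  \<comment> \<open>Over a base of this radius the graph deviates from its height at
    \<open>z\<close> by less than \<open>d / 4\<close>, so the level \<open>d / 4\<close> above
    \<open>z\<close> lies above the graph and inside the cylinder.\<close>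
  define \<rho> where "\<rho> = d / (4 * (L + 1))"
  have \<rho>: "\<rho> > 0" "L * \<rho> < d / 4" "\<rho> \<le> d / 4"
  proof -
    show "\<rho> > 0" using d L0 by (simp add: \<rho>_def)
    have "(L + 1) * \<rho> = d / 4" using L0 by (simp add: \<rho>_def field_simps)
    then have *: "L * \<rho> + \<rho> = d / 4" by (simp add: algebra_simps)
    then show "L * \<rho> < d / 4" using \<open>\<rho> > 0\<close> by linarith
    show "\<rho> \<le> d / 4" using * mult_nonneg_nonneg[OF L0, of \<rho>] \<open>\<rho> > 0\<close> by linarith
  qed
  define W where "W = {x. norm (p x - p z) < \<rho>} \<inter> {x. \<bar>x \<bullet> e - z \<bullet> e\<bar> < d / 2}"
  have cp: "continuous_on UNIV p" unfolding p_def[abs_def] by (intro continuous_intros)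
  have W: "open W" unfolding W_def
    by (intro open_Int open_Collect_less continuous_intros cp)
  have zW: "z \<in> W" using \<rho> d by (simp add: W_def)
  have dec: "x = p x + (x \<bullet> e) *\<^sub>R e" for x by (simp add: p_def)
  have Wb: "W \<subseteq> V \<inter> N"
  proof
    fix x assume x: "x \<in> W"
    have "x - z = (p x - p z) + (x \<bullet> e - z \<bullet> e) *\<^sub>R e" by (simp add: p_def algebra_simps)
    then have "norm (x - z) \<le> norm (p x - p z) + norm ((x \<bullet> e - z \<bullet> e) *\<^sub>R e)" by (metis norm_triangle_ineq)
    then have "norm (x - z) < d" using x \<rho>(3) e d(1) by (simp add: W_def)
    then show "x \<in> V \<inter> N" by (intro subsetD[OF d(2)]) (simp add: dist_norm norm_minus_commute)
  qed
  have zph: "\<phi> (p z) = z \<bullet> e" using fr[OF V(2)] z by (simp add: p_def)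
  have ph: "\<phi> (p x) < z \<bullet> e + d / 4" if "x \<in> W" for x
  proof -
    have "\<bar>\<phi> (p x) - \<phi> (p z)\<bar> \<le> L * norm (p x - p z)"
      using lipschitz_onD[OF L, of "p x" "p z"] by (simp add: dist_real_def dist_norm)
    also have "\<dots> \<le> L * \<rho>" using that L0 by (intro mult_left_mono) (auto simp: W_def)
    finally show ?thesis using \<rho>(2) zph by linarith
  qed
  define s where "s = z \<bullet> e + d / 4"
  define top where "top x = p x + s *\<^sub>R e" for x
  have pe: "p x \<bullet> e = 0" for x using ee by (simp add: p_def inner_diff_left)
  have WO: "x \<in> \<Omega> \<longleftrightarrow> x \<bullet> e > \<phi> (p x)" if "x \<in> W" for x
    using ins[of x] Wb that by (auto simp: p_def)
  have convW: "convex W"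
  proof -
    have lp: "linear p" unfolding p_def[abs_def] by (intro linearI) (auto simp: inner_add_left algebra_simps)
    have "{x. norm (p x - p z) < \<rho>} = p -` ball (p z) \<rho>" by (auto simp: dist_norm norm_minus_commute)
    moreover have "{x. \<bar>x \<bullet> e - z \<bullet> e\<bar> < d / 2} = (\<lambda>x. x \<bullet> e) -` ball (z \<bullet> e) (d / 2)" by (auto simp: dist_real_def abs_minus_commute)
    moreover have "linear (\<lambda>x. x \<bullet> e)" by (intro linearI) (auto simp: inner_add_left)
    ultimately show ?thesis
      unfolding W_def using lp by (auto intro!: convex_Int convex_linear_vimage)
  qed
  have ptop: "p (top x) = p x" "top x \<bullet> e = s" for x
    using pe[of x] ee by (auto simp: top_def inner_add_left p_def[of "p x + _"])
  have topW: "top x \<in> W" if "x \<in> W" for x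
    using that d(1) by (simp add: W_def ptop s_def)
  have seg1: "closed_segment x (top x) \<subseteq> W \<inter> \<Omega>" if x: "x \<in> W \<inter> \<Omega>" for x
  proof
    fix y assume y: "y \<in> closed_segment x (top x)"
    have yW: "y \<in> W" using y convW topW[of x] x by (metis IntD1 closed_segment_subset subsetD)
    obtain u where u: "0 \<le> u" "u \<le> 1" "y = (1 - u) *\<^sub>R x + u *\<^sub>R top x" using y by (auto simp: in_segment)
    have xs: "\<phi> (p x) < x \<bullet> e" "\<phi> (p x) < s" using WO[of x] x ph[of x] by (auto simp: s_def)
    have ye: "y \<bullet> e = (1 - u) * (x \<bullet> e) + u * s" by (simp add: u(3) inner_add_left ptop)
    have "y = p x + ((1 - u) * (x \<bullet> e) + u * s) *\<^sub>R e"
      unfolding u(3) top_def by (subst (1) dec[of x]) (simp add: algebra_simps)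
    then have py: "p y = p x" unfolding p_def[of y] ye by simp
    have "\<phi> (p x) < (1 - u) * (x \<bullet> e) + u * s"
      using convex_bound_lt[of "- (x \<bullet> e)" "- \<phi> (p x)" "- s" "1 - u" u] xs u by simp
    then show "y \<in> W \<inter> \<Omega>" using WO[OF yW] yW py ye by simp
  qed
  have seg2: "closed_segment (top x) (top z) \<subseteq> W \<inter> \<Omega>" if x: "x \<in> W" for x
  proof
    fix y assume y: "y \<in> closed_segment (top x) (top z)"
    have yW: "y \<in> W" using y convW topW[OF x] topW[OF zW] by (metis closed_segment_subset subsetD)
    obtain u where u: "y = (1 - u) *\<^sub>R top x + u *\<^sub>R top z" using y by (auto simp: in_segment)
    have "y \<bullet> e = s" by (simp add: u inner_add_left ptop algebra_simps)
    then show "y \<in> W \<inter> \<Omega>" using WO[OF yW] ph[OF yW] yW by (simp add: s_def)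
  qed
  have "connected (W \<inter> \<Omega>)"
  proof -
    have cc: "connected_component (W \<inter> \<Omega>) x (top z)" if x: "x \<in> W \<inter> \<Omega>" for x
    proof -
      have "connected_component (W \<inter> \<Omega>) x (top x)"
        unfolding connected_component_def using seg1[OF x] by (intro exI[of _ "closed_segment x (top x)"]) auto
      moreover have "connected_component (W \<inter> \<Omega>) (top x) (top z)"
        unfolding connected_component_def using seg2[of x] x by (intro exI[of _ "closed_segment (top x) (top z)"]) auto
      ultimately show ?thesis by (rule connected_component_trans)
    qed
    then show ?thesis
      unfolding connected_iff_connected_component by (meson connected_component_sym connected_component_trans)
  qed
  then show ?thesis using that W zW Wb by blast
qed

subsection \<open>Contact with the Robin boundary\<close>

lemma restr_integrable_iff:
  fixes f :: "'a::euclidean_space \<Rightarrow> complex"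
  assumes "open S" shows "integrable lebesgue (restr S f) \<longleftrightarrow> integrable (lebesgue_on S) f"
  using Lebesgue_Measure.integrable_restrict_UNIV[of S f] assms by (simp add: restr_def[abs_def])

lemma integrable_lebesgue_onI:
  fixes f :: "'a::euclidean_space \<Rightarrow> 'b::{second_countable_topology,banach}"
  assumes "open S" "integrable lebesgue f" shows "integrable (lebesgue_on S) f"
  using assms by (simp add: integrable_restrict_space integrable_mult_indicator)

lemma L2_integrable:
  fixes f :: "'a::euclidean_space \<Rightarrow> complex"
  assumes S: "open S" "bounded S" and f: "f \<in> L2 (lebesgue_on S)"
  shows "integrable (lebesgue_on S) f"
proof (rule Bochner_Integration.integrable_bound)
  have "emeasure (lebesgue_on S) (space (lebesgue_on S)) < \<infinity>"
    using emeasure_bounded_finite[OF S(2)] S(1) by (simp add: emeasure_restrict_space)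
  then have "integrable (lebesgue_on S) (\<lambda>_. 1 :: real)"
    by (intro integrableI_bounded_set[where A="space (lebesgue_on S)" and B=1]) auto
  then show "integrable (lebesgue_on S) (\<lambda>x. 1 + (cmod (f x))\<^sup>2)"
    using f by (intro Bochner_Integration.integrable_add) (auto simp: L2_def)
  show "f \<in> borel_measurable (lebesgue_on S)" using f by (simp add: L2_def)
  have "t \<le> 1 + t\<^sup>2" for t :: real
  proof -
    have "0 \<le> (t - 1)\<^sup>2" by simp
    then have "2 * t \<le> t\<^sup>2 + 1" by (simp add: power2_diff)
    then show ?thesis using zero_le_power2[of t] by linarith
  qed
  then show "AE x in lebesgue_on S. norm (f x) \<le> norm (1 + (cmod (f x))\<^sup>2)"
    by (intro always_eventually allI) (simp add: add_nonneg_nonneg)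
qed

lemma smooth_L2:
  fixes v :: "'a::euclidean_space \<Rightarrow> complex"
  assumes S: "open S" and v: "smooth v" "\<And>y. y \<notin> cball c \<rho> \<Longrightarrow> v y = 0"
  shows "v \<in> L2 (lebesgue_on S)"
proof -
  have m: "v \<in> borel_measurable lebesgue" by (rule smooth_measurable_lebesgue[OF v(1)])
  obtain B where B: "\<And>y. cmod (v y) \<le> B" using smooth_bounded[OF v] by blast
  have "integrable lebesgue (\<lambda>x. (cmod (v x))\<^sup>2)"
  proof (rule integrable_lebesgue_bounded_support[where B="B\<^sup>2" and c=c and R=\<rho>])
    show "(\<lambda>x. (cmod (v x))\<^sup>2) \<in> borel_measurable lebesgue" using m by measurable
    show "norm ((cmod (v x))\<^sup>2) \<le> B\<^sup>2" for x using B[of x] by (simp add: power_mono)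
  qed (use v(2) in auto)
  then show ?thesis
    using integrable_lebesgue_onI[OF S] m by (simp add: L2_def measurable_restrict_space1)
qed

lemma integration_by_parts:
  fixes v \<psi> :: "'a::euclidean_space \<Rightarrow> complex"
  assumes v: "smooth v" and psi: "smooth \<psi>" "\<And>x. x \<notin> cball 0 R \<Longrightarrow> \<psi> x = 0" and i: "i \<in> Basis"
  shows "(\<integral>y. v y * partial_deriv i \<psi> y \<partial>lebesgue) = - (\<integral>y. partial_deriv i v y * \<psi> y \<partial>lebesgue)"
proof -
  have "integrable lebesgue (\<lambda>y. v y * partial_deriv i \<psi> y)"
    by (rule smooth_integrable[OF smooth_mult[OF v smooth_partial[OF psi(1) i]], of 0 R])
      (metis partial_deriv_outside[of 0 R \<psi>, OF psi(2)] mult_zero_right)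
  moreover have "integrable lebesgue (\<lambda>y. partial_deriv i v y * \<psi> y)"
    by (rule smooth_integrable[OF smooth_mult[OF smooth_partial[OF v i] psi(1)], of 0 R]) (simp add: psi(2))
  moreover have "(\<integral>y. v y * partial_deriv i \<psi> y + partial_deriv i v y * \<psi> y \<partial>lebesgue) = 0"
    unfolding partial_deriv_mult[OF v psi(1), symmetric]
    by (rule integral_partial_deriv_eq_0[OF smooth_mult[OF v psi(1)] _ i, where R=R]) (simp add: psi(2))
  ultimately show ?thesis by (simp add: eq_neg_iff_add_eq_0)
qed

lemma smooth_H1_gradient:
  fixes v :: "'a::euclidean_space \<Rightarrow> complex"
  assumes S: "open S" and v: "smooth v" "\<And>y. y \<notin> cball c \<rho> \<Longrightarrow> v y = 0"
  shows "H1_gradient S v (\<lambda>i. partial_deriv i v)"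
  unfolding H1_gradient_def
proof (intro conjI ballI)
  show "v \<in> L2 (lebesgue_on S)" by (rule smooth_L2[OF S v])
  fix i :: 'a assume i: "i \<in> Basis"
  show "partial_deriv i v \<in> L2 (lebesgue_on S)"
    by (rule smooth_L2[OF S smooth_partial[OF v(1) i] partial_deriv_outside[of c \<rho> v, OF v(2)]])
  fix \<psi> assume psi: "\<psi> \<in> test_functions S"
  obtain R where R: "smooth \<psi>" "\<And>x. x \<notin> cball 0 R \<Longrightarrow> \<psi> x = 0" "\<And>x. x \<notin> S \<Longrightarrow> \<psi> x = 0"
    "\<And>x i. x \<notin> S \<Longrightarrow> partial_deriv i \<psi> x = 0"
    by (rule test_functionE[OF psi]) (rule that)
  have m: "S \<in> sets lebesgue" using S by simp
  have "(\<integral>x. v x * partial_deriv i \<psi> x \<partial>lebesgue_on S) = (\<integral>x. v x * partial_deriv i \<psi> x \<partial>lebesgue)"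
    by (rule integral_lebesgue_on_eq[OF m]) (simp add: R(4))
  moreover have "(\<integral>x. partial_deriv i v x * \<psi> x \<partial>lebesgue_on S) = (\<integral>x. partial_deriv i v x * \<psi> x \<partial>lebesgue)"
    by (rule integral_lebesgue_on_eq[OF m]) (simp add: R(3))
  ultimately show "(\<integral>x. v x * partial_deriv i \<psi> x \<partial>lebesgue_on S) = - (\<integral>x. partial_deriv i v x * \<psi> x \<partial>lebesgue_on S)"
    using integration_by_parts[OF v(1) R(1,2) i] by simp
qed

lemma L2_tendsto_const: "f \<in> L2 M \<Longrightarrow> L2_tendsto M (\<lambda>_. f) f"
  by (simp add: L2_tendsto_def)

text \<open>The constant sequence \<open>v\<close> serves as approximation; finite surface measure
  of the ball makes the boundary values square integrable.\<close>

lemma smooth_has_trace: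
  fixes v :: "'a::euclidean_space \<Rightarrow> complex"
  assumes S: "open S" and v: "smooth v" "\<And>y. y \<notin> ball z R \<Longrightarrow> v y = 0"
    and fin: "emeasure (surface_measure S) (frontier S \<inter> ball z R) < \<infinity>"
  shows "has_trace S v v"
proof -
  have v': "v y = 0" if "y \<notin> cball z R" for y using v(2) that by auto
  note grad = smooth_H1_gradient[OF S v(1) v']
  obtain B where B: "\<And>y. cmod (v y) \<le> B" using smooth_bounded[OF v(1) v'] by blast
  have fb: "frontier S \<inter> space (hausdorff_measure (DIM('a) - 1)) \<in> sets (hausdorff_measure (DIM('a) - 1) :: 'a measure)"
    by (simp add: sets_hausdorff_measure space_hausdorff_measure)
  have "v \<in> borel_measurable (hausdorff_measure (DIM('a) - 1))"
    using smooth_measurable[OF v(1)] measurable_cong_sets[OF sets_hausdorff_measure refl] by blast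
  then have m: "v \<in> borel_measurable (surface_measure S)"
    unfolding surface_measure_def by (rule measurable_restrict_space1)
  have sp: "space (surface_measure S) = frontier S"
    by (simp add: surface_measure_def space_restrict_space space_hausdorff_measure)
  have "integrable (surface_measure S) (\<lambda>x. (cmod (v x))\<^sup>2)"
  proof (rule integrableI_bounded_set[where A="frontier S \<inter> ball z R" and B="B\<^sup>2"])
    show "frontier S \<inter> ball z R \<in> sets (surface_measure S)"
      unfolding surface_measure_def using fb by (auto simp: sets_restrict_space_iff sets_hausdorff_measure)
    show "(\<lambda>x. (cmod (v x))\<^sup>2) \<in> borel_measurable (surface_measure S)" using m by measurable
    show "AE x in surface_measure S. x \<in> frontier S \<inter> ball z R \<longrightarrow> norm ((cmod (v x))\<^sup>2) \<le> B\<^sup>2"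
      using B by (simp add: power_mono)
    show "AE x in surface_measure S. x \<notin> frontier S \<inter> ball z R \<longrightarrow> (cmod (v x))\<^sup>2 = 0"
      by (rule AE_I2) (use v(2) sp in auto)
  qed (use fin in simp)
  then have L2s: "v \<in> L2 (surface_measure S)" using m by (simp add: L2_def)
  have "H1_tendsto S (\<lambda>_. v) v"
    unfolding H1_tendsto_def
  proof (intro conjI exI[of _ "\<lambda>_ i. partial_deriv i v"] exI[of _ "\<lambda>i. partial_deriv i v"] allI ballI)
    show "L2_tendsto (lebesgue_on S) (\<lambda>_. v) v" by (rule L2_tendsto_const[OF smooth_L2[OF S v(1) v']])
    show "L2_tendsto (lebesgue_on S) (\<lambda>_. partial_deriv i v) (partial_deriv i v)" if "i \<in> Basis" for i
      using grad that by (intro L2_tendsto_const) (simp add: H1_gradient_def)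
    show "H1_gradient S v (\<lambda>i. partial_deriv i v)" by (rule grad)
    show "H1_gradient S v (\<lambda>i. partial_deriv i v)" by (rule grad)
  qed
  moreover have "v \<in> H1 S" using grad by (auto simp: H1_def)
  ultimately show ?thesis
    unfolding has_trace_def using L2_tendsto_const[OF L2s] smooth_continuous_on[OF v(1)]
    by (intro exI[of _ "\<lambda>_. v"]) auto
qed

text \<open>The gradient and the Laplacian supplied by \<open>has_normal_derivative\<close> are
  arbitrary representatives. As \<open>u = c * v\<close> in \<open>\<Omega>\<close> near
  \<open>z\<close>, those of \<open>c * v\<close> may replace them in integrals against
  \<open>p\<close> and its derivatives, which live near \<open>z\<close> but may be nonzero on the
  boundary.\<close>

lemma normal_derivative_smooth_test:
  fixes \<Omega> :: "'a::euclidean_space set"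
  assumes \<Omega>: "open \<Omega>" "bounded \<Omega>"
    and nd: "has_normal_derivative \<Omega> u b" and lap: "distributional_laplacian \<Omega> u w'"
    and v: "smooth v" "\<And>y. y \<notin> cball a \<sigma> \<Longrightarrow> v y = 0"
    and uv: "\<And>y. y \<in> \<Omega> \<inter> ball z R \<Longrightarrow> u y = c * v y"
    and wv: "\<And>y. y \<in> \<Omega> \<inter> ball z R \<Longrightarrow> w' y = c * laplacian v y"
    and p: "smooth p" "\<And>y. y \<notin> cball z \<rho> \<Longrightarrow> p y = 0" and \<rho>: "\<rho> < R"
    and real: "\<And>y. cnj (p y) = p y" "\<And>i y. cnj (partial_deriv i p y) = partial_deriv i p y"
    and fin: "emeasure (surface_measure \<Omega>) (frontier \<Omega> \<inter> ball z R) < \<infinity>"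
  shows "(\<integral>y. b y * p y \<partial>surface_measure \<Omega>) =
    c * ((\<Sum>i\<in>Basis. \<integral>y. restr \<Omega> (partial_deriv i v) y * partial_deriv i p y \<partial>lebesgue) +
      (\<integral>y. restr \<Omega> (laplacian v) y * p y \<partial>lebesgue))"
proof -
  let ?O = "\<Omega> \<inter> ball z R"
  have oO: "open ?O" using \<Omega>(1) by auto
  have m: "\<Omega> \<in> sets lebesgue" using \<Omega>(1) by simp
  obtain Gu w where Gu: "H1_gradient \<Omega> u Gu" and w: "distributional_laplacian \<Omega> u w"
    and green: "\<And>v Gv t. H1_gradient \<Omega> v Gv \<Longrightarrow> has_trace \<Omega> v t \<Longrightarrow>
      (\<integral>x. (\<Sum>i\<in>Basis. Gu i x * cnj (Gv i x)) + w x * cnj (v x) \<partial>lebesgue_on \<Omega>) =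
      (\<integral>x. b x * cnj (t x) \<partial>surface_measure \<Omega>)"
    using nd unfolding has_normal_derivative_def by blast
  have pb: "p y = 0" if "y \<notin> ball z R" for y using p(2) that \<rho> by auto
  have replace: "integrable lebesgue (\<lambda>y. restr \<Omega> F y * q y) \<and>
      (\<integral>y. restr \<Omega> F y * q y \<partial>lebesgue) = c * (\<integral>y. restr \<Omega> f y * q y \<partial>lebesgue)"
    if F: "F \<in> L2 (lebesgue_on \<Omega>)" and f: "smooth f" "\<And>y. y \<notin> cball a \<sigma> \<Longrightarrow> f y = 0"
      and q: "smooth q" "\<And>y. y \<notin> cball z \<rho> \<Longrightarrow> q y = 0"
      and weak: "\<And>\<psi>. \<psi> \<in> test_functions ?O \<Longrightarrow>
        (\<integral>y. restr \<Omega> F y * \<psi> y \<partial>lebesgue) = c * (\<integral>y. f y * \<psi> y \<partial>lebesgue)" for F f q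
  proof -
    have iF: "integrable lebesgue (restr \<Omega> F)" using L2_integrable[OF \<Omega> F] restr_integrable_iff[OF \<Omega>(1)] by blast
    have iff: "integrable lebesgue (restr \<Omega> f)"
      using integrable_lebesgue_onI[OF \<Omega>(1) smooth_integrable[OF f]] restr_integrable_iff[OF \<Omega>(1)] by blast
    \<comment> \<open>\<open>k\<close> vanishes weakly on the part of \<open>\<Omega>\<close> near
      \<open>z\<close>, and \<open>weak_zero_extends\<close> lets it be tested with \<open>q\<close>
      up to the boundary.\<close>
    define k where "k y = restr \<Omega> F y - c * restr \<Omega> f y" for y
    have ik: "integrable lebesgue k" unfolding k_def[abs_def] using iF iff by simp
    obtain Bq where Bq: "\<And>y. cmod (q y) \<le> Bq" using smooth_bounded[OF q] by blast
    have mult: "integrable lebesgue (\<lambda>y. g y * s y)"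
      if "integrable lebesgue g" "smooth s" "\<And>y. cmod (s y) \<le> B" for g s B
      by (rule integrable_mult_bounded[OF that(1) smooth_measurable_lebesgue[OF that(2)] that(3)])
    have "(\<integral>y. restr ?O k y * q y \<partial>lebesgue) = 0"
    proof (rule weak_zero_extends[OF oO ik _ q(1) Bq])
      fix \<psi> assume psi: "\<psi> \<in> test_functions ?O"
      obtain S where S: "smooth \<psi>" "\<And>x. x \<notin> cball 0 S \<Longrightarrow> \<psi> x = 0" "\<And>x. x \<notin> ?O \<Longrightarrow> \<psi> x = 0"
        by (rule test_functionE[OF psi]) (rule that)
      obtain B where B: "\<And>y. cmod (\<psi> y) \<le> B" using smooth_bounded[OF S(1,2)] by blast
      have "(\<integral>y. k y * \<psi> y \<partial>lebesgue) = (\<integral>y. restr \<Omega> F y * \<psi> y - c * (restr \<Omega> f y * \<psi> y) \<partial>lebesgue)"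
        by (intro Bochner_Integration.integral_cong refl) (simp add: k_def algebra_simps)
      also have "\<dots> = (\<integral>y. restr \<Omega> F y * \<psi> y \<partial>lebesgue) - c * (\<integral>y. restr \<Omega> f y * \<psi> y \<partial>lebesgue)"
        using mult[OF iF S(1) B] mult[OF iff S(1) B] by simp
      also have "(\<integral>y. restr \<Omega> f y * \<psi> y \<partial>lebesgue) = (\<integral>y. f y * \<psi> y \<partial>lebesgue)"
        by (intro Bochner_Integration.integral_cong refl) (use S(3) in \<open>auto simp: restr_def\<close>)
      finally show "(\<integral>y. k y * \<psi> y \<partial>lebesgue) = 0" using weak[OF psi] by simp
    qed
    moreover have "restr ?O k y * q y = restr \<Omega> F y * q y - c * (restr \<Omega> f y * q y)" for y
      using q(2)[of y] \<rho> by (cases "y \<in> cball z \<rho>") (auto simp: restr_def k_def algebra_simps)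
    ultimately have "(\<integral>y. restr \<Omega> F y * q y - c * (restr \<Omega> f y * q y) \<partial>lebesgue) = 0" by simp
    then show ?thesis using mult[OF iF q(1) Bq] mult[OF iff q(1) Bq] by simp
  qed
  have tO: "\<psi> \<in> test_functions \<Omega>" if "\<psi> \<in> test_functions ?O" for \<psi>
    using that test_functions_mono[of ?O \<Omega>] by blast
  have gr: "integrable lebesgue (\<lambda>y. restr \<Omega> (Gu i) y * partial_deriv i p y) \<and>
      (\<integral>y. restr \<Omega> (Gu i) y * partial_deriv i p y \<partial>lebesgue) =
      c * (\<integral>y. restr \<Omega> (partial_deriv i v) y * partial_deriv i p y \<partial>lebesgue)" if i: "i \<in> Basis" for i
  proof (rule replace)
    show "Gu i \<in> L2 (lebesgue_on \<Omega>)" using Gu i by (simp add: H1_gradient_def)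
    show "smooth (partial_deriv i v)" "smooth (partial_deriv i p)" by (intro smooth_partial v(1) p(1) i)+
    show "\<And>y. y \<notin> cball a \<sigma> \<Longrightarrow> partial_deriv i v y = 0" by (rule partial_deriv_outside[of a \<sigma> v, OF v(2)])
    show "\<And>y. y \<notin> cball z \<rho> \<Longrightarrow> partial_deriv i p y = 0" by (rule partial_deriv_outside[of z \<rho> p, OF p(2)])
    fix \<psi> assume psi: "\<psi> \<in> test_functions ?O"
    obtain S where S: "smooth \<psi>" "\<And>x. x \<notin> cball 0 S \<Longrightarrow> \<psi> x = 0" "\<And>x. x \<notin> ?O \<Longrightarrow> \<psi> x = 0"
      "\<And>x i. x \<notin> ?O \<Longrightarrow> partial_deriv i \<psi> x = 0"
      by (rule test_functionE[OF psi]) (rule that)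
    have "(\<integral>y. restr \<Omega> (Gu i) y * \<psi> y \<partial>lebesgue) = (\<integral>y. Gu i y * \<psi> y \<partial>lebesgue_on \<Omega>)"
      by (rule integral_lebesgue_on_eq[OF m, symmetric]) (simp add: restr_def)
    also have "\<dots> = - (\<integral>y. u y * partial_deriv i \<psi> y \<partial>lebesgue_on \<Omega>)"
      using Gu i tO[OF psi] by (simp add: H1_gradient_def)
    also have "(\<integral>y. u y * partial_deriv i \<psi> y \<partial>lebesgue_on \<Omega>) = (\<integral>y. c * (v y * partial_deriv i \<psi> y) \<partial>lebesgue)"
    proof (rule integral_lebesgue_on_eq[OF m])
      fix y show "c * (v y * partial_deriv i \<psi> y) = (if y \<in> \<Omega> then u y * partial_deriv i \<psi> y else 0)"
        using uv[of y] S(4)[of y i] by (cases "y \<in> ?O") auto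
    qed
    also have "\<dots> = - (c * (\<integral>y. partial_deriv i v y * \<psi> y \<partial>lebesgue))"
      using integration_by_parts[OF v(1) S(1,2) i] by simp
    finally show "(\<integral>y. restr \<Omega> (Gu i) y * \<psi> y \<partial>lebesgue) = c * (\<integral>y. partial_deriv i v y * \<psi> y \<partial>lebesgue)" by simp
  qed
  have wr: "integrable lebesgue (\<lambda>y. restr \<Omega> w y * p y) \<and>
      (\<integral>y. restr \<Omega> w y * p y \<partial>lebesgue) = c * (\<integral>y. restr \<Omega> (laplacian v) y * p y \<partial>lebesgue)"
  proof (rule replace)
    show "w \<in> L2 (lebesgue_on \<Omega>)" using w by (simp add: distributional_laplacian_def)
    show "smooth (laplacian v)" by (rule smooth_laplacian[OF v(1)])
    show "\<And>y. y \<notin> cball a \<sigma> \<Longrightarrow> laplacian v y = 0" by (rule laplacian_outside[of a \<sigma> v, OF v(2)])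
    fix \<psi> assume psi: "\<psi> \<in> test_functions ?O"
    obtain S where S: "\<And>x. x \<notin> ?O \<Longrightarrow> \<psi> x = 0"
      by (rule test_functionE[OF psi]) (rule that)
    have "(\<integral>y. restr \<Omega> w y * \<psi> y \<partial>lebesgue) = (\<integral>y. w y * \<psi> y \<partial>lebesgue_on \<Omega>)"
      by (rule integral_lebesgue_on_eq[OF m, symmetric]) (simp add: restr_def)
    also have "\<dots> = (\<integral>y. w' y * \<psi> y \<partial>lebesgue_on \<Omega>)"
      using w lap tO[OF psi] by (simp add: distributional_laplacian_def)
    also have "\<dots> = (\<integral>y. c * (laplacian v y * \<psi> y) \<partial>lebesgue)"
    proof (rule integral_lebesgue_on_eq[OF m])
      fix y show "c * (laplacian v y * \<psi> y) = (if y \<in> \<Omega> then w' y * \<psi> y else 0)"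
        using wv[of y] S[of y] by (cases "y \<in> ?O") auto
    qed
    finally show "(\<integral>y. restr \<Omega> w y * \<psi> y \<partial>lebesgue) = c * (\<integral>y. laplacian v y * \<psi> y \<partial>lebesgue)" by simp
  qed (rule p)+
  have "(\<integral>y. b y * p y \<partial>surface_measure \<Omega>) =
      (\<integral>x. (\<Sum>i\<in>Basis. Gu i x * partial_deriv i p x) + w x * p x \<partial>lebesgue_on \<Omega>)"
    using green[OF smooth_H1_gradient[OF \<Omega>(1) p] smooth_has_trace[OF \<Omega>(1) p(1) pb fin]] by (simp add: real)
  also have "\<dots> = (\<integral>y. (\<Sum>i\<in>Basis. restr \<Omega> (Gu i) y * partial_deriv i p y) + restr \<Omega> w y * p y \<partial>lebesgue)"
    by (rule integral_lebesgue_on_eq[OF m]) (simp add: restr_def)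
  also have "\<dots> = (\<Sum>i\<in>Basis. \<integral>y. restr \<Omega> (Gu i) y * partial_deriv i p y \<partial>lebesgue) + (\<integral>y. restr \<Omega> w y * p y \<partial>lebesgue)"
    using gr wr by (subst Bochner_Integration.integral_add) (auto intro!: Bochner_Integration.integrable_sum)
  also have "\<dots> = c * ((\<Sum>i\<in>Basis. \<integral>y. restr \<Omega> (partial_deriv i v) y * partial_deriv i p y \<partial>lebesgue) +
      (\<integral>y. restr \<Omega> (laplacian v) y * p y \<partial>lebesgue))"
    using gr wr by (simp add: sum_distrib_left distrib_left)
  finally show ?thesis .
qed

lemma radial_isometry:
  assumes "is_isometry T" shows "radial g r (T x) (T y) = radial g r x y"
  using assms by (simp add: radial_def is_isometry_def dist_norm[symmetric])

lemma laplacian_radial_isometry: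
  fixes T :: "'a::euclidean_space \<Rightarrow> 'a"
  assumes T: "is_isometry T" and g: "smooth g" and r: "r \<noteq> 0"
  shows "laplacian (radial g r (T x)) (T y) = laplacian (radial g r x) y"
proof -
  obtain g' where g': "\<And>s. (g has_real_derivative g' s) (at s)" "smooth g'" using smooth_realE[OF g] by metis
  obtain g'' where g'': "\<And>s. (g' has_real_derivative g'' s) (at s)" using smooth_realE[OF g'(2)] by metis
  show ?thesis unfolding laplacian_radial[OF g'(1) g'' r] radial_isometry[OF T] ..
qed

lemma cnj_radial: "cnj (radial g r x y) = radial g r x y"
  by (simp add: radial_def)

lemma cnj_partial_deriv_radial:
  assumes "smooth g" shows "cnj (partial_deriv i (radial g r x) y) = partial_deriv i (radial g r x) y"
proof -
  obtain g' where "\<And>s. (g has_real_derivative g' s) (at s)" using smooth_realE[OF assms] by metis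
  from partial_deriv_radial[OF this, of i r x y] show ?thesis by (simp add: cnj_radial)
qed

text \<open>
  In the boundary integral two radial bumps \<open>v\<close>, \<open>p\<close> enter symmetrically, so the same holds for the volume side.
  Taking \<open>p = 1\<close> near \<open>z\<close> leaves \<open>\<integral>\<^sub>\<Omega> laplacian v = 0\<close> for all small \<open>v\<close>: the radial means of the indicator of \<open>\<Omega>\<^sub>2\<close> do
  not depend on the radius. They are continuous in the centre but take different values inside and outside \<open>\<Omega>\<^sub>2\<close>.
\<close>

lemma no_interior_contact:
  fixes \<Omega>\<^sub>1 \<Omega>\<^sub>2 :: "'a::euclidean_space set"
  assumes o1: "open \<Omega>\<^sub>1" and o2: "open \<Omega>\<^sub>2" "bounded \<Omega>\<^sub>2" and lip: "lipschitz_boundary \<Omega>\<^sub>2"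
    and z: "z \<in> frontier \<Omega>\<^sub>2" and T: "is_isometry T" "T z \<in> \<Omega>\<^sub>1" and c: "c \<noteq> 0"
    and N: "open N" "z \<in> N"
    and U: "\<And>f y. f \<in> C (closure \<Omega>\<^sub>1) \<Longrightarrow> y \<in> closure \<Omega>\<^sub>2 \<inter> N \<Longrightarrow> U f y = c * f (T y)"
    and dom: "U ` test_functions \<Omega>\<^sub>1 \<subseteq> robin_domain \<Omega>\<^sub>2 \<beta>"
    and lap: "\<forall>f\<in>test_functions \<Omega>\<^sub>1. distributional_laplacian \<Omega>\<^sub>2 (U f) (U (laplacian f))"
  shows False
proof -
  obtain R1 where R1: "R1 > 0" "emeasure (surface_measure \<Omega>\<^sub>2) (frontier \<Omega>\<^sub>2 \<inter> ball z R1) < \<infinity>"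
    by (rule surface_measure_finite[OF lip z]) (rule that)
  obtain R2 where R2: "R2 > 0" "ball z R2 \<subseteq> N" using N open_contains_ball by metis
  obtain R3 where R3: "R3 > 0" "ball (T z) R3 \<subseteq> \<Omega>\<^sub>1" using o1 T(2) open_contains_ball by metis
  define R where "R = min R1 (min R2 R3)"
  have R: "R > 0" "ball z R \<subseteq> N" "ball (T z) R \<subseteq> \<Omega>\<^sub>1"
    using R1 R2 R3 by (auto simp: R_def subset_iff)
  have Td: "dist (T x) (T y) = dist x y" for x y using T(1) by (simp add: is_isometry_def)
  have fin: "emeasure (surface_measure \<Omega>\<^sub>2) (frontier \<Omega>\<^sub>2 \<inter> ball z R) < \<infinity>"
  proof -
    have "frontier \<Omega>\<^sub>2 \<inter> ball z R1 \<in> sets (surface_measure \<Omega>\<^sub>2)"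
      unfolding surface_measure_def by (auto simp: sets_restrict_space_iff sets_hausdorff_measure space_hausdorff_measure)
    then have "emeasure (surface_measure \<Omega>\<^sub>2) (frontier \<Omega>\<^sub>2 \<inter> ball z R) \<le> emeasure (surface_measure \<Omega>\<^sub>2) (frontier \<Omega>\<^sub>2 \<inter> ball z R1)"
      by (intro emeasure_mono) (auto simp: R_def)
    then show ?thesis using R1(2) by (rule le_less_trans)
  qed
  \<comment> \<open>The cut-off of this radius is \<open>1\<close> within \<open>R / 2\<close> of
    \<open>z\<close>, because \<open>4 / 9\<close> lies below \<open>1 / 2\<close>; bumps of radius
    below \<open>R / 4\<close> centred within \<open>R / 4\<close> of \<open>z\<close> stay in that
    region.\<close>
  define \<rho> where "\<rho> = 3 * R / 4"
  have \<rho>: "\<rho> < R" "\<rho> > 0" using R(1) by (auto simp: \<rho>_def)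
  have bdy: "(\<integral>y. (- complex_of_real (\<beta> y) * (c * radial g r x y)) * radial g' r' x' y \<partial>surface_measure \<Omega>\<^sub>2) =
      c * ((\<Sum>i\<in>Basis. \<integral>y. restr \<Omega>\<^sub>2 (partial_deriv i (radial g r x)) y * partial_deriv i (radial g' r' x') y \<partial>lebesgue) +
      (\<integral>y. restr \<Omega>\<^sub>2 (laplacian (radial g r x)) y * radial g' r' x' y \<partial>lebesgue))"
    if g: "radial_profile g" "r > 0" "cball x r \<subseteq> cball z \<rho>"
      and g': "radial_profile g'" "r' > 0" "cball x' r' \<subseteq> cball z \<rho>" for g r x g' r' x'
  proof -
    let ?v = "radial g r x" and ?p = "radial g' r' x'" and ?f = "radial g r (T x)"
    have sg: "smooth g" "smooth g'" using g(1) g'(1) by (auto simp: radial_profile_def)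
    have "cball (T x) r \<subseteq> \<Omega>\<^sub>1"
    proof
      fix y assume y: "y \<in> cball (T x) r"
      obtain S where S: "\<And>x. T (S x) = x" using isometry_inverse[OF T(1)] by metis
      have "S y \<in> cball x r" using y Td[of x "S y"] S[of y] by simp
      then have "S y \<in> cball z \<rho>" using g(3) by blast
      then have "y \<in> ball (T z) R" using Td[of z "S y"] S[of y] \<rho>(1) by simp
      then show "y \<in> \<Omega>\<^sub>1" using R(3) by blast
    qed
    then have f: "?f \<in> test_functions \<Omega>\<^sub>1" by (rule radial_test_function[OF g(1,2)])
    have sf: "smooth ?f" by (rule smooth_radial[OF sg(1)])
    have C: "?f \<in> C (closure \<Omega>\<^sub>1)" "laplacian ?f \<in> C (closure \<Omega>\<^sub>1)"
      unfolding C_def using smooth_continuous_on[OF sf] smooth_continuous_on[OF smooth_laplacian[OF sf]] by auto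
    have Uf: "U ?f y = c * ?v y" if "y \<in> closure \<Omega>\<^sub>2 \<inter> ball z R" for y
      using U[OF C(1), of y] that R(2) by (auto simp: radial_isometry[OF T(1)])
    have pz: "?p y = 0" if "y \<notin> cball z \<rho>" for y
      using that g'(3) radial_outside[of g' r' x' y] g'(1,2) by (force simp: radial_profile_def)
    have "has_normal_derivative \<Omega>\<^sub>2 (U ?f) (\<lambda>y. - complex_of_real (\<beta> y) * U ?f y)"
      using dom f by (auto simp: robin_domain_def)
    then have main: "(\<integral>y. - complex_of_real (\<beta> y) * U ?f y * ?p y \<partial>surface_measure \<Omega>\<^sub>2) =
      c * ((\<Sum>i\<in>Basis. \<integral>y. restr \<Omega>\<^sub>2 (partial_deriv i ?v) y * partial_deriv i ?p y \<partial>lebesgue) +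
      (\<integral>y. restr \<Omega>\<^sub>2 (laplacian ?v) y * ?p y \<partial>lebesgue))"
    proof (rule normal_derivative_smooth_test[OF o2 _ bspec[OF lap f], where R=R and \<rho>=\<rho> and z=z and a=x and \<sigma>=r])
      show "\<And>y. y \<notin> cball x r \<Longrightarrow> ?v y = 0"
        using radial_outside[of g r x] g(1,2) by (force simp: radial_profile_def)
      show "U ?f y = c * ?v y" if "y \<in> \<Omega>\<^sub>2 \<inter> ball z R" for y
        using Uf[of y] that closure_subset by blast
      show "U (laplacian ?f) y = c * laplacian ?v y" if "y \<in> \<Omega>\<^sub>2 \<inter> ball z R" for y
      proof -
        have "y \<in> closure \<Omega>\<^sub>2 \<inter> N" using that R(2) closure_subset by blast
        then show ?thesis using U[OF C(2)] laplacian_radial_isometry[OF T(1) sg(1)] g(2) by simp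
      qed
    qed (use pz \<rho> fin sg smooth_radial in \<open>auto simp: cnj_radial cnj_partial_deriv_radial\<close>)
    \<comment> \<open>The formula for \<open>U ?f\<close> is known only on the closure of the
      domain; surface measure lives on its frontier.\<close>
    have e: "- complex_of_real (\<beta> y) * U ?f y * ?p y = (- complex_of_real (\<beta> y) * (c * ?v y)) * ?p y"
      if "y \<in> space (surface_measure \<Omega>\<^sub>2)" for y
    proof (cases "y \<in> cball z \<rho>")
      case True
      have "y \<in> frontier \<Omega>\<^sub>2" using that by (simp add: surface_measure_def space_restrict_space)
      then have "y \<in> closure \<Omega>\<^sub>2 \<inter> ball z R" using True \<rho>(1) by (auto simp: frontier_def)
      then show ?thesis by (simp add: Uf)
    qed (simp add: pz)
    from trans[OF sym[OF Bochner_Integration.integral_cong[OF refl e]] main] show ?thesis .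
  qed
  obtain \<eta> where \<eta>: "radial_profile \<eta>" "\<And>s. s \<le> 1 / 2 \<Longrightarrow> \<eta> s = 1"
    by (rule cutoff_profile) (rule that)
  have harmonic: "(\<integral>y. restr \<Omega>\<^sub>2 (\<lambda>_. 1) y * laplacian (radial g r x) y \<partial>lebesgue) = 0"
    if g: "radial_profile g" and r: "0 < r" "r < R / 4" and x: "dist z x < R / 4" for g r x
  proof -
    have near: "dist z y < R / 2" if "dist x y \<le> r" for y
      using dist_triangle[of z y x] that r x by linarith
    have sub: "cball x r \<subseteq> cball z \<rho>" using near R(1) by (force simp: \<rho>_def)
    let ?v = "radial g r x" and ?p = "radial \<eta> \<rho> z"
    have p1: "?p y = 1" if "dist z y < R / 2" for y
    proof -
      have "(norm (y - z))\<^sup>2 \<le> (R / 2)\<^sup>2" using that by (intro power_mono) (auto simp: dist_norm norm_minus_commute)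
      moreover have "\<rho>\<^sup>2 = 9 / 16 * R\<^sup>2" "0 < R\<^sup>2"
        using R(1) by (simp_all add: \<rho>_def power2_eq_square)
      moreover have "(R / 2)\<^sup>2 = R\<^sup>2 / 4" by (simp add: power2_eq_square)
      ultimately have "(norm (y - z))\<^sup>2 \<le> 1 / 2 * \<rho>\<^sup>2" by linarith
      then have "(norm (y - z))\<^sup>2 / \<rho>\<^sup>2 \<le> 1 / 2"
        using \<rho>(2) by (simp add: divide_le_eq)
      from \<eta>(2)[OF this] show ?thesis by (simp add: radial_def)
    qed
    have lp: "laplacian ?p y = 0" if "dist z y < R / 2" for y
      using laplacian_cong_open[of "ball z (R / 2)" y ?p "\<lambda>_. 1"] that p1
      by (simp add: laplacian_def partial_deriv_const[abs_def])
    have v0: "?v y = 0" if "dist x y > r" for y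
      using radial_outside[of g r x y] g r(1) that by (simp add: radial_profile_def)
    have l0: "laplacian ?v y = 0" if "dist x y > r" for y
      by (rule laplacian_outside[of x r ?v]) (use v0 that in auto)
    have cb: "cball z \<rho> \<subseteq> cball z \<rho>" by simp
    have "(\<Sum>i\<in>Basis. \<integral>y. restr \<Omega>\<^sub>2 (partial_deriv i ?v) y * partial_deriv i ?p y \<partial>lebesgue) +
        (\<integral>y. restr \<Omega>\<^sub>2 (laplacian ?v) y * ?p y \<partial>lebesgue) =
      (\<Sum>i\<in>Basis. \<integral>y. restr \<Omega>\<^sub>2 (partial_deriv i ?p) y * partial_deriv i ?v y \<partial>lebesgue) +
        (\<integral>y. restr \<Omega>\<^sub>2 (laplacian ?p) y * ?v y \<partial>lebesgue)"
    proof -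
      have e: "(- complex_of_real (\<beta> y) * (c * ?v y)) * ?p y = (- complex_of_real (\<beta> y) * (c * ?p y)) * ?v y" for y
        by (simp add: mult_ac)
      have "c * ((\<Sum>i\<in>Basis. \<integral>y. restr \<Omega>\<^sub>2 (partial_deriv i ?v) y * partial_deriv i ?p y \<partial>lebesgue) +
          (\<integral>y. restr \<Omega>\<^sub>2 (laplacian ?v) y * ?p y \<partial>lebesgue)) =
        c * ((\<Sum>i\<in>Basis. \<integral>y. restr \<Omega>\<^sub>2 (partial_deriv i ?p) y * partial_deriv i ?v y \<partial>lebesgue) +
          (\<integral>y. restr \<Omega>\<^sub>2 (laplacian ?p) y * ?v y \<partial>lebesgue))"
        unfolding bdy[OF g r(1) sub \<eta>(1) \<rho>(2) cb, symmetric] bdy[OF \<eta>(1) \<rho>(2) cb g r(1) sub, symmetric] e ..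
      then show ?thesis using c by simp
    qed
    moreover have "restr \<Omega>\<^sub>2 (partial_deriv i ?v) y * partial_deriv i ?p y = restr \<Omega>\<^sub>2 (partial_deriv i ?p) y * partial_deriv i ?v y" for i y
      by (simp add: restr_def)
    ultimately have "(\<integral>y. restr \<Omega>\<^sub>2 (laplacian ?v) y * ?p y \<partial>lebesgue) = (\<integral>y. restr \<Omega>\<^sub>2 (laplacian ?p) y * ?v y \<partial>lebesgue)"
      by simp
    \<comment> \<open>On the support of the small bump the large one is \<open>1\<close> and has
      vanishing Laplacian; the gradient terms have already cancelled by symmetry.\<close>
    moreover have "restr \<Omega>\<^sub>2 (laplacian ?v) y * ?p y = restr \<Omega>\<^sub>2 (\<lambda>_. 1) y * laplacian ?v y" for y
      using p1[OF near, of y] l0[of y] by (cases "dist x y \<le> r") (auto simp: restr_def)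
    moreover have "restr \<Omega>\<^sub>2 (laplacian ?p) y * ?v y = 0" for y
      using lp[OF near, of y] v0[of y] by (cases "dist x y \<le> r") (auto simp: restr_def)
    ultimately show ?thesis by simp
  qed
  define G where "G s = flat_exp 0 (1 - s)" for s
  have G: "radial_profile G" unfolding G_def[abs_def] by (rule radial_profile_flat)
  obtain H where H: "radial_profile H" "\<And>s. (H has_real_derivative - G s / 2) (at s)"
    using radial_profile_tail[OF G] by blast
  have const: "(\<integral>y. u y * mollifier G r x y \<partial>lebesgue) = (\<integral>y. u y * mollifier G s x y \<partial>lebesgue)"
    if u: "integrable lebesgue u" and z: "\<And>r. 0 < r \<Longrightarrow> r < R / 4 \<Longrightarrow> (\<integral>y. u y * laplacian (radial H r x) y \<partial>lebesgue) = 0"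
      and r: "0 < r" "r < R / 4" and s: "0 < s" "s < R / 4" for u r s and x :: 'a
  proof -
    have "\<exists>c. \<forall>t\<in>{0<..<R / 4}. (\<integral>y. u y * mollifier G t x y \<partial>lebesgue) = c"
    proof (rule has_derivative_zero_constant)
      fix t assume t: "t \<in> {0<..<R / 4}"
      have "((\<lambda>r. \<integral>y. u y * mollifier G r x y \<partial>lebesgue) has_vector_derivative
        of_real t * (\<integral>y. (\<lambda>_. 0) y * mollifier H t x y \<partial>lebesgue)) (at t)"
        by (rule mean_value_deriv[OF u _ _ G H]) (use t z in auto)
      then show "((\<lambda>t. \<integral>y. u y * mollifier G t x y \<partial>lebesgue) has_derivative (\<lambda>h. 0)) (at t within {0<..<R / 4})"
        by (auto simp: has_vector_derivative_def intro: has_derivative_at_withinI)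
    qed auto
    then obtain c where "\<And>t. t \<in> {0<..<R / 4} \<Longrightarrow> (\<integral>y. u y * mollifier G t x y \<partial>lebesgue) = c" by blast
    then show ?thesis using r s by simp
  qed
  define I where "I r x = (\<integral>y. restr \<Omega>\<^sub>2 (\<lambda>_. 1) y * mollifier G r x y \<partial>lebesgue)" for r x
  have i1: "integrable lebesgue (restr \<Omega>\<^sub>2 (\<lambda>_. 1))"
  proof -
    obtain Q where Q: "\<Omega>\<^sub>2 \<subseteq> cball 0 Q" using o2(2) by (auto simp: bounded_iff subset_iff)
    show ?thesis
    proof (rule integrable_lebesgue_bounded_support[where B=1 and c=0 and R=Q])
      have "(\<lambda>x. indicator \<Omega>\<^sub>2 x :: complex) \<in> borel_measurable lebesgue" using o2(1) by (intro borel_measurable_indicator) simp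
      then show "restr \<Omega>\<^sub>2 (\<lambda>_. 1) \<in> borel_measurable lebesgue"
        by (simp add: restr_def[abs_def] indicator_def[abs_def] of_bool_def)
    qed (use Q in \<open>auto simp: restr_def\<close>)
  qed
  define q where "q = R / 8"
  have q: "0 < q" "q < R / 4" using R(1) by (auto simp: q_def)
  define P where "P = (\<integral>y. mollifier G q (0::'a) y \<partial>lebesgue)"
  have P0: "P \<noteq> 0" unfolding P_def G_def[abs_def] by (rule integral_flat_mollifier_nonzero[OF q(1)])
  \<comment> \<open>The mass of the kernel does not depend on the radius: \<open>const\<close>
    applies to the constant \<open>1\<close> on a ball, which is weakly harmonic there by
    \<open>weak_norm_power\<close> with exponent \<open>0\<close>.\<close>
  have Pr: "(\<integral>y. mollifier G r x y \<partial>lebesgue) = P" if r: "0 < r" "r < R / 4" for r and x :: 'a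
  proof -
    let ?u = "restr (ball x R) (\<lambda>_. 1 :: complex)"
    have u: "integrable lebesgue ?u" by (intro restr_continuous_integrable continuous_intros)
    have e: "?u y * mollifier G r x y = mollifier G r x y" if "0 < r" "r < R / 4" for r y
      using mollifier_outside[OF G that(1), of y x] that(2) R(1) by (cases "y \<in> cball x r") (auto simp: restr_def)
    have "(\<integral>y. ?u y * mollifier G r x y \<partial>lebesgue) = (\<integral>y. ?u y * mollifier G q x y \<partial>lebesgue)"
    proof (rule const[OF u _ r q])
      fix r assume "0 < r" "r < R / 4"
      then have "radial H r x \<in> test_functions (ball x R)" by (intro radial_test_function[OF H(1)]) auto
      from weak_norm_power[OF this, of 0 x] show "(\<integral>y. ?u y * laplacian (radial H r x) y \<partial>lebesgue) = 0"
        by (simp add: eigen_factor_def radial_def[of "\<lambda>s. 1", abs_def])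
    qed
    then show ?thesis
      unfolding e[OF r] e[OF q] P_def integral_mollifier_translate[OF G, of q x] .
  qed
  have Iconst: "I r x = I q x" if "0 < r" "r < R / 4" "dist z x < R / 4" for r x
    unfolding I_def by (rule const[OF i1 harmonic[OF H(1)]]) (use that q in auto)
  have small: "\<exists>r. 0 < r \<and> r < R / 4 \<and> cball x r \<subseteq> A" if "open A" "x \<in> A" for A and x :: 'a
  proof -
    obtain e where e: "e > 0" "cball x e \<subseteq> A" using \<open>open A\<close> \<open>x \<in> A\<close> open_contains_cball by metis
    show ?thesis using e R(1) by (intro exI[of _ "min e (R / 8)"]) (auto simp: subset_iff)
  qed
  have inside: "I q x = P" if x: "x \<in> \<Omega>\<^sub>2" "dist z x < R / 4" for x
  proof -
    obtain r where r: "0 < r" "r < R / 4" "cball x r \<subseteq> \<Omega>\<^sub>2" using small[OF o2(1) x(1)] by blast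
    have "restr \<Omega>\<^sub>2 (\<lambda>_. 1) y * mollifier G r x y = mollifier G r x y" for y
      using mollifier_outside[OF G r(1), of y x] r(3) by (cases "y \<in> cball x r") (auto simp: restr_def)
    then have "I r x = P" unfolding I_def using Pr[OF r(1,2), of x] by (simp only:)
    then show ?thesis using Iconst[OF r(1,2) x(2)] by simp
  qed
  have outside: "I q x = 0" if x: "x \<notin> closure \<Omega>\<^sub>2" "dist z x < R / 4" for x
  proof -
    obtain r where r: "0 < r" "r < R / 4" "cball x r \<subseteq> - closure \<Omega>\<^sub>2" using small[of "- closure \<Omega>\<^sub>2" x] x(1) by auto
    have "restr \<Omega>\<^sub>2 (\<lambda>_. 1) y * mollifier G r x y = 0" for y
    proof (cases "y \<in> cball x r")
      case True
      then have "y \<notin> \<Omega>\<^sub>2" using r(3) closure_subset by blast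
      then show ?thesis by (simp add: restr_def)
    next
      case False
      then have "mollifier G r x y = 0" by (rule mollifier_outside[OF G r(1)])
      then show ?thesis by simp
    qed
    then have "I r x = 0" unfolding I_def by (simp only: Bochner_Integration.integral_zero)
    then show ?thesis using Iconst[OF r(1,2) x(2)] by simp
  qed
  have cont: "(\<lambda>n. I q (X n)) \<longlonglongrightarrow> I q z" if X: "X \<longlonglongrightarrow> z" for X
  proof -
    obtain B where B: "\<And>c y. norm (mollifier G q (c::'a) y) \<le> B" using mollifier_bounded[OF G] by blast
    have cg: "continuous_on UNIV G" using G by (auto simp: radial_profile_def intro: smooth_continuous_on)
    show ?thesis
      unfolding I_def
    proof (rule integral_dominated_convergence[where w="\<lambda>y. norm (restr \<Omega>\<^sub>2 (\<lambda>_. 1 :: complex) y) * B"])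
      show "integrable lebesgue (\<lambda>y. norm (restr \<Omega>\<^sub>2 (\<lambda>_. 1 :: complex) y) * B)" using i1 by simp
      show "(\<lambda>y. restr \<Omega>\<^sub>2 (\<lambda>_. 1) y * mollifier G q z y) \<in> borel_measurable lebesgue"
        using i1 smooth_measurable_lebesgue[OF smooth_mollifier[OF G]] by (intro borel_measurable_times) auto
      show "(\<lambda>y. restr \<Omega>\<^sub>2 (\<lambda>_. 1) y * mollifier G q (X n) y) \<in> borel_measurable lebesgue" for n
        using i1 smooth_measurable_lebesgue[OF smooth_mollifier[OF G]] by (intro borel_measurable_times) auto
      show "AE y in lebesgue. norm (restr \<Omega>\<^sub>2 (\<lambda>_. 1) y * mollifier G q (X n) y) \<le> norm (restr \<Omega>\<^sub>2 (\<lambda>_. 1 :: complex) y) * B" for n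
        unfolding norm_mult by (intro always_eventually allI mult_left_mono B) auto
      show "AE y in lebesgue. (\<lambda>n. restr \<Omega>\<^sub>2 (\<lambda>_. 1) y * mollifier G q (X n) y) \<longlonglongrightarrow> restr \<Omega>\<^sub>2 (\<lambda>_. 1) y * mollifier G q z y"
      proof (intro always_eventually allI)
        fix y
        have "(\<lambda>n. G ((norm (y - X n))\<^sup>2 / q\<^sup>2)) \<longlonglongrightarrow> G ((norm (y - z))\<^sup>2 / q\<^sup>2)"
          by (rule continuous_on_tendsto_compose[OF cg]) (use q in \<open>auto intro!: tendsto_intros X\<close>)
        then show "(\<lambda>n. restr \<Omega>\<^sub>2 (\<lambda>_. 1) y * mollifier G q (X n) y) \<longlonglongrightarrow> restr \<Omega>\<^sub>2 (\<lambda>_. 1) y * mollifier G q z y"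
          unfolding mollifier_def radial_def by (intro tendsto_intros) (use q in auto)
      qed
    qed
  qed
  have limit: "I q z = l" if A: "z \<in> closure A" and val: "\<And>x. x \<in> A \<Longrightarrow> dist z x < R / 4 \<Longrightarrow> I q x = l" for A l
  proof -
    obtain X where X: "\<And>n. X n \<in> A" "X \<longlonglongrightarrow> z" using A closure_sequential by metis
    have "\<forall>\<^sub>F n in sequentially. dist (X n) z < R / 4" using X(2) R(1) by (intro tendstoD) auto
    then have "\<forall>\<^sub>F n in sequentially. I q (X n) = l"
      by eventually_elim (simp add: val X(1) dist_commute)
    then have "(\<lambda>n. I q (X n)) \<longlonglongrightarrow> l" by (rule tendsto_eventually)
    then show ?thesis using cont[OF X(2)] LIMSEQ_unique by blast
  qed
  have "z \<in> closure \<Omega>\<^sub>2" using z by (simp add: frontier_def)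
  then have "I q z = P" by (rule limit) (rule inside)
  moreover have "z \<in> closure (- closure \<Omega>\<^sub>2)"
    unfolding closure_iff_nhds_not_empty
  proof (intro allI impI)
    fix A V assume "V \<subseteq> A" "open V" "z \<in> V"
    then show "- closure \<Omega>\<^sub>2 \<inter> A \<noteq> {}"
      using graph_boundary_exterior[OF lip[unfolded lipschitz_boundary_def] z] by blast
  qed
  then have "I q z = 0" by (rule limit) (use outside in auto)
  ultimately show False using P0 by simp
qed

section \<open>From the weighted composition to a single isometry\<close>

theorem theorem5p8:
  fixes \<Omega>\<^sub>1 \<Omega>\<^sub>2 :: "'a::euclidean_space set"
    and U :: "('a \<Rightarrow> complex) \<Rightarrow> ('a \<Rightarrow> complex)"
  assumes dim: "DIM('a) \<ge> 2"
    and dom1: "open \<Omega>\<^sub>1" "bounded \<Omega>\<^sub>1" "connected \<Omega>\<^sub>1" "\<Omega>\<^sub>1 \<noteq> {}" "lipschitz_boundary \<Omega>\<^sub>1"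
    and dom2: "open \<Omega>\<^sub>2" "bounded \<Omega>\<^sub>2" "connected \<Omega>\<^sub>2" "\<Omega>\<^sub>2 \<noteq> {}" "lipschitz_boundary \<Omega>\<^sub>2"
    and U: "bounded_linear_C (closure \<Omega>\<^sub>1) (closure \<Omega>\<^sub>2) U"
    and a: "\<forall>f\<in>C (closure \<Omega>\<^sub>1). \<forall>g\<in>C (closure \<Omega>\<^sub>1).
              (\<forall>x\<in>closure \<Omega>\<^sub>1. f x * g x = 0) \<longrightarrow> (\<forall>x\<in>closure \<Omega>\<^sub>2. U f x * U g x = 0)"
    and b1: "\<exists>\<beta>. continuous_on (frontier \<Omega>\<^sub>2) \<beta> \<and> U ` test_functions \<Omega>\<^sub>1 \<subseteq> robin_domain \<Omega>\<^sub>2 \<beta>"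
    and b2: "\<forall>f\<in>test_functions \<Omega>\<^sub>1. distributional_laplacian \<Omega>\<^sub>2 (U f) (U (laplacian f))"
    and c: "\<forall>\<omega>. open \<omega> \<and> \<omega> \<subseteq> \<Omega>\<^sub>2 \<and> (\<forall>f\<in>test_functions \<Omega>\<^sub>1. \<forall>x\<in>\<omega>. U f x = 0) \<longrightarrow> \<omega> = {}"
    and C1: "C1_boundary \<Omega>\<^sub>1"
  shows "(\<exists>\<tau> c. is_isometry \<tau> \<and> \<tau> ` \<Omega>\<^sub>2 = \<Omega>\<^sub>1 \<and> c \<noteq> 0 \<and>
            (\<forall>f\<in>C (closure \<Omega>\<^sub>1). \<forall>x\<in>closure \<Omega>\<^sub>2. U f x = c * f (\<tau> x))) \<and>
         congruent_sets \<Omega>\<^sub>1 \<Omega>\<^sub>2"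
proof -
  let ?L = "closure \<Omega>\<^sub>2"
  have K: "compact (closure \<Omega>\<^sub>1)" "closure \<Omega>\<^sub>1 \<noteq> {}" "compact ?L"
    using dom1(2,4) dom2(2) by (auto simp: compact_closure)
  obtain h \<tau> where h: "continuous_on ?L h"
    and Uh: "\<And>f y. f \<in> C (closure \<Omega>\<^sub>1) \<Longrightarrow> y \<in> ?L \<Longrightarrow> U f y = h y * f (\<tau> y)"
    and \<tau>: "continuous_on {y \<in> ?L. h y \<noteq> 0} \<tau>"
    by (rule weighted_composition[OF K U a]) (rule that)
  define Y where "Y = {y \<in> \<Omega>\<^sub>2. h y \<noteq> 0 \<and> \<tau> y \<in> \<Omega>\<^sub>1}"
  have loc: "\<exists>e>0. ball y0 e \<subseteq> Y \<and> (\<forall>y\<in>ball y0 e. h y = h y0 \<and> (\<forall>y'\<in>ball y0 e. dist (\<tau> y) (\<tau> y') = dist y y'))"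
    if y0: "y0 \<in> Y" for y0
  proof -
    have y0': "y0 \<in> \<Omega>\<^sub>2" "h y0 \<noteq> 0" "\<tau> y0 \<in> \<Omega>\<^sub>1" using y0 by (auto simp: Y_def)
    obtain e where e: "e > 0" "ball y0 e \<subseteq> \<Omega>\<^sub>2" "\<And>y. y \<in> ball y0 e \<Longrightarrow> h y = h y0" "\<And>y. y \<in> ball y0 e \<Longrightarrow> \<tau> y \<in> \<Omega>\<^sub>1"
      "\<And>y y'. y \<in> ball y0 e \<Longrightarrow> y' \<in> ball y0 e \<Longrightarrow> dist (\<tau> y) (\<tau> y') = dist y y'"
      using intertwining_local_rigidity[OF dom1(1) dom2(1) h \<tau> Uh b2 y0'] by metis
    have "ball y0 e \<subseteq> Y"
    proof
      fix y assume y: "y \<in> ball y0 e"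
      have "h y \<noteq> 0" unfolding e(3)[OF y] by (rule y0'(2))
      then show "y \<in> Y" using e(2,4) y unfolding Y_def by blast
    qed
    then show ?thesis using e(1,3,5) by blast
  qed
  have oY: "open Y" using loc open_contains_ball by metis
  have YO: "Y \<subseteq> \<Omega>\<^sub>2" by (auto simp: Y_def)
  \<comment> \<open>Off the closure of \<open>Y\<close> either the weight vanishes or
    \<open>\<tau>\<close> takes values outside \<open>\<Omega>\<^sub>1\<close>, where test functions
    are \<open>0\<close>; hypothesis \<open>c\<close> excludes such an open set.\<close>
  have dense: "\<Omega>\<^sub>2 \<subseteq> closure Y"
  proof -
    have "U f x = 0" if f: "f \<in> test_functions \<Omega>\<^sub>1" and x: "x \<in> \<Omega>\<^sub>2 - closure Y" for f x
    proof -
      have sm: "smooth f" and out: "\<And>y. y \<notin> \<Omega>\<^sub>1 \<Longrightarrow> f y = 0" using test_functionE[OF f] by metis+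
      have "f \<in> C (closure \<Omega>\<^sub>1)" using smooth_continuous_on[OF sm] by (simp add: C_def)
      moreover have "x \<in> ?L" using x closure_subset by blast
      moreover have "x \<notin> Y" using x closure_subset by blast
      then have "h x = 0 \<or> \<tau> x \<notin> \<Omega>\<^sub>1" using x by (simp add: Y_def)
      ultimately show ?thesis using Uh[of f x] out by auto
    qed
    moreover have "open (\<Omega>\<^sub>2 - closure Y)" using dom2(1) by (intro open_Diff) auto
    ultimately have "\<Omega>\<^sub>2 - closure Y = {}" using c by blast
    then show ?thesis by blast
  qed
  have "\<exists>T k. is_isometry T \<and> (\<forall>y\<in>E. \<tau> y = T y) \<and> (\<forall>y\<in>E. h y = k)" if E: "E \<in> components Y" for E
  proof (rule isometry_global_of_local[OF in_components_connected[OF E] in_components_nonempty[OF E], of h \<tau>])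
    show "\<exists>e>0. \<forall>y\<in>ball y0 e. h y = h y0 \<and> (\<forall>y'\<in>ball y0 e. dist (\<tau> y) (\<tau> y') = dist y y')" if "y0 \<in> E" for y0
      using loc[of y0] in_components_subset[OF E] that by blast
  qed blast
  then obtain T k where T: "\<And>E. E \<in> components Y \<Longrightarrow> is_isometry (T E)"
    "\<And>E y. E \<in> components Y \<Longrightarrow> y \<in> E \<Longrightarrow> \<tau> y = T E y"
    "\<And>E y. E \<in> components Y \<Longrightarrow> y \<in> E \<Longrightarrow> h y = k E" by metis
  have clL: "closure E \<subseteq> ?L" if "E \<in> components Y" for E
    using in_components_subset[OF that] YO by (intro closure_mono) blast
  have k0: "k E \<noteq> 0" if E: "E \<in> components Y" for E
  proof -
    obtain y where y: "y \<in> E" using in_components_nonempty[OF E] by blast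
    then have "y \<in> Y" using in_components_subset[OF E] by blast
    then show ?thesis using T(3)[OF E y] by (simp add: Y_def)
  qed
  have hcl: "h z = k E" if E: "E \<in> components Y" and z: "z \<in> closure E" for E z
    by (rule continuous_constant_on_closure[OF continuous_on_subset[OF h clL[OF E]] T(3)[OF E] z])
  \<comment> \<open>The weight is the nonzero constant \<open>k E\<close> on the whole closure, so
    \<open>\<tau>\<close> is continuous there and the identity extends from
    \<open>E\<close>.\<close>
  have Tcl: "\<tau> z = T E z" if E: "E \<in> components Y" and z: "z \<in> closure E" for E z
  proof -
    have "closure E \<subseteq> {y \<in> ?L. h y \<noteq> 0}" using clL[OF E] hcl[OF E] k0[OF E] by auto
    then have "continuous_on (closure E) (\<lambda>y. \<tau> y - T E y)"
      by (intro continuous_intros continuous_on_subset[OF \<tau>] isometry_continuous T(1) E)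
    then have "\<tau> z - T E z = 0"
      by (rule continuous_constant_on_closure) (use T(2)[OF E] z in auto)
    then show ?thesis by simp
  qed
  \<comment> \<open>The conditions defining \<open>Y\<close> are relatively open in the closed
    domain, so they persist near boundary points as well.\<close>
  obtain A where A: "open A" "{y \<in> ?L. h y \<noteq> 0 \<and> \<tau> y \<in> \<Omega>\<^sub>1} = ?L \<inter> A"
  proof -
    obtain A1 where A1: "open A1" "?L \<inter> h -` (- {0}) = ?L \<inter> A1"
    proof -
      have "openin (top_of_set ?L) (?L \<inter> h -` (- {0}))"
        using h by (intro continuous_openin_preimage_gen) auto
      then show ?thesis using that by (auto simp: openin_open)
    qed
    let ?W = "{y \<in> ?L. h y \<noteq> 0}"
    obtain A2 where A2: "open A2" "?W \<inter> \<tau> -` \<Omega>\<^sub>1 = ?W \<inter> A2"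
    proof -
      have "openin (top_of_set ?W) (?W \<inter> \<tau> -` \<Omega>\<^sub>1)"
        using \<tau> dom1(1) by (intro continuous_openin_preimage_gen) auto
      then show ?thesis using that by (auto simp: openin_open)
    qed
    have "{y \<in> ?L. h y \<noteq> 0 \<and> \<tau> y \<in> \<Omega>\<^sub>1} = ?L \<inter> (A1 \<inter> A2)"
    proof (intro set_eqI)
      fix y
      have "y \<in> ?L \<and> h y \<noteq> 0 \<longleftrightarrow> y \<in> ?L \<and> y \<in> A1" using A1(2) by auto
      moreover have "y \<in> ?W \<and> \<tau> y \<in> \<Omega>\<^sub>1 \<longleftrightarrow> y \<in> ?W \<and> y \<in> A2" using A2(2) by blast
      ultimately show "y \<in> {y \<in> ?L. h y \<noteq> 0 \<and> \<tau> y \<in> \<Omega>\<^sub>1} \<longleftrightarrow> y \<in> ?L \<inter> (A1 \<inter> A2)" by auto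
    qed
    then show ?thesis by (rule that[OF open_Int[OF A1(1) A2(1)]])
  qed
  obtain \<beta> where \<beta>: "U ` test_functions \<Omega>\<^sub>1 \<subseteq> robin_domain \<Omega>\<^sub>2 \<beta>" using b1 by blast
  have Eq: "E = T E -` \<Omega>\<^sub>1" if E: "E \<in> components Y" for E
  proof (rule ccontr)
    assume ne: "E \<noteq> T E -` \<Omega>\<^sub>1"
    have sub: "E \<subseteq> T E -` \<Omega>\<^sub>1" using T(2)[OF E] in_components_subset[OF E] by (auto simp: Y_def)
    obtain S where S: "is_isometry S" "\<And>x. T E (S x) = x" "\<And>x. S (T E x) = x" using isometry_inverse[OF T(1)[OF E]] by metis
    have "T E -` \<Omega>\<^sub>1 = S ` \<Omega>\<^sub>1" using S(2,3) by (metis (no_types, lifting) image_eqI subsetI subset_antisym image_subset_iff vimage_eq)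
    then have "connected (T E -` \<Omega>\<^sub>1)"
      using connected_continuous_image[OF isometry_continuous[OF S(1)] dom1(3)] by simp
    \<comment> \<open>The preimage is connected and properly contains \<open>E\<close>, so it meets
      the boundary of \<open>E\<close>.\<close>
    then obtain z where z: "T E z \<in> \<Omega>\<^sub>1" "z \<in> frontier E"
      using connected_Int_frontier[of "T E -` \<Omega>\<^sub>1" E] sub ne in_components_nonempty[OF E] by blast
    have oE: "open E" by (rule open_components[OF oY E])
    have zE: "z \<in> closure E" "z \<notin> E" using z(2) oE by (auto simp: frontier_def interior_open)
    have zA: "z \<in> ?L \<inter> A"
    proof -
      have "h z \<noteq> 0" using hcl[OF E zE(1)] k0[OF E] by simp
      then show ?thesis using A(2) clL[OF E] zE(1) z(1) Tcl[OF E zE(1)] by auto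
    qed
    have meets: "V \<inter> E \<noteq> {}" if "open V" "z \<in> V" for V
      using zE(1) that open_Int_closure_eq_empty[OF that(1), of E] by blast
    show False
    proof (cases "z \<in> \<Omega>\<^sub>2")
      case True
      then have "z \<in> Y" using zA A(2) by (auto simp: Y_def)
      then obtain E' where E': "E' \<in> components Y" "z \<in> E'" using Union_components[of Y] by blast
      have "E' \<inter> E \<noteq> {}" by (rule meets[OF open_components[OF oY E'(1)] E'(2)])
      then have "E' = E" using components_nonoverlap[OF E'(1) E] by blast
      then show False using E'(2) zE(2) by simp
    next
      case False
      then have zf: "z \<in> frontier \<Omega>\<^sub>2" using zA dom2(1) by (simp add: frontier_def interior_open)
      \<comment> \<open>Near \<open>z\<close> the domain is a connected piece of \<open>Y\<close>
        that meets \<open>E\<close>, so it lies in \<open>E\<close>. Hence near \<open>z\<close> and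
        up to the boundary, \<open>U\<close> is a constant times composition with one isometry,
        which \<open>no_interior_contact\<close> excludes.\<close>
      obtain W where W: "open W" "z \<in> W" "W \<subseteq> A" "connected (W \<inter> \<Omega>\<^sub>2)"
        by (rule connected_near_boundary[OF dom2(5) zf A(1)]) (use zA in blast, rule that)
      have WY: "W \<inter> \<Omega>\<^sub>2 \<subseteq> Y"
        using A(2) W(3) closure_subset[of \<Omega>\<^sub>2] by (auto simp: Y_def)
      have "E \<inter> (W \<inter> \<Omega>\<^sub>2) \<noteq> {}" using meets[OF W(1,2)] in_components_subset[OF E] YO by blast
      then have WE: "W \<inter> \<Omega>\<^sub>2 \<subseteq> E" by (rule components_maximal[OF E W(4) WY])
      have cl: "y \<in> closure E" if "y \<in> ?L \<inter> W" for y
      proof -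
        have "y \<in> closure (W \<inter> \<Omega>\<^sub>2)" using open_Int_closure_subset[OF W(1), of \<Omega>\<^sub>2] that by blast
        then show ?thesis using closure_mono[OF WE] by blast
      qed
      show False
      proof (rule no_interior_contact[OF dom1(1) dom2(1,2,5) zf T(1)[OF E] z(1) k0[OF E] W(1,2) _ \<beta> b2])
        show "U f y = k E * f (T E y)" if "f \<in> C (closure \<Omega>\<^sub>1)" "y \<in> ?L \<inter> W" for f y
          using Uh[OF that(1), of y] hcl[OF E cl[OF that(2)]] Tcl[OF E cl[OF that(2)]] that(2) by simp
      qed
    qed
  qed
  have "Y \<noteq> {}" using dense dom2(4) by auto
  then obtain E where E: "E \<in> components Y" using Union_components[of Y] by blast
  have EO: "E = \<Omega>\<^sub>2"
  proof (rule dense_isometric_copies_single[OF dim dom1(1,4) C1 dom2(1,2,3,5) oY YO dense _ _ E, where T=T])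
    show "is_isometry (T E) \<and> E = T E -` \<Omega>\<^sub>1" if "E \<in> components Y" for E
      using T(1)[OF that] Eq[OF that] by blast
    show "T E z = T E' z" if "E \<in> components Y" "E' \<in> components Y" "z \<in> closure E" "z \<in> closure E'" for E E' z
      using Tcl[OF that(1,3)] Tcl[OF that(2,4)] by simp
  qed
  obtain S where S: "is_isometry S" "\<And>x. T E (S x) = x" "\<And>x. S (T E x) = x" using isometry_inverse[OF T(1)[OF E]] by metis
  have O2: "\<Omega>\<^sub>2 = T E -` \<Omega>\<^sub>1" using Eq[OF E] EO by simp
  have img: "T E ` \<Omega>\<^sub>2 = \<Omega>\<^sub>1"
  proof (intro equalityI subsetI)
    fix x assume "x \<in> \<Omega>\<^sub>1"
    then have "S x \<in> \<Omega>\<^sub>2" using O2 S(2)[of x] by simp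
    then show "x \<in> T E ` \<Omega>\<^sub>2" using S(2)[of x] by (metis imageI)
  qed (use O2 in auto)
  have "S ` \<Omega>\<^sub>1 = \<Omega>\<^sub>2" unfolding img[symmetric] image_image S(3) by simp
  then have "congruent_sets \<Omega>\<^sub>1 \<Omega>\<^sub>2" unfolding congruent_sets_def using S(1) by blast
  moreover have "U f x = k E * f (T E x)" if "f \<in> C (closure \<Omega>\<^sub>1)" "x \<in> ?L" for f x
    using Uh[OF that] hcl[OF E, of x] Tcl[OF E, of x] that(2) EO by simp
  ultimately show ?thesis using T(1)[OF E] img k0[OF E] by blast
qed

end
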